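(* There is a randomized (Monte-Carlo) algorithm that constructs a solution of the Dominating Matching Problem or of the Dominating f-factor Problem with the following properties. Its running time is bounded by a polynomial in $n$, the number of vertices of the input graph, whenever $\prod_{j=1}^{k}(m_j+1)=O(p(n))$ for some polynomial $p$ (which holds in particular if the number $k$ of prescribed edge sets stays bounded as $n$ grows). If the algorithm returns a construction, then it is a correct solution; and if a correct solution exists, the algorithm finds one with high probability.
   Context: Dominating Matching Problem: given a finite simple graph $G$, pairwise disjoint edge subsets $E'_1,\dots,E'_k\subseteq E(G)$ and nonnegative integers $m_1,\dots,m_k$, find a perfect matching $M$ of $G$ with $|M\cap E'_j|\ge m_j$ for every $j=1,\dots,k$. Dominating f-factor Problem: given a finite simple graph $G$ on vertices $v_1,\dots,v_n$, pairwise disjoint edge subsets $E_1,\dots,E_k\subseteq E(G)$, nonnegative integers $m_1,\dots,m_k$, and nonnegative integers $d_1,\dots,d_n$, find a spanning subgraph $G'$ of $G$ in which $v_i$ has degree $d_i$ for every $i$ and which contains at least $m_j$ edges of $E_j$ for every $j=1,\dots,k$. "With high probability" means with probability tending to $1$ as $n\to\infty$.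
   Formalization: The remark that the product bound holds for bounded k is proved only when m_j ≤ |E_j| for all j (it fails e.g. for k=1, m_1=2^n; other instances have no solution); polynomial running time for bounded k is proved for arbitrary m_j. *)

theory Defs
  imports "HOL-Probability.Probability" "HOL-Computational_Algebra.Polynomial"
begin

text \<open>The vertices are \<open>0, \<dots>, n - 1\<close>, an edge is a two-element set of vertices, and the list
  \<open>constraints\<close> consists of the pairs \<open>(E\<^sub>j, m\<^sub>j)\<close>, so that its length is \<open>k\<close>.\<close>

record dom_graph =
  nverts :: nat
  edges :: "nat set set"
  constraints :: "(nat set set \<times> nat) list"

definition prescribed :: "dom_graph \<Rightarrow> nat \<Rightarrow> nat set set" where
  "prescribed G j = fst (constraints G ! j)"

definition demand :: "dom_graph \<Rightarrow> nat \<Rightarrow> nat" where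
  "demand G j = snd (constraints G ! j)"

definition nsets :: "dom_graph \<Rightarrow> nat" where
  "nsets G = length (constraints G)"

definition wf_dom_graph :: "dom_graph \<Rightarrow> bool" where
  "wf_dom_graph G \<longleftrightarrow>
     edges G \<subseteq> {{u, v} | u v. u < nverts G \<and> v < nverts G \<and> u \<noteq> v} \<and>
     (\<forall>j<nsets G. prescribed G j \<subseteq> edges G) \<and>
     (\<forall>i<nsets G. \<forall>j<nsets G. i \<noteq> j \<longrightarrow> prescribed G i \<inter> prescribed G j = {})"

definition perfect_matching :: "dom_graph \<Rightarrow> nat set set \<Rightarrow> bool" where
  "perfect_matching G M \<longleftrightarrow>
     M \<subseteq> edges G \<and> (\<forall>e\<in>M. \<forall>e'\<in>M. e \<noteq> e' \<longrightarrow> e \<inter> e' = {}) \<and> \<Union>M = {..<nverts G}"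

definition vdegree :: "nat set set \<Rightarrow> nat \<Rightarrow> nat" where
  "vdegree F v = card {e \<in> F. v \<in> e}"

text \<open>A spanning subgraph is given by its edge set; \<open>d\<close> is the list of prescribed degrees.\<close>

definition f_factor :: "dom_graph \<Rightarrow> nat list \<Rightarrow> nat set set \<Rightarrow> bool" where
  "f_factor G d F \<longleftrightarrow> F \<subseteq> edges G \<and> (\<forall>v<nverts G. vdegree F v = d ! v)"

definition dominating :: "dom_graph \<Rightarrow> nat set set \<Rightarrow> bool" where
  "dominating G F \<longleftrightarrow> (\<forall>j<nsets G. demand G j \<le> card (F \<inter> prescribed G j))"

datatype problem =
    Dominating_Matching (graph: dom_graph)
  | Dominating_F_Factor (graph: dom_graph) "nat list"

fun wf_problem :: "problem \<Rightarrow> bool" where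
  "wf_problem (Dominating_Matching G) \<longleftrightarrow> wf_dom_graph G"
| "wf_problem (Dominating_F_Factor G d) \<longleftrightarrow> wf_dom_graph G \<and> length d = nverts G"

fun solves :: "nat set set \<Rightarrow> problem \<Rightarrow> bool" where
  "solves M (Dominating_Matching G) \<longleftrightarrow> perfect_matching G M \<and> dominating G M"
| "solves F (Dominating_F_Factor G d) \<longleftrightarrow> f_factor G d F \<and> dominating G F"

definition demand_product :: "dom_graph \<Rightarrow> nat" where
  "demand_product G = (\<Prod>j<nsets G. demand G j + 1)"

text \<open>Structured programs for a random access machine over the natural numbers with indirect
  addressing, addition and (truncated) subtraction under the uniform cost criterion. There is no
  multiplication: with it, the uniform cost criterion would no longer be polynomially related to
  Turing machine time. The memory consists of arrays, of which a program can only name finitely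
  many; a scalar variable is cell 0 of an array. Fair coin flips are read off an infinite random
  tape. Every elementary command and every test costs one unit; the expressions in a program have
  a fixed size, so this is machine time up to a constant factor that depends on the program only.\<close>

type_synonym mem = "nat \<Rightarrow> nat \<Rightarrow> nat"

datatype aexp =
    Const nat
  | Fetch nat aexp
  | Plus aexp aexp
  | Minus aexp aexp

datatype bexp =
    Less aexp aexp
  | Equal aexp aexp
  | Neg bexp
  | Conj bexp bexp

datatype com =
    Skip
  | Store nat aexp aexp
  | Flip nat aexp
  | Seq com com
  | Cond bexp com com
  | While bexp com

fun aval :: "aexp \<Rightarrow> mem \<Rightarrow> nat" where
  "aval (Const c) s = c"
| "aval (Fetch x a) s = s x (aval a s)"
| "aval (Plus a b) s = aval a s + aval b s"
| "aval (Minus a b) s = aval a s - aval b s"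

fun bval :: "bexp \<Rightarrow> mem \<Rightarrow> bool" where
  "bval (Less a b) s \<longleftrightarrow> aval a s < aval b s"
| "bval (Equal a b) s \<longleftrightarrow> aval a s = aval b s"
| "bval (Neg b) s \<longleftrightarrow> \<not> bval b s"
| "bval (Conj b c) s \<longleftrightarrow> bval b s \<and> bval c s"

definition upd :: "mem \<Rightarrow> nat \<Rightarrow> nat \<Rightarrow> nat \<Rightarrow> mem" where
  "upd s x i c = s(x := (s x)(i := c))"

text \<open>\<open>exec c s \<omega> t s' \<omega>'\<close>: started in memory \<open>s\<close> with random tape \<open>\<omega>\<close>, the program \<open>c\<close> halts after
  \<open>t\<close> steps in memory \<open>s'\<close>, leaving the unread tape \<open>\<omega>'\<close>.\<close>

inductive exec :: "com \<Rightarrow> mem \<Rightarrow> bool stream \<Rightarrow> nat \<Rightarrow> mem \<Rightarrow> bool stream \<Rightarrow> bool" where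
  Skip: "exec Skip s \<omega> 1 s \<omega>"
| Store: "exec (Store x a b) s \<omega> 1 (upd s x (aval a s) (aval b s)) \<omega>"
| Flip: "exec (Flip x a) s \<omega> 1 (upd s x (aval a s) (of_bool (shd \<omega>))) (stl \<omega>)"
| Seq: "exec c\<^sub>1 s\<^sub>1 \<omega>\<^sub>1 t\<^sub>1 s\<^sub>2 \<omega>\<^sub>2 \<Longrightarrow> exec c\<^sub>2 s\<^sub>2 \<omega>\<^sub>2 t\<^sub>2 s\<^sub>3 \<omega>\<^sub>3 \<Longrightarrow>
    exec (Seq c\<^sub>1 c\<^sub>2) s\<^sub>1 \<omega>\<^sub>1 (t\<^sub>1 + t\<^sub>2) s\<^sub>3 \<omega>\<^sub>3"
| Cond_True: "bval b s \<Longrightarrow> exec c\<^sub>1 s \<omega> t s' \<omega>' \<Longrightarrow> exec (Cond b c\<^sub>1 c\<^sub>2) s \<omega> (t + 1) s' \<omega>'"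
| Cond_False: "\<not> bval b s \<Longrightarrow> exec c\<^sub>2 s \<omega> t s' \<omega>' \<Longrightarrow> exec (Cond b c\<^sub>1 c\<^sub>2) s \<omega> (t + 1) s' \<omega>'"
| While_False: "\<not> bval b s \<Longrightarrow> exec (While b c) s \<omega> 1 s \<omega>"
| While_True: "bval b s\<^sub>1 \<Longrightarrow> exec c s\<^sub>1 \<omega>\<^sub>1 t\<^sub>1 s\<^sub>2 \<omega>\<^sub>2 \<Longrightarrow> exec (While b c) s\<^sub>2 \<omega>\<^sub>2 t\<^sub>2 s\<^sub>3 \<omega>\<^sub>3 \<Longrightarrow>
    exec (While b c) s\<^sub>1 \<omega>\<^sub>1 (t\<^sub>1 + t\<^sub>2 + 1) s\<^sub>3 \<omega>\<^sub>3"

inductive_cases exec_SkipE: "exec Skip s \<omega> t s' \<omega>'"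
inductive_cases exec_StoreE: "exec (Store x a b) s \<omega> t s' \<omega>'"
inductive_cases exec_FlipE: "exec (Flip x a) s \<omega> t s' \<omega>'"
inductive_cases exec_SeqE: "exec (Seq c\<^sub>1 c\<^sub>2) s \<omega> t s' \<omega>'"
inductive_cases exec_CondE: "exec (Cond b c\<^sub>1 c\<^sub>2) s \<omega> t s' \<omega>'"
inductive_cases exec_WhileE: "exec (While b c) s \<omega> t s' \<omega>'"

lemma exec_deterministic:
  "exec c s \<omega> t s' \<omega>' \<Longrightarrow> exec c s \<omega> u s'' \<omega>'' \<Longrightarrow> t = u \<and> s' = s'' \<and> \<omega>' = \<omega>''"
proof (induction arbitrary: u s'' \<omega>'' rule: exec.induct)
  case (Seq c\<^sub>1 s\<^sub>1 \<omega>\<^sub>1 t\<^sub>1 s\<^sub>2 \<omega>\<^sub>2 c\<^sub>2 t\<^sub>2 s\<^sub>3 \<omega>\<^sub>3)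
  from Seq.prems obtain u\<^sub>1 r \<rho> u\<^sub>2
    where u: "u = u\<^sub>1 + u\<^sub>2" and 1: "exec c\<^sub>1 s\<^sub>1 \<omega>\<^sub>1 u\<^sub>1 r \<rho>" and 2: "exec c\<^sub>2 r \<rho> u\<^sub>2 s'' \<omega>''"
    by (rule exec_SeqE)
  from Seq.IH(1)[OF 1] have eq: "t\<^sub>1 = u\<^sub>1" "s\<^sub>2 = r" "\<omega>\<^sub>2 = \<rho>" by simp_all
  from 2 have "exec c\<^sub>2 s\<^sub>2 \<omega>\<^sub>2 u\<^sub>2 s'' \<omega>''" unfolding eq .
  from Seq.IH(2)[OF this] show ?case unfolding u eq(1) by simp
next
  case (Cond_True b s c\<^sub>1 \<omega> t s' \<omega>' c\<^sub>2)
  from Cond_True.prems show ?case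
    by (rule exec_CondE) (use Cond_True.hyps(1) in \<open>simp_all add: Cond_True.IH\<close>)
next
  case (Cond_False b s c\<^sub>2 \<omega> t s' \<omega>' c\<^sub>1)
  from Cond_False.prems show ?case
    by (rule exec_CondE) (use Cond_False.hyps(1) in \<open>simp_all add: Cond_False.IH\<close>)
next
  case (While_True b s\<^sub>1 c \<omega>\<^sub>1 t\<^sub>1 s\<^sub>2 \<omega>\<^sub>2 t\<^sub>2 s\<^sub>3 \<omega>\<^sub>3)
  from While_True.prems obtain u\<^sub>1 r \<rho> u\<^sub>2
    where u: "u = u\<^sub>1 + u\<^sub>2 + 1" and 1: "exec c s\<^sub>1 \<omega>\<^sub>1 u\<^sub>1 r \<rho>"
      and 2: "exec (While b c) r \<rho> u\<^sub>2 s'' \<omega>''"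
    by (rule exec_WhileE) (use While_True.hyps(1) in simp_all)
  from While_True.IH(1)[OF 1] have eq: "t\<^sub>1 = u\<^sub>1" "s\<^sub>2 = r" "\<omega>\<^sub>2 = \<rho>" by simp_all
  from 2 have "exec (While b c) s\<^sub>2 \<omega>\<^sub>2 u\<^sub>2 s'' \<omega>''" unfolding eq .
  from While_True.IH(2)[OF this] show ?case unfolding u eq(1) by simp
next
  case (While_False b s c \<omega>)
  from While_False.prems show ?case
    by (rule exec_WhileE) (use While_False.hyps in simp_all)
qed (auto elim: exec_SkipE exec_StoreE exec_FlipE)

definition coin_tape :: "bool stream measure" where
  "coin_tape = stream_space (measure_pmf (bernoulli_pmf (1 / 2)))"

text \<open>The graph and the prescribed sets are given by an adjacency matrix (row by row) with entries
  0 for a non-edge, 1 for an edge in none of the sets, and \<open>j + 2\<close> for an edge in \<open>E\<^sub>j\<close>. The vector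
  of demands is given in sparse form, as the number of indices \<open>j\<close> with \<open>m\<^sub>j \<noteq> 0\<close> followed by the
  pairs \<open>j\<close>, \<open>m\<^sub>j\<close> for these \<open>j\<close>; in a dense listing, arbitrarily many vacuous demands \<open>m\<^sub>j = 0\<close>
  would make the input length unbounded in terms of \<open>n\<close> and the product of the \<open>m\<^sub>j + 1\<close>.\<close>

definition edge_label :: "dom_graph \<Rightarrow> nat \<Rightarrow> nat \<Rightarrow> nat" where
  "edge_label G u v =
     (if {u, v} \<notin> edges G then 0
      else if \<exists>j<nsets G. {u, v} \<in> prescribed G j
        then (THE j. j < nsets G \<and> {u, v} \<in> prescribed G j) + 2
      else 1)"

definition encode_matrix :: "dom_graph \<Rightarrow> nat list" where
  "encode_matrix G =
     concat (map (\<lambda>u. map (\<lambda>v. edge_label G u v) [0..<nverts G]) [0..<nverts G])"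

definition encode_demands :: "dom_graph \<Rightarrow> nat list" where
  "encode_demands G =
     (let js = filter (\<lambda>j. demand G j \<noteq> 0) [0..<nsets G]
      in length js # concat (map (\<lambda>j. [j, demand G j]) js))"

fun encode :: "problem \<Rightarrow> nat list" where
  "encode (Dominating_Matching G) = [0, nverts G] @ encode_matrix G @ encode_demands G"
| "encode (Dominating_F_Factor G d) = [1, nverts G] @ encode_matrix G @ d @ encode_demands G"

text \<open>The input is put into array 0. The output is read off array 1: a zero in cell 0 means that
  no construction is returned; otherwise cell 1 contains the length of the list of edges that
  follows, two cells per edge.\<close>

definition init_mem :: "nat list \<Rightarrow> mem" where
  "init_mem xs = (\<lambda>x i. if x = 0 \<and> i < length xs then xs ! i else 0)"

definition out_edges :: "mem \<Rightarrow> nat set set option" where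
  "out_edges s =
     (if s 1 0 = 0 then None
      else Some {{s 1 (2 * i + 2), s 1 (2 * i + 3)} | i. i < s 1 1})"

definition returns :: "com \<Rightarrow> problem \<Rightarrow> bool stream \<Rightarrow> nat set set \<Rightarrow> bool" where
  "returns A P \<omega> F \<longleftrightarrow>
     (\<exists>t s \<omega>'. exec A (init_mem (encode P)) \<omega> t s \<omega>' \<and> out_edges s = Some F)"

text \<open>The running time is the worst case over all outcomes of the coin flips.\<close>

definition halts_within :: "com \<Rightarrow> problem \<Rightarrow> real \<Rightarrow> bool" where
  "halts_within A P b \<longleftrightarrow>
     (\<forall>\<omega>. \<exists>t s \<omega>'. exec A (init_mem (encode P)) \<omega> t s \<omega>' \<and> real t \<le> b)"

end

theory Submission imports Defs "HOL-Computational_Algebra.Formal_Power_Series" "HOL-Library.Z2" begin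

text \<open>A perfect matching is an f-factor with all degrees 1. Replace every vertex \<open>u\<close> by \<open>n\<close> ports \<open>(u, v)\<close>
  and \<open>n - d u\<close> cores that are adjacent to all ports of \<open>u\<close>, and join \<open>(u, v)\<close> to \<open>(v, u)\<close> for every edge
  \<open>{u, v}\<close>: the perfect matchings of this graph project onto the f-factors. The edges between ports are
  doubled, and only the second copy counts towards a demand, so that ``at least \<open>m\<^sub>j\<close>'' becomes ``exactly
  \<open>m\<^sub>j\<close> counted edges''; the required numbers of edges are encoded in a single integer weight that is
  polynomial in \<open>n\<close> and the product of the \<open>m\<^sub>j + 1\<close>.

  By the isolation lemma of Mulmuley, Vazirani and Vazirani, random weights make the lightest solution
  unique with high probability. It can then be read off from the parities of the numbers of matchings
  of a given weight that avoid a given edge. As a candidate is returned only after it has been verified,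
  randomness affects completeness but not soundness.

  The parities need no determinants. In characteristic 2 the matching polynomial satisfies
  \<open>\<mu>(S \<union> {h}) = \<mu>(S) \<cdot> (1 + W)\<close>, where \<open>W\<close> is the generating function of the walks of positive length that start
  in \<open>h\<close> and stay in \<open>S\<close> afterwards, and walks are counted by dynamic programming.\<close>

section \<open>Matchings and walks in characteristic 2\<close>


text \<open>The walk identity is linear algebra. In characteristic 2 the vector of all
  \<open>mu (S - {u})\<close> solves a linear system with the symmetric matrix \<open>I + A\<close>,
  where \<open>A\<close> is the weighted adjacency matrix of \<open>S\<close>; the inverse of
  \<open>I + A\<close> is the series of powers of \<open>A\<close>, which counts walks. The machine
  cannot multiply, so large determinant entries are avoided: weights stay polynomially small and the
  program fills tables of bits indexed by weight. All matchings are counted, perfect or not.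
  Perfection, the exact class counts and the random tie-breaking are packed into the single weight
  \<open>random_weight + modulus * id_type\<close>, and \<open>modulus\<close> exceeds every sum of
  random weights, so the two parts of a total can be separated. The random sum of the lightest
  solution is unknown, hence every value below \<open>modulus\<close> is tried. At the right value
  exactly one matching has the required weight, so the number of those that avoid a given pair is 0
  if that matching uses the pair and 1 otherwise.\<close>

lemma bit_fps_add_self: "(f :: bit fps) + f = 0"
  by (rule fps_ext) simp

lemma bit_fps_add_cancel: "(f :: bit fps) + g + f = g"
  by (simp add: add.commute[of f g] add.assoc bit_fps_add_self)

text \<open>Every unordered pair occurs twice and cancels. The diagonal is excluded because its
  terms would occur only once.\<close>

lemma sum_symmetric_off_diagonal_bit_fps:
  fixes f :: "'a \<Rightarrow> 'a \<Rightarrow> bit fps"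
  assumes "finite U" "\<And>u x. f u x = f x u"
  shows "(\<Sum>u\<in>U. \<Sum>x\<in>U - {u}. f u x) = 0"
  using assms(1)
proof (induction U rule: finite_induct)
  case empty
  show ?case by simp
next
  case (insert v U)
  have "(\<Sum>u\<in>insert v U. \<Sum>x\<in>insert v U - {u}. f u x) =
      (\<Sum>x\<in>U. f v x) + (\<Sum>u\<in>U. \<Sum>x\<in>insert v U - {u}. f u x)"
    using insert.hyps by simp
  also have "(\<Sum>u\<in>U. \<Sum>x\<in>insert v U - {u}. f u x) = (\<Sum>u\<in>U. f v u + (\<Sum>x\<in>U - {u}. f u x))"
  proof (rule sum.cong[OF refl])
    fix u assume u: "u \<in> U"
    then have "insert v U - {u} = insert v (U - {u})" using insert.hyps by auto
    then show "(\<Sum>x\<in>insert v U - {u}. f u x) = f v u + (\<Sum>x\<in>U - {u}. f u x)"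
      using insert.hyps by (simp add: assms(2)[of u v])
  qed
  also have "\<dots> = (\<Sum>u\<in>U. f v u)" using insert.IH by (simp add: sum.distrib)
  finally show ?case by (simp add: bit_fps_add_self)
qed

text \<open>Edges are abstract indices, so parallel edges stay distinct, as the two copies of a port
  edge require. Positive weights give \<open>mu\<close> the constant coefficient 1 and make the test
  \<open>0 < w k\<close> in the walk recursion succeed for every edge.\<close>

locale weighted_multigraph =
  fixes K :: "'e set" and s t w :: "'e \<Rightarrow> nat"
  assumes finite_K: "finite K"
    and no_loop: "k \<in> K \<Longrightarrow> s k \<noteq> t k"
    and weight_pos: "k \<in> K \<Longrightarrow> 0 < w k"
begin

definition ends :: "'e \<Rightarrow> nat set" where
  "ends k = {s k, t k}"

definition matchings :: "nat set \<Rightarrow> 'e set set" where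
  "matchings S = {M. M \<subseteq> K \<and> (\<forall>k\<in>M. ends k \<subseteq> S) \<and>
     (\<forall>k\<in>M. \<forall>l\<in>M. k \<noteq> l \<longrightarrow> ends k \<inter> ends l = {})}"

text \<open>The coefficient at \<open>x\<close> is the parity of the number of matchings of weight
  \<open>x\<close>.\<close>

definition mu :: "nat set \<Rightarrow> bit fps" where
  "mu S = (\<Sum>M\<in>matchings S. fps_X ^ sum w M)"

definition adj :: "nat \<Rightarrow> nat \<Rightarrow> bit fps" where
  "adj u v = (\<Sum>k\<in>{k\<in>K. ends k = {u, v}}. fps_X ^ w k)"

lemma finite_matchings: "finite (matchings S)"
  by (rule finite_subset[of _ "Pow K"]) (auto simp: matchings_def finite_K)

lemma adj_commute: "adj u v = adj v u"
  by (simp add: adj_def insert_commute)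

lemma adj_self: "adj v v = 0"
proof -
  have "ends k \<noteq> {v, v}" if "k \<in> K" for k
    using no_loop[OF that] by (auto simp: ends_def doubleton_eq_iff)
  then have "{k\<in>K. ends k = {v, v}} = {}" by blast
  then show ?thesis unfolding adj_def by (simp only: sum.empty)
qed

lemma mu_empty: "mu {} = 1"
proof -
  have "matchings {} = {{}}" by (auto simp: matchings_def ends_def)
  then show ?thesis by (simp add: mu_def)
qed

text \<open>Either \<open>v\<close> is unmatched, or exactly one edge \<open>k\<close> of the
  matching joins it to some \<open>u\<close>, and removing \<open>k\<close> leaves a matching that
  avoids both. The characteristic does not enter here.\<close>

lemma mu_expand:
  assumes "finite S" "v \<in> S"
  shows "mu S = mu (S - {v}) + (\<Sum>u\<in>S - {v}. adj v u * mu (S - {v} - {u}))"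
proof -
  \<comment> \<open>The edge \<open>k\<close> is recorded besides \<open>u\<close>, because parallel
    edges yield different matchings.\<close>
  define I where "I = (SIGMA u:S - {v}. SIGMA k:{k\<in>K. ends k = {v, u}}. matchings (S - {v} - {u}))"
  define J where "J = {M\<in>matchings S. \<exists>k\<in>M. v \<in> ends k}"
  have split: "matchings S = matchings (S - {v}) \<union> J"
    by (auto simp: matchings_def J_def)
  have disj: "matchings (S - {v}) \<inter> J = {}"
    by (auto simp: matchings_def J_def)
  have finJ: "finite J" using finite_matchings[of S] by (simp add: J_def)
  have notin: "k \<notin> M" if "(u, k, M) \<in> I" for u k M
    using that by (auto simp: I_def matchings_def ends_def)
  have inj: "inj_on (\<lambda>(u, k, M). insert k M) I"
  proof (rule inj_onI)
    fix p p' assume p: "p \<in> I" "p' \<in> I"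
      "(\<lambda>(u, k, M). insert k M) p = (\<lambda>(u, k, M). insert k M) p'"
    obtain u k M u' k' M' where pp: "p = (u, k, M)" "p' = (u', k', M')" by (metis prod_cases3)
    have a: "(u, k, M) \<in> I" "(u', k', M') \<in> I" "insert k M = insert k' M'"
      using p by (auto simp: pp)
    have v: "v \<in> ends k" "v \<in> ends k'" using a by (auto simp: I_def)
    have nv: "v \<notin> ends l" if "l \<in> M \<or> l \<in> M'" for l
      using a that by (auto simp: I_def matchings_def)
    have "k \<in> insert k' M'" using a(3) by blast
    then have kk: "k = k'" using v nv by blast
    have "M = M'" using a(3) notin[OF a(1)] notin[OF a(2)] unfolding kk by (simp add: insert_ident)
    moreover have "u = u'" using a(1,2) kk by (auto simp: I_def doubleton_eq_iff)
    ultimately show "p = p'" using kk by (simp add: pp)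
  qed
  have img: "(\<lambda>(u, k, M). insert k M) ` I = J"
  proof (intro equalityI subsetI)
    fix x assume "x \<in> (\<lambda>(u, k, M). insert k M) ` I"
    then obtain u k M where x: "x = insert k M" and i: "(u, k, M) \<in> I" by auto
    have u: "u \<in> S" "k \<in> K" "ends k = {v, u}" and M: "M \<in> matchings (S - {v} - {u})"
      using i by (auto simp: I_def)
    have "M \<subseteq> K" and 1: "ends l \<subseteq> S - {v} - {u}" if "l \<in> M" for l using M that by (auto simp: matchings_def)
    moreover have "ends l \<inter> ends k = {}" "ends k \<inter> ends l = {}" if "l \<in> M" for l using 1[OF that] u by auto
    moreover have "\<forall>k\<in>M. \<forall>l\<in>M. k \<noteq> l \<longrightarrow> ends k \<inter> ends l = {}" using M by (simp add: matchings_def)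
    ultimately have "insert k M \<in> matchings S"
      unfolding matchings_def using u assms(2) M by (auto simp: matchings_def)
    then show "x \<in> J" unfolding x J_def using u by auto
  next
    fix x assume x: "x \<in> J"
    then obtain k where k: "k \<in> x" "v \<in> ends k" and xm: "x \<in> matchings S" by (auto simp: J_def)
    have kK: "k \<in> K" and kS: "ends k \<subseteq> S" using xm k by (auto simp: matchings_def)
    obtain u where u: "ends k = {v, u}" "u \<noteq> v"
      using k(2) no_loop[OF kK] unfolding ends_def by (metis doubleton_eq_iff insert_iff singletonD)
    have "x - {k} \<in> matchings (S - {v} - {u})"
    proof -
      have "ends l \<inter> {v, u} = {}" if "l \<in> x - {k}" for l
        using xm k(1) that unfolding u(1)[symmetric] by (auto simp: matchings_def)
      then show ?thesis using xm by (auto simp: matchings_def)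
    qed
    moreover have "insert k (x - {k}) = x" using k by auto
    ultimately show "x \<in> (\<lambda>(u, k, M). insert k M) ` I"
      using u kK kS by (intro image_eqI[of _ _ "(u, k, x - {k})"]) (auto simp: I_def)
  qed
  have "(\<Sum>M\<in>J. fps_X ^ sum w M) = (\<Sum>(u, k, M)\<in>I. fps_X ^ sum w (insert k M) :: bit fps)"
    unfolding img[symmetric] by (subst sum.reindex[OF inj]) (simp add: case_prod_unfold comp_def)
  also have "\<dots> = (\<Sum>(u, k, M)\<in>I. fps_X ^ w k * fps_X ^ sum w M)"
  proof (rule sum.cong[OF refl], clarify)
    fix u k M assume i: "(u, k, M) \<in> I"
    have "finite M" using i finite_K finite_subset by (auto simp: I_def matchings_def)
    then show "fps_X ^ sum w (insert k M) = (fps_X ^ w k * fps_X ^ sum w M :: bit fps)"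
      using notin[OF i] by (simp add: power_add)
  qed
  also have "\<dots> = (\<Sum>u\<in>S - {v}. \<Sum>k\<in>{k\<in>K. ends k = {v, u}}. \<Sum>M\<in>matchings (S - {v} - {u}).
      fps_X ^ w k * fps_X ^ sum w M)"
    unfolding I_def using assms(1) finite_K finite_matchings
    by (simp add: sum.Sigma case_prod_unfold)
  also have "\<dots> = (\<Sum>u\<in>S - {v}. adj v u * mu (S - {v} - {u}))"
    by (simp add: adj_def mu_def sum_product)
  finally show ?thesis
    unfolding mu_def[of S] split using disj finJ finite_matchings
    by (subst sum.union_disjoint) (auto simp: mu_def)
qed

text \<open>If \<open>mu (S - {u})\<close> is expanded at \<open>v\<close>, then the terms in which \<open>v\<close> has a second neighbour are symmetric
  in the two neighbours and cancel.\<close>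

lemma mu_deletion_system:
  assumes "finite S" "v \<in> S"
  shows "mu S = mu (S - {v}) + (\<Sum>u\<in>S. adj v u * mu (S - {u}))"
proof -
  define U where "U = S - {v}"
  have fU: "finite U" using assms by (simp add: U_def)
  have "(\<Sum>u\<in>S. adj v u * mu (S - {u})) = (\<Sum>u\<in>U. adj v u * mu (S - {u}))"
    unfolding U_def using assms by (simp add: sum.remove adj_self)
  also have "\<dots> = (\<Sum>u\<in>U. adj v u * mu (U - {u})
      + (\<Sum>x\<in>U - {u}. adj v u * (adj v x * mu (S - {v, u, x}))))"
  proof (rule sum.cong[OF refl])
    fix u assume u: "u \<in> U"
    have e: "S - {u} - {v} = U - {u}" "S - {u} - {v} - {x} = S - {v, u, x}" for x by (auto simp: U_def)
    have "mu (S - {u}) = mu (S - {u} - {v}) +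
        (\<Sum>x\<in>S - {u} - {v}. adj v x * mu (S - {u} - {v} - {x}))"
      using u assms by (intro mu_expand) (auto simp: U_def)
    then show "adj v u * mu (S - {u}) = adj v u * mu (U - {u})
        + (\<Sum>x\<in>U - {u}. adj v u * (adj v x * mu (S - {v, u, x})))"
      unfolding e(2) unfolding e(1) by (simp add: distrib_left sum_distrib_left)
  qed
  also have "\<dots> = (\<Sum>u\<in>U. adj v u * mu (U - {u}))
      + (\<Sum>u\<in>U. \<Sum>x\<in>U - {u}. adj v u * (adj v x * mu (S - {v, u, x})))"
    by (simp add: sum.distrib)
  also have "(\<Sum>u\<in>U. \<Sum>x\<in>U - {u}. adj v u * (adj v x * mu (S - {v, u, x}))) = 0"
    by (rule sum_symmetric_off_diagonal_bit_fps[OF fU]) (simp add: insert_commute mult.left_commute)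
  finally show ?thesis using mu_expand[OF assms] by (simp add: U_def)
qed

text \<open>Only the empty matching has weight 0, so the constant coefficient is 1. As power series
  over a field form an integral domain, \<open>mu S\<close> can be cancelled.\<close>

lemma mu_nonzero: "finite S \<Longrightarrow> mu S \<noteq> 0"
proof -
  assume "finite S"
  have e: "{} \<in> matchings S" by (simp add: matchings_def)
  have "fps_nth (mu S) 0 = (\<Sum>M\<in>matchings S. if M = {} then 1 else 0)"
    unfolding mu_def fps_sum_nth
  proof (rule sum.cong[OF refl])
    fix M assume M: "M \<in> matchings S"
    then have MK: "M \<subseteq> K" and fM: "finite M" using finite_K finite_subset by (auto simp: matchings_def)
    have "M \<noteq> {} \<Longrightarrow> sum w M > 0" using MK fM weight_pos by (intro sum_pos) blast+
    then show "fps_nth (fps_X ^ sum w M) 0 = (if M = {} then 1 else 0 :: bit)"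
      by (cases "M = {}") (simp_all add: fps_X_power_nth)
  qed
  also have "\<dots> = 1" using e finite_matchings[of S] by (subst sum.delta) auto
  finally show ?thesis by auto
qed

text \<open>The coefficient matrix of the system for \<open>E\<close> is symmetric and occurs in \<open>mu_deletion_system\<close> as well;
  multiplying either system by the solution of the other one yields the sum of \<open>E\<close>.\<close>

lemma mu_insert_by_walks:
  assumes "finite S" "h \<notin> S"
    and E: "\<And>c. c \<in> S \<Longrightarrow> E c = (\<Sum>a\<in>S. adj c a * E a) + adj c h * mu S"
  shows "mu (insert h S) = mu S + (\<Sum>c\<in>S. E c)"
proof -
  have 1: "(\<Sum>c\<in>S. E c) * mu S = (\<Sum>c\<in>S. E c * mu (S - {c})) + (\<Sum>c\<in>S. \<Sum>u\<in>S. E c * adj c u * mu (S - {u}))"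
    unfolding sum_distrib_right sum.distrib[symmetric]
    by (rule sum.cong[OF refl], subst mu_deletion_system[OF assms(1)])
       (simp_all add: distrib_left sum_distrib_left mult.assoc)
  also have "(\<Sum>c\<in>S. E c * mu (S - {c})) =
      (\<Sum>u\<in>S. \<Sum>c\<in>S. E c * adj c u * mu (S - {u})) + (\<Sum>u\<in>S. adj u h * mu S * mu (S - {u}))"
    unfolding sum.distrib[symmetric]
  proof (rule sum.cong[OF refl])
    fix u assume "u \<in> S"
    then have "E u * mu (S - {u}) = (\<Sum>c\<in>S. E c * adj u c * mu (S - {u})) + adj u h * mu S * mu (S - {u})"
      by (subst E, assumption) (simp only: distrib_right sum_distrib_right mult.commute[of "E _"])
    moreover have "(\<Sum>c\<in>S. E c * adj u c * mu (S - {u})) = (\<Sum>c\<in>S. E c * adj c u * mu (S - {u}))"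
      by (rule sum.cong[OF refl]) (metis adj_commute)
    ultimately show "E u * mu (S - {u}) = (\<Sum>c\<in>S. E c * adj c u * mu (S - {u})) + adj u h * mu S * mu (S - {u})"
      by (simp only:)
  qed
  also have "(\<Sum>u\<in>S. \<Sum>c\<in>S. E c * adj c u * mu (S - {u})) = (\<Sum>c\<in>S. \<Sum>u\<in>S. E c * adj c u * mu (S - {u}))"
    by (rule sum.swap)
  \<comment> \<open>The same double sum arises from both systems, once with rows and columns
    exchanged, and vanishes in characteristic 2.\<close>
  finally have "(\<Sum>c\<in>S. E c) * mu S = (\<Sum>u\<in>S. adj u h * mu S * mu (S - {u}))"
    by (simp only: bit_fps_add_cancel)
  also have "\<dots> = (\<Sum>u\<in>S. adj h u * mu (S - {u})) * mu S"
    unfolding sum_distrib_right by (rule sum.cong[OF refl]) (simp add: adj_commute[of h] ac_simps)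
  finally have "(\<Sum>c\<in>S. E c) = (\<Sum>u\<in>S. adj h u * mu (S - {u}))"
    using mu_nonzero[OF assms(1)] by simp
  \<comment> \<open>The sum just obtained is exactly the part of the expansion of
    \<open>mu (insert h S)\<close> at \<open>h\<close> in which \<open>h\<close> is matched.\<close>
  then show ?thesis
    using mu_expand[of "insert h S" h] assms by (simp add: insert_Diff_if)
qed

end

text \<open>\<open>walk_count K s t w D h x c\<close> counts the walks of weight \<open>x\<close> from \<open>h\<close> to \<open>c\<close> that stay below \<open>h\<close>
  after their start, where a start with an initial weight \<open>y\<close> is counted \<open>D y\<close> times.\<close>

function walk_count :: "'e set \<Rightarrow> ('e \<Rightarrow> nat) \<Rightarrow> ('e \<Rightarrow> nat) \<Rightarrow> ('e \<Rightarrow> nat) \<Rightarrow> (nat \<Rightarrow> nat) \<Rightarrow> nat \<Rightarrow> nat \<Rightarrow> nat \<Rightarrow> nat" where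
  "walk_count K s t w D h x c = (if c = h then D x else 0) +
     (\<Sum>k\<in>K. if w k \<le> x \<and> 0 < w k then
        (if t k = c \<and> c < h then walk_count K s t w D h (x - w k) (s k) else 0) +
        (if s k = c \<and> c < h then walk_count K s t w D h (x - w k) (t k) else 0) else 0)"
  by auto
termination
  by (relation "Wellfounded.measure (\<lambda>(K, s, t, w, D, h, x, c). x)") auto

declare walk_count.simps [simp del]

text \<open>The multiplication by \<open>1 + W\<close> is never carried out: the table for
  \<open>h\<close> supplies the initial weights of the walks from \<open>h\<close>, so that the sum
  over all end points below \<open>h\<close> is already the product with \<open>W\<close>.\<close>

fun walk_seq_count :: "'e set \<Rightarrow> ('e \<Rightarrow> nat) \<Rightarrow> ('e \<Rightarrow> nat) \<Rightarrow> ('e \<Rightarrow> nat) \<Rightarrow> nat \<Rightarrow> nat \<Rightarrow> nat" where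
  "walk_seq_count K s t w 0 x = (if x = 0 then 1 else 0)"
| "walk_seq_count K s t w (Suc h) x = walk_seq_count K s t w h x +
     (\<Sum>c<h. walk_count K s t w (walk_seq_count K s t w h) h x c)"

lemma walk_count_start: "walk_count K s t w D h x h = D x"
  by (subst walk_count.simps) (auto intro!: sum.neutral)

lemma walk_count_above: "h < c \<Longrightarrow> walk_count K s t w D h x c = 0"
  by (subst walk_count.simps) (auto intro!: sum.neutral)

lemma of_nat_bit_eq_odd: "(of_nat n :: bit) = of_bool (odd n)"
  by (induction n) auto

context weighted_multigraph
begin

text \<open>Split a walk at its last edge. Walks never return to \<open>h\<close>, so a last edge
  that leaves \<open>h\<close> follows a bare start, which produces the inhomogeneous term
  \<open>adj c h * m\<close>.\<close>

lemma walk_count_linear_system: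
  assumes D: "\<And>x. of_nat (D x) = fps_nth m x" and c: "c < h"
    and E: "\<And>c. E c = Abs_fps (\<lambda>x. of_nat (walk_count K s t w D h x c) :: bit)"
  shows "E c = (\<Sum>a<h. adj c a * E a) + adj c h * m"
proof (rule fps_ext)
  fix x
  have Eh: "E h = m" by (rule fps_ext) (simp add: E walk_count_start D)
  define f where "f k a = (if w k \<le> x then of_nat (walk_count K s t w D h (x - w k) a) else (0 :: bit))" for k a
  define g where "g k a = (if w k \<le> x then walk_count K s t w D h (x - w k) a else 0)" for k a
  have f_g: "f k a = of_nat (g k a)" for k a by (simp add: f_def g_def)
  have f_above: "f k a = 0" if "h < a" for k a using that by (simp add: f_def walk_count_above)
  have nth: "fps_nth (adj c a * E a) x = (\<Sum>k\<in>K. if ends k = {c, a} then f k a else 0)" for a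
  proof -
    have "fps_nth (adj c a * E a) x = (\<Sum>k\<in>{k\<in>K. ends k = {c, a}}. f k a)"
      unfolding adj_def sum_distrib_right fps_sum_nth
      by (rule sum.cong[OF refl]) (auto simp: fps_X_power_mult_nth E f_def)
    then show ?thesis using finite_K by (simp add: sum.inter_filter)
  qed
  have inner: "(\<Sum>a<Suc h. if ends k = {c, a} then f k a else 0) =
      (if t k = c then f k (s k) else 0) + (if s k = c then f k (t k) else 0)" if k: "k \<in> K" for k
  proof -
    have st: "s k \<noteq> t k" by (rule no_loop[OF k])
    have delta: "(\<Sum>a<Suc h. if a = b then f k a else 0) = f k b" for b
      using f_above[of b k] by (cases "b < Suc h") (auto simp: sum.delta)
    consider "t k = c" | "s k = c" "t k \<noteq> c" | "s k \<noteq> c" "t k \<noteq> c" by blast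
    then show ?thesis
    proof cases
      case 1
      then have "(ends k = {c, a}) = (a = s k)" for a using st by (auto simp: ends_def doubleton_eq_iff)
      then show ?thesis using 1 st delta[of "s k"] by simp
    next
      case 2
      then have "(ends k = {c, a}) = (a = t k)" for a using st by (auto simp: ends_def doubleton_eq_iff)
      then show ?thesis using 2 st delta[of "t k"] by simp
    next
      case 3
      then have "(ends k = {c, a}) = False" for a using st by (auto simp: ends_def doubleton_eq_iff)
      then show ?thesis using 3 by simp
    qed
  qed
  have "fps_nth ((\<Sum>a<h. adj c a * E a) + adj c h * m) x = (\<Sum>a<Suc h. fps_nth (adj c a * E a) x)"
    by (simp add: fps_sum_nth Eh)
  also have "\<dots> = (\<Sum>k\<in>K. \<Sum>a<Suc h. if ends k = {c, a} then f k a else 0)"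
    unfolding nth by (rule sum.swap)
  also have "\<dots> = (\<Sum>k\<in>K. (if t k = c then f k (s k) else 0) + (if s k = c then f k (t k) else 0))"
    by (rule sum.cong[OF refl inner])
  also have "\<dots> = of_nat (\<Sum>k\<in>K. (if t k = c then g k (s k) else 0) + (if s k = c then g k (t k) else 0))"
    unfolding f_g by (simp only: of_nat_sum of_nat_add if_distrib[of of_nat] of_nat_0)
  also have "(\<Sum>k\<in>K. (if t k = c then g k (s k) else 0) + (if s k = c then g k (t k) else 0)) =
      walk_count K s t w D h x c"
    unfolding walk_count.simps[of K s t w D h x c] g_def using c
    by simp (rule sum.cong[OF refl], simp add: weight_pos)
  finally show "fps_nth (E c) x = fps_nth ((\<Sum>a<h. adj c a * E a) + adj c h * m) x"
    by (simp add: E)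
qed

lemma walk_seq_count_eq_mu: "of_nat (walk_seq_count K s t w h x) = fps_nth (mu {..<h}) x"
proof (induction h arbitrary: x)
  case 0
  show ?case by (simp add: mu_empty)
next
  case (Suc h)
  define D where "D = walk_seq_count K s t w h"
  define E where "E c = Abs_fps (\<lambda>x. of_nat (walk_count K s t w D h x c) :: bit)" for c
  have "E c = (\<Sum>a<h. adj c a * E a) + adj c h * mu {..<h}" if "c \<in> {..<h}" for c
    by (rule walk_count_linear_system[of D]) (use that in \<open>auto simp: D_def Suc.IH E_def\<close>)
  then have "mu (insert h {..<h}) = mu {..<h} + (\<Sum>c<h. E c)"
    by (intro mu_insert_by_walks) auto
  then show ?case
    by (simp only: walk_seq_count.simps lessThan_Suc of_nat_add of_nat_sum Suc.IH fps_add_nth fps_sum_nth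
        E_def D_def fps_nth_Abs_fps)
qed

text \<open>Only the parity of the walk count is meaningful for matchings, which is why the program
  keeps single bits.\<close>

lemma walk_seq_count_parity:
  "walk_seq_count K s t w h x mod 2 = card {M \<in> matchings {..<h}. sum w M = x} mod 2"
proof -
  have "of_nat (walk_seq_count K s t w h x) = (of_nat (card {M \<in> matchings {..<h}. sum w M = x}) :: bit)"
    using finite_matchings[of "{..<h}"]
    unfolding walk_seq_count_eq_mu mu_def fps_sum_nth fps_X_power_nth
    by (simp add: sum.inter_filter[symmetric] eq_commute[of x])
  then have "odd (walk_seq_count K s t w h x) = odd (card {M \<in> matchings {..<h}. sum w M = x})"
    unfolding of_nat_bit_eq_odd of_bool_eq_iff .
  then show ?thesis by (simp add: mod2_eq_if)
qed

end

section \<open>The isolation lemma on the random tape\<close>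

text \<open>Most significant bit first, in agreement with a loop that doubles an accumulator and
  adds the next coin.\<close>

definition bin :: "bool list \<Rightarrow> nat" where
  "bin bs = foldl (\<lambda>a b. a + a + of_bool b) 0 bs"

lemma bin_Nil [simp]: "bin [] = 0"
  by (simp add: bin_def)

lemma bin_snoc [simp]: "bin (bs @ [b]) = bin bs + bin bs + of_bool b"
  by (simp add: bin_def)

lemma bin_less: "bin bs < 2 ^ length bs"
  by (induction bs rule: rev_induct) auto

lemma bin_inj: "length bs = length bs' \<Longrightarrow> bin bs = bin bs' \<Longrightarrow> bs = bs'"
proof (induction bs arbitrary: bs' rule: rev_induct)
  case Nil
  then show ?case by simp
next
  case (snoc b bs)
  obtain c cs where bs': "bs' = cs @ [c]"
    using snoc.prems(1) by (cases bs' rule: rev_cases) auto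
  have "of_bool b = (of_bool c :: nat)" "bin bs = bin cs"
    using snoc.prems(2) unfolding bs' bin_snoc by (cases b; cases c; simp; presburger)+
  then show ?case using snoc.IH[of cs] snoc.prems(1) bs' by (simp add: of_bool_eq_iff)
qed

definition block :: "nat \<Rightarrow> nat \<Rightarrow> bool list \<Rightarrow> bool list" where
  "block r k bs = take r (drop (k * r) bs)"

definition isolating :: "nat set set \<Rightarrow> (nat \<Rightarrow> nat) \<Rightarrow> bool" where
  "isolating \<F> w \<longleftrightarrow> (\<exists>M\<in>\<F>. \<forall>M'\<in>\<F>. M' \<noteq> M \<longrightarrow> sum w M < sum w M')"

lemma block_middle:
  assumes "length u = k * r" "length v = r"
  shows "block r k (u @ v @ x) = v"
    and "l \<noteq> k \<Longrightarrow> length v' = r \<Longrightarrow> block r l (u @ v @ x) = block r l (u @ v' @ x)"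
proof -
  show "block r k (u @ v @ x) = v" using assms by (simp add: block_def)
  assume l: "l \<noteq> k" and v': "length v' = r"
  show "block r l (u @ v @ x) = block r l (u @ v' @ x)"
  proof (cases "l < k")
    case True
    then have "(l + 1) * r \<le> k * r" by (intro mult_le_mono1) simp
    then have "r \<le> k * r - l * r" by simp
    then show ?thesis using assms v' by (simp add: block_def)
  next
    case False
    then have "(k + 1) * r \<le> l * r" using l by (intro mult_le_mono1) simp
    then have "r + k * r \<le> l * r" by simp
    then show ?thesis using assms v' by (simp add: block_def)
  qed
qed

text \<open>If some element \<open>k\<close> lies in one minimal set but not in another, then the weight of \<open>k\<close> is
  determined by the other weights.\<close>

lemma card_not_isolating:
  assumes fam: "finite \<F>" "\<F> \<noteq> {}" "\<And>M. M \<in> \<F> \<Longrightarrow> M \<subseteq> {..<m}"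
  shows "card {bs. length bs = m * r \<and> \<not> isolating \<F> (\<lambda>k. bin (block r k bs))} * 2 ^ r \<le> m * 2 ^ (m * r)"
    (is "card ?bad * _ \<le> _")
proof -
  define w where "w bs k = bin (block r k bs)" for bs k
  \<comment> \<open>Element \<open>k\<close> is ambiguous: some lightest set contains it and another
    lightest set does not.\<close>
  define bad where "bad k = {bs. length bs = m * r \<and> (\<exists>A\<in>\<F>. \<exists>B\<in>\<F>. k \<in> A \<and> k \<notin> B \<and>
      sum (w bs) A = sum (w bs) B \<and> (\<forall>C\<in>\<F>. sum (w bs) A \<le> sum (w bs) C))}" for k
  have finL: "finite {bs :: bool list. length bs = n}" for n
    using finite_lists_length_eq[of "UNIV :: bool set" n] by simp
  have cardL: "card {bs :: bool list. length bs = n} = 2 ^ n" for n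
    using card_lists_length_eq[of "UNIV :: bool set" n] by simp
  have cover: "?bad \<subseteq> (\<Union>k<m. bad k)"
  proof
    fix bs assume "bs \<in> ?bad"
    then have len: "length bs = m * r" and ni: "\<not> isolating \<F> (w bs)" by (auto simp: w_def[abs_def])
    obtain A where A: "A \<in> \<F>" "\<forall>C\<in>\<F>. sum (w bs) A \<le> sum (w bs) C"
      using arg_min_least[OF fam(1,2), of _ "sum (w bs)"] arg_min_if_finite(1)[OF fam(1,2), of "sum (w bs)"] by blast
    obtain B where B: "B \<in> \<F>" "B \<noteq> A" "sum (w bs) B \<le> sum (w bs) A"
      using ni A(1) unfolding isolating_def by (meson not_le)
    have eq: "sum (w bs) B = sum (w bs) A" using A B by (simp add: order_antisym)
    have minB: "\<forall>C\<in>\<F>. sum (w bs) B \<le> sum (w bs) C" using A eq by simp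
    \<comment> \<open>Both sets are lightest, so it does not matter which of the two contains
      \<open>k\<close>.\<close>
    obtain k where "k \<in> A \<and> k \<notin> B \<or> k \<in> B \<and> k \<notin> A" using B(2) by blast
    then show "bs \<in> (\<Union>k<m. bad k)"
    proof
      assume k: "k \<in> A \<and> k \<notin> B"
      then have "bs \<in> bad k" using A B(1) eq[symmetric] len unfolding bad_def by blast
      then show ?thesis using k fam(3)[OF A(1)] by blast
    next
      assume k: "k \<in> B \<and> k \<notin> A"
      then have "bs \<in> bad k" using A(1) B(1) eq minB len unfolding bad_def by blast
      then show ?thesis using k fam(3)[OF B(1)] by blast
    qed
  qed
  have card_bad: "card (bad k) * 2 ^ r \<le> 2 ^ (m * r)" if k: "k < m" for k
  proof -
    have "(k + 1) * r \<le> m * r" using k by (intro mult_le_mono1) simp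
    then have kr: "k * r + r \<le> m * r" by simp
    \<comment> \<open>Forgetting block \<open>k\<close> is injective on \<open>bad k\<close>; the
      lost \<open>r\<close> bits give the factor \<open>2 ^ r\<close>.\<close>
    define del :: "bool list \<Rightarrow> bool list" where "del bs = take (k * r) bs @ drop (k * r + r) bs" for bs
    have "inj_on del (bad k)"
    proof (rule inj_onI)
      fix bs bs' assume b: "bs \<in> bad k" "bs' \<in> bad k" "del bs = del bs'"
      have len: "length bs = m * r" "length bs' = m * r" using b by (auto simp: bad_def)
      define u v x v' where "u = take (k * r) bs" and "v = take r (drop (k * r) bs)"
        and "x = drop (k * r + r) bs" and "v' = take r (drop (k * r) bs')"
      have lu: "length u = k * r" "length v = r" "length v' = r" using len kr by (auto simp: u_def v_def v'_def)
      have "u = take (k * r) bs'" "x = drop (k * r + r) bs'"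
        using b(3) len kr unfolding del_def u_def x_def by (simp_all add: append_eq_append_conv)
      then have bs': "bs' = u @ v' @ x"
        unfolding v'_def by (metis add.commute append_take_drop_id drop_drop)
      have bs: "bs = u @ v @ x"
        unfolding u_def v_def x_def by (metis add.commute append_take_drop_id drop_drop)
      have weq: "w bs l = w bs' l" if "l \<noteq> k" for l
        unfolding w_def bs bs' using block_middle(2)[OF lu(1,2) that lu(3)] by simp
      have wk: "w bs k = bin v" "w bs' k = bin v'"
        unfolding w_def bs bs' using block_middle(1)[OF lu(1)] lu by simp_all
      have fin: "finite C" if "C \<in> \<F>" for C using fam(3)[OF that] finite_subset by blast
      have rem: "sum (w b) C = w b k + sum (w b) (C - {k})" if "C \<in> \<F>" "k \<in> C" for b C
        using fin[OF that(1)] that(2) by (rule sum.remove)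
      have same: "sum (w bs) C = sum (w bs') C" if "k \<notin> C" for C
        by (rule sum.cong[OF refl], rule weq) (use that in blast)
      obtain A B where A: "A \<in> \<F>" "B \<in> \<F>" "k \<in> A" "k \<notin> B" "sum (w bs) A = sum (w bs) B"
        "\<forall>C\<in>\<F>. sum (w bs) A \<le> sum (w bs) C" using b(1) unfolding bad_def by blast
      obtain A' B' where A': "A' \<in> \<F>" "B' \<in> \<F>" "k \<in> A'" "k \<notin> B'" "sum (w bs') A' = sum (w bs') B'"
        "\<forall>C\<in>\<F>. sum (w bs') A' \<le> sum (w bs') C" using b(2) unfolding bad_def by blast
      \<comment> \<open>The tapes agree outside block \<open>k\<close>. So they share the least sum
        over sets without \<open>k\<close>, and the least sum over sets with \<open>k\<close> when
        \<open>k\<close> itself is not counted; the weight of \<open>k\<close> is the difference of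
        these two numbers.\<close>
      have "sum (w bs) A \<le> sum (w bs) A'" "sum (w bs') A' \<le> sum (w bs') A"
        "sum (w bs) B \<le> sum (w bs) B'" "sum (w bs') B' \<le> sum (w bs') B"
        using A A' by metis+
      then have "bin v = bin v'"
        using A(5) A'(5) rem[OF A(1,3)] rem[OF A'(1,3)] same[of "A - {k}"] same[of "A' - {k}"]
          same[OF A(4)] same[OF A'(4)] wk by auto
      then show "bs = bs'" using bin_inj lu bs bs' by auto
    qed
    moreover have "del ` bad k \<subseteq> {bs. length bs = m * r - r}"
      using kr by (auto simp: bad_def del_def)
    ultimately have "card (bad k) \<le> 2 ^ (m * r - r)"
      using card_inj_on_le[OF _ _ finL] cardL by metis
    then have "card (bad k) * 2 ^ r \<le> 2 ^ (m * r - r) * 2 ^ r" by simp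
    also have "\<dots> = (2 :: nat) ^ (m * r)" using kr by (simp flip: power_add)
    finally show ?thesis .
  qed
  have "finite (bad k)" for k
    by (rule finite_subset[OF _ finL[of "m * r"]]) (auto simp: bad_def)
  then have "card ?bad \<le> (\<Sum>k<m. card (bad k))"
    using card_mono[OF _ cover] card_UN_le[of "{..<m}" bad] by (meson finite_UN finite_lessThan le_trans)
  then have "card ?bad * 2 ^ r \<le> (\<Sum>k<m. card (bad k)) * 2 ^ r" by simp
  also have "\<dots> = (\<Sum>k<m. card (bad k) * 2 ^ r)" by (simp add: sum_distrib_right)
  also have "\<dots> \<le> (\<Sum>k<m. 2 ^ (m * r))" by (intro sum_mono card_bad) simp
  finally show ?thesis by simp
qed

section \<open>Probabilities of events that depend on a finite prefix of the tape\<close>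

lemma prob_space_coin_tape: "prob_space coin_tape"
  unfolding coin_tape_def by (intro prob_space.prob_space_stream_space measure_pmf.prob_space_axioms)

lemma space_coin_tape [simp]: "space coin_tape = UNIV"
  by (simp add: coin_tape_def space_stream_space)

lemma measurable_stake_coin_tape: "stake n \<in> measurable coin_tape (count_space UNIV)"
proof -
  have "sets coin_tape = sets (stream_space (count_space UNIV))"
    unfolding coin_tape_def by (rule sets_stream_space_cong) simp
  then show ?thesis
    using measurable_stake[of n] measurable_cong_sets by blast
qed

lemma stake_sets: "{\<omega>. stake n \<omega> \<in> A} \<in> sets coin_tape"
  using measurable_sets[OF measurable_stake_coin_tape, of A n] by (simp add: vimage_def)

lemma emeasure_stake_eq:
  "length bs = n \<Longrightarrow> emeasure coin_tape {\<omega>. stake n \<omega> = bs} = ennreal ((1 / 2) ^ n)"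
proof (induction n arbitrary: bs)
  case 0
  interpret prob_space coin_tape by (rule prob_space_coin_tape)
  show ?case using 0 emeasure_space_1 by simp
next
  case (Suc n)
  obtain c cs where bs: "bs = c # cs" "length cs = n" using Suc.prems by (cases bs) auto
  have set: "{\<omega>. stake (Suc n) \<omega> = bs} \<in> sets coin_tape"
    using stake_sets[of "Suc n" "{bs}"] by (simp only: singleton_iff)
  have "emeasure coin_tape {\<omega>. stake (Suc n) \<omega> = bs} =
     (\<integral>\<^sup>+ t. emeasure coin_tape {\<omega>\<in>space coin_tape. t ## \<omega> \<in> {\<omega>. stake (Suc n) \<omega> = bs}} \<partial>measure_pmf (bernoulli_pmf (1 / 2)))"
    unfolding coin_tape_def
    by (rule prob_space.emeasure_stream_space[OF measure_pmf.prob_space_axioms])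
       (use set in \<open>simp add: coin_tape_def\<close>)
  also have "\<dots> = (\<integral>\<^sup>+ t. ennreal ((1 / 2) ^ n) * indicator {c} t \<partial>measure_pmf (bernoulli_pmf (1 / 2)))"
    by (rule nn_integral_cong) (use Suc.IH[OF bs(2)] in \<open>auto simp: bs(1) indicator_def\<close>)
  also have "\<dots> = ennreal ((1 / 2) ^ n) * emeasure (measure_pmf (bernoulli_pmf (1 / 2))) {c}"
    by (rule nn_integral_cmult_indicator) simp
  also have "emeasure (measure_pmf (bernoulli_pmf (1 / 2))) {c} = ennreal (1 / 2)"
    by (cases c) (simp_all add: emeasure_pmf_single)
  also have "ennreal ((1 / 2) ^ n) * ennreal (1 / 2) = ennreal ((1 / 2) ^ Suc n)"
    by (subst ennreal_mult[symmetric]) (simp_all add: mult.commute)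
  finally show ?case .
qed

lemma measure_stake:
  assumes "A \<subseteq> {bs. length bs = n}"
  shows "measure coin_tape {\<omega>. stake n \<omega> \<in> A} = card A / 2 ^ n"
proof -
  interpret prob_space coin_tape by (rule prob_space_coin_tape)
  have fA: "finite A"
    by (rule finite_subset[OF assms]) (use finite_lists_length_eq[of "UNIV :: bool set" n] in simp)
  have "{\<omega>. stake n \<omega> \<in> A} = (\<Union>bs\<in>A. {\<omega>. stake n \<omega> = bs})" by auto
  then have "measure coin_tape {\<omega>. stake n \<omega> \<in> A} = (\<Sum>bs\<in>A. measure coin_tape {\<omega>. stake n \<omega> = bs})"
    using fA stake_sets[of n "{bs}" for bs]
    by (simp, intro finite_measure_finite_Union) (auto simp: disjoint_family_on_def)
  also have "\<dots> = (\<Sum>bs\<in>A. (1 / 2) ^ n)"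
    by (rule sum.cong) (use assms emeasure_stake_eq in \<open>auto simp: measure_def\<close>)
  finally show ?thesis by (simp add: power_divide)
qed

text \<open>The fraction of bad tapes is at most \<open>m / 2 ^ r\<close>, and
  \<open>n * m \<le> 2 ^ r\<close> brings this down to \<open>1 / n\<close>.\<close>

lemma measure_stake_isolating:
  assumes fam: "finite \<F>" "\<F> \<noteq> {}" "\<And>M. M \<in> \<F> \<Longrightarrow> M \<subseteq> {..<m}" and mr: "n * m \<le> 2 ^ r" and n: "0 < n"
  shows "measure coin_tape {\<omega>. isolating \<F> (\<lambda>k. bin (block r k (stake (m * r) \<omega>)))} \<ge> 1 - 1 / real n"
proof -
  interpret prob_space coin_tape by (rule prob_space_coin_tape)
  define bad where "bad = {bs. length bs = m * r \<and> \<not> isolating \<F> (\<lambda>k. bin (block r k bs))}"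
  have bad: "card bad * 2 ^ r \<le> m * 2 ^ (m * r)" unfolding bad_def by (rule card_not_isolating[OF fam])
  have "n * card bad * 2 ^ r \<le> n * m * 2 ^ (m * r)" using bad by (simp add: mult.assoc)
  also have "\<dots> \<le> 2 ^ r * 2 ^ (m * r)" using mr by (rule mult_le_mono1)
  finally have "n * card bad \<le> 2 ^ (m * r)" by simp
  then have "real n * real (card bad) \<le> 2 ^ (m * r)"
    by (metis of_nat_le_iff of_nat_mult of_nat_numeral of_nat_power)
  then have "card bad / 2 ^ (m * r) \<le> 1 / real n" using n by (simp add: field_simps)
  then have m: "prob {\<omega>. stake (m * r) \<omega> \<in> bad} \<le> 1 / real n"
    by (subst measure_stake) (auto simp: bad_def)
  have "{\<omega>. isolating \<F> (\<lambda>k. bin (block r k (stake (m * r) \<omega>)))} = space coin_tape - {\<omega>. stake (m * r) \<omega> \<in> bad}"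
    by (auto simp: bad_def)
  then show ?thesis using prob_compl[OF stake_sets[of "m * r" bad]] m by simp
qed

section \<open>Reduction to matchings\<close>

text \<open>Among all representations of \<open>B c - 1\<close> as a sum of the place values \<open>B i\<close> of a mixed radix system,
  the one with the fewest summands is the one by digits. Hence the two sums determine the digits.\<close>

lemma mixed_radix_digit_sum:
  fixes m a B :: "nat \<Rightarrow> nat"
  assumes "\<And>i. i < c \<Longrightarrow> 1 \<le> m i" "B 0 = 1" "\<And>i. i < c \<Longrightarrow> B (Suc i) = (m i + 1) * B i"
    and "(\<Sum>i<c. a i * B i) + 1 = (e + 1) * B c"
  shows "(\<Sum>i<c. m i) + 2 * e \<le> (\<Sum>i<c. a i)"
    and "e = 0 \<Longrightarrow> (\<Sum>i<c. a i) = (\<Sum>i<c. m i) \<Longrightarrow> i < c \<Longrightarrow> a i = m i"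
proof -
  have "(\<Sum>i<c. m i) + 2 * e \<le> (\<Sum>i<c. a i) \<and>
    (e = 0 \<and> (\<Sum>i<c. a i) = (\<Sum>i<c. m i) \<longrightarrow> (\<forall>i<c. a i = m i))"
    using assms
  proof (induction c arbitrary: e)
    case 0
    then show ?case by simp
  next
    case (Suc c)
    \<comment> \<open>\<open>e\<close> counts surplus units of the place above. Each of them is
      worth \<open>m c + 1 \<ge> 2\<close> units of place \<open>c\<close>, so \<open>g\<close>
      units are available there, and the \<open>e'\<close> units that \<open>a c\<close> does not
      use up are the surplus for the induction hypothesis.\<close>
    define g where "g = e * (m c + 1) + m c"
    have mc: "1 \<le> m c" using Suc.prems(1) by simp
    have "(e + 1) * B (Suc c) = (g + 1) * B c"
      using Suc.prems(3)[of c] by (simp add: g_def algebra_simps)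
    then have eq: "(\<Sum>i<c. a i * B i) + 1 + a c * B c = (g + 1) * B c" using Suc.prems(4) by simp
    have ac: "a c \<le> g"
    proof (rule ccontr)
      assume "\<not> a c \<le> g"
      then have "(g + 1) * B c \<le> a c * B c" by (intro mult_le_mono1) simp
      then show False using eq by simp
    qed
    define e' where "e' = g - a c"
    have g: "g = a c + e'" using ac by (simp add: e'_def)
    have "(\<Sum>i<c. a i * B i) + 1 = (e' + 1) * B c" using eq by (simp add: g algebra_simps)
    with Suc.IH[of e'] Suc.prems have IH: "(\<Sum>i<c. m i) + 2 * e' \<le> (\<Sum>i<c. a i)"
      "e' = 0 \<and> (\<Sum>i<c. a i) = (\<Sum>i<c. m i) \<longrightarrow> (\<forall>i<c. a i = m i)" by auto
    have "2 * e + m c \<le> g" using mc by (simp add: g_def)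
    moreover have "g \<le> a c + 2 * e'" using g by simp
    ultimately have 1: "(\<Sum>i<Suc c. m i) + 2 * e \<le> (\<Sum>i<Suc c. a i)" using IH(1) by simp
    have "\<forall>i<Suc c. a i = m i" if "e = 0" "(\<Sum>i<Suc c. a i) = (\<Sum>i<Suc c. m i)"
    proof -
      have "g = m c" using that by (simp add: g_def)
      then have "e' = 0" "a c = m c" using that(2) IH(1) g by auto
      then show ?thesis using IH(2) that(2) by (auto simp: less_Suc_eq)
    qed
    then show ?case using 1 by blast
  qed
  then show "(\<Sum>i<c. m i) + 2 * e \<le> (\<Sum>i<c. a i)"
    and "e = 0 \<Longrightarrow> (\<Sum>i<c. a i) = (\<Sum>i<c. m i) \<Longrightarrow> i < c \<Longrightarrow> a i = m i" by auto
qed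

lemma mixed_radix_max:
  fixes m B :: "nat \<Rightarrow> nat"
  assumes "B 0 = 1" "\<And>i. i < c \<Longrightarrow> B (Suc i) = (m i + 1) * B i"
  shows "(\<Sum>i<c. m i * B i) + 1 = B c"
  using assms by (induction c) auto

lemma radix_split:
  fixes Q :: nat
  assumes "a < Q" "a' < Q" "a + Q * x = a' + Q * x'"
  shows "a = a' \<and> x = x'"
proof -
  have "(a + Q * x) mod Q = a" "(a' + Q * x') mod Q = a'" using assms(1,2) by simp_all
  then have "a = a'" using assms(3) by simp
  then show ?thesis using assms by auto
qed

lemma sum_two_plus_if:
  fixes f :: "'a \<Rightarrow> nat"
  assumes "finite A"
  shows "(\<Sum>x\<in>A. 2 + (if P x then f x else 0)) = 2 * card A + sum f {x \<in> A. P x}"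
proof -
  have "(\<Sum>x\<in>A. 2 + (if P x then f x else 0)) = (\<Sum>x\<in>A. 2) + (\<Sum>x\<in>A. if P x then f x else 0)"
    by (rule sum.distrib)
  then show ?thesis using assms by (simp add: sum.inter_filter)
qed

text \<open>\<open>lab u v\<close> is an entry of the input matrix, and \<open>jl i\<close>, \<open>dm i\<close> are the matrix label and the demand of the
  \<open>i\<close>-th set with a nonzero demand. A pair \<open>(u, v)\<close> with \<open>v < u\<close> stands for the edge \<open>{u, v}\<close>.\<close>

locale factor_instance =
  fixes n :: nat and lab :: "nat \<Rightarrow> nat \<Rightarrow> nat" and d :: "nat \<Rightarrow> nat"
    and c :: nat and jl dm :: "nat \<Rightarrow> nat"
  assumes jl_inj: "inj_on jl {..<c}" and dm_pos: "i < c \<Longrightarrow> 1 \<le> dm i"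
begin

definition pairs :: "(nat \<times> nat) set" where
  "pairs = {(u, v). v < u \<and> u < n \<and> lab u v \<noteq> 0}"

definition incident :: "(nat \<times> nat) set \<Rightarrow> nat \<Rightarrow> (nat \<times> nat) set" where
  "incident F u = {p \<in> F. fst p = u \<or> snd p = u}"

definition class_of :: "(nat \<times> nat) set \<Rightarrow> nat \<Rightarrow> (nat \<times> nat) set" where
  "class_of F l = {p \<in> F. lab (fst p) (snd p) = l}"

definition solution :: "(nat \<times> nat) set \<Rightarrow> bool" where
  "solution F \<longleftrightarrow> F \<subseteq> pairs \<and> (\<forall>u<n. card (incident F u) = d u) \<and>
     (\<forall>i<c. dm i \<le> card (class_of F (jl i)))"

text \<open>The port \<open>pt u u\<close> has no partner and is always matched to a core, which leaves \<open>d u\<close> ports of \<open>u\<close> for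
  the edges of the factor.\<close>

definition pt :: "nat \<Rightarrow> nat \<Rightarrow> nat" where
  "pt u v = u * n + v"

definition core :: "nat \<Rightarrow> nat \<Rightarrow> nat" where
  "core u i = n * n + pt u i"

definition order :: nat where
  "order = n * n + (\<Sum>u<n. n - d u)"

text \<open>With \<open>Q = order + 1\<close>, the types of the edges of a matching add up to twice the number of edges, plus
  \<open>Q\<close> times the number of counted edges, plus \<open>Q\<^sup>2\<close> times a sum of place values, and there is no carry between
  the first two. The cap bounds the running time; it only affects instances without a solution.\<close>

definition demand_cap :: "nat \<Rightarrow> nat" where
  "demand_cap i = min (dm i) order"

definition place :: "nat \<Rightarrow> nat" where
  "place i = (\<Prod>i'<i. demand_cap i' + 1)"

definition step_weight :: "nat \<Rightarrow> nat" where
  "step_weight i = (order + 1) + (order + 1) * (order + 1) * place i"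

text \<open>At most one summand, as \<open>jl\<close> is injective; in the form of a sum it is 0 for
  labels without a demand.\<close>

definition stride :: "nat \<Rightarrow> nat" where
  "stride l = (\<Sum>i | i < c \<and> jl i = l. step_weight i)"

definition target :: nat where
  "target = order + (\<Sum>i<c. demand_cap i * step_weight i)"

text \<open>Edges are triples: two end points and the number of the copy.\<close>

definition core_ids :: "(nat \<times> nat \<times> nat) set" where
  "core_ids = {(core u i, pt u v, 0) | u i v. u < n \<and> i < n - d u \<and> v < n}"

definition port_ids :: "(nat \<times> nat \<times> nat) set" where
  "port_ids = {(pt u v, pt v u, b) | u v b. (u, v) \<in> pairs \<and> b < 2}"

definition id_ends :: "nat \<times> nat \<times> nat \<Rightarrow> nat set" where
  "id_ends k = {fst k, fst (snd k)}"

text \<open>The first end point of a port edge is \<open>pt u v\<close>, so quotient and remainder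
  recover the pair and with it the label.\<close>

definition id_type :: "nat \<times> nat \<times> nat \<Rightarrow> nat" where
  "id_type k = 2 + (if snd (snd k) = 0 then 0 else stride (lab (fst k div n) (fst k mod n)))"

definition id_matching :: "(nat \<times> nat \<times> nat) set \<Rightarrow> bool" where
  "id_matching M \<longleftrightarrow> M \<subseteq> core_ids \<union> port_ids \<and>
     (\<forall>k\<in>M. \<forall>l\<in>M. k \<noteq> l \<longrightarrow> id_ends k \<inter> id_ends l = {})"

definition chosen :: "(nat \<times> nat \<times> nat) set \<Rightarrow> (nat \<times> nat) set" where
  "chosen M = {(u, v) \<in> pairs. \<exists>b. (pt u v, pt v u, b) \<in> M}"

definition nbrs :: "(nat \<times> nat) set \<Rightarrow> nat \<Rightarrow> nat set" where
  "nbrs F u = {v. v < n \<and> ((u, v) \<in> F \<or> (v, u) \<in> F)}"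

lemma finite_pairs: "finite pairs"
  by (rule finite_subset[of _ "{..<n} \<times> {..<n}"]) (auto simp: pairs_def)

lemma pt_eq_iff: "v < n \<Longrightarrow> v' < n \<Longrightarrow> pt u v = pt u' v' \<longleftrightarrow> u = u' \<and> v = v'"
  unfolding pt_def by (metis add.commute div_mult_self1 div_less mod_mult_self1 mod_less add_0 less_nat_zero_code neq0_conv)

lemma pt_less: "u < n \<Longrightarrow> v < n \<Longrightarrow> pt u v < n * n"
proof -
  assume "u < n" "v < n"
  then have "u * n + v < (u + 1) * n" by simp
  also have "\<dots> \<le> n * n" using \<open>u < n\<close> by (intro mult_le_mono1) simp
  finally show ?thesis by (simp add: pt_def)
qed

lemma core_eq_iff: "i < n \<Longrightarrow> i' < n \<Longrightarrow> core u i = core u' i' \<longleftrightarrow> u = u' \<and> i = i'"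
  by (simp add: core_def pt_eq_iff)

lemma core_neq_pt: "u' < n \<Longrightarrow> v' < n \<Longrightarrow> core u i \<noteq> pt u' v'" "u' < n \<Longrightarrow> v' < n \<Longrightarrow> pt u' v' \<noteq> core u i"
  using pt_less[of u' v'] by (auto simp: core_def)

lemma pt_div_mod: "v < n \<Longrightarrow> pt u v div n = u" "v < n \<Longrightarrow> pt u v mod n = v"
  by (auto simp: pt_def)

lemma card_incident:
  assumes "F \<subseteq> pairs" "u < n"
  shows "card (incident F u) = card (nbrs F u)"
proof -
  have p: "v < u' \<and> u' < n" if "(u', v) \<in> F" for u' v using assms that by (auto simp: pairs_def)
  have "bij_betw (\<lambda>p. if fst p = u then snd p else fst p) (incident F u) (nbrs F u)"
    unfolding bij_betw_def
  proof
    show "inj_on (\<lambda>p. if fst p = u then snd p else fst p) (incident F u)"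
      using p by (intro inj_onI) (fastforce simp: incident_def split: if_splits dest: p)
    show "(\<lambda>p. if fst p = u then snd p else fst p) ` incident F u = nbrs F u"
    proof (intro equalityI subsetI)
      fix v assume "v \<in> nbrs F u"
      then have v: "v < n" "(u, v) \<in> F \<or> (v, u) \<in> F" by (auto simp: nbrs_def)
      show "v \<in> (\<lambda>p. if fst p = u then snd p else fst p) ` incident F u"
        using v(2)
      proof
        assume "(u, v) \<in> F"
        then show ?thesis by (intro image_eqI[of _ _ "(u, v)"]) (auto simp: incident_def)
      next
        assume a: "(v, u) \<in> F"
        then show ?thesis using p[OF a] by (intro image_eqI[of _ _ "(v, u)"]) (auto simp: incident_def)
      qed
    qed (force simp: incident_def nbrs_def dest: p)
  qed
  then show ?thesis by (rule bij_betw_same_card)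
qed

lemma handshake:
  assumes "F \<subseteq> pairs"
  shows "(\<Sum>u<n. card (incident F u)) = 2 * card F"
proof -
  have fF: "finite F" using assms finite_pairs finite_subset by blast
  have "card (incident F u) = (\<Sum>p\<in>F. (if fst p = u then 1 else 0) + (if snd p = u then 1 else 0))" for u
  proof -
    have "card (incident F u) = (\<Sum>p\<in>F. if fst p = u \<or> snd p = u then 1 else 0)"
      unfolding incident_def using fF by (simp add: sum.inter_filter[symmetric])
    also have "\<dots> = (\<Sum>p\<in>F. (if fst p = u then 1 else 0) + (if snd p = u then 1 else 0))"
      by (rule sum.cong[OF refl]) (use assms in \<open>auto simp: pairs_def\<close>)
    finally show ?thesis .
  qed
  then have "(\<Sum>u<n. card (incident F u)) =
      (\<Sum>p\<in>F. \<Sum>u<n. (if fst p = u then 1 else 0) + (if snd p = u then 1 else 0))"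
    by (simp only: sum.swap[of _ F])
  also have "\<dots> = (\<Sum>p\<in>F. 2)"
    by (rule sum.cong[OF refl]) (use assms in \<open>auto simp: sum.distrib pairs_def\<close>)
  finally show ?thesis by simp
qed

lemma place_Suc: "place (Suc i) = (demand_cap i + 1) * place i"
  by (simp add: place_def mult.commute)

lemma place_0: "place 0 = 1"
  by (simp add: place_def)

lemma stride_jl: "i < c \<Longrightarrow> stride (jl i) = step_weight i"
proof -
  assume "i < c"
  then have "{i'. i' < c \<and> jl i' = jl i} = {i}" using jl_inj by (auto simp: inj_on_def)
  then show ?thesis by (simp add: stride_def)
qed

lemma stride_other: "l \<notin> jl ` {..<c} \<Longrightarrow> stride l = 0"
  unfolding stride_def by (rule sum.neutral) auto

lemma sum_stride:
  assumes "finite A"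
  shows "(\<Sum>p\<in>A. stride (f p)) = (\<Sum>i<c. card {p\<in>A. f p = jl i} * step_weight i)"
proof -
  have "(\<Sum>p\<in>A. stride (f p)) = (\<Sum>p\<in>A. \<Sum>i<c. if f p = jl i then step_weight i else 0)"
    by (rule sum.cong[OF refl]) (auto simp: stride_def sum.inter_filter[symmetric] intro!: sum.cong)
  also have "\<dots> = (\<Sum>i<c. \<Sum>p\<in>A. if f p = jl i then step_weight i else 0)" by (rule sum.swap)
  also have "\<dots> = (\<Sum>i<c. card {p\<in>A. f p = jl i} * step_weight i)"
    using assms by (intro sum.cong[OF refl]) (simp add: sum.inter_filter[symmetric])
  finally show ?thesis .
qed

text \<open>Counting edge ends gives \<open>2 * card F = (\<Sum>u<n. d u)\<close>. The classes are
  disjoint, so the demands add up to at most \<open>card F\<close> and no cap takes effect. The last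
  equation is the edge count of the perfect matching to be built: \<open>card F\<close> port edges
  and \<open>n - d u\<close> core edges for each \<open>u\<close>.\<close>

lemma solution_facts:
  assumes "solution F"
  shows "card F \<le> order" "\<And>u. u < n \<Longrightarrow> d u \<le> n" "\<And>i. i < c \<Longrightarrow> demand_cap i = dm i"
    "(\<Sum>i<c. dm i) \<le> card F" "2 * card F + 2 * (\<Sum>u<n. n - d u) = order"
proof -
  have F: "F \<subseteq> pairs" "\<And>u. u < n \<Longrightarrow> card (incident F u) = d u" "\<And>i. i < c \<Longrightarrow> dm i \<le> card (class_of F (jl i))"
    using assms by (auto simp: solution_def)
  have fF: "finite F" using F(1) finite_pairs finite_subset by blast
  show dn: "d u \<le> n" if "u < n" for u
  proof -
    have "card (nbrs F u) \<le> card {..<n}" by (rule card_mono) (auto simp: nbrs_def)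
    then show ?thesis using card_incident[OF F(1) that] F(2)[OF that] by simp
  qed
  have "(\<Sum>u<n. d u) = 2 * card F" using handshake[OF F(1)] F(2) by simp
  moreover have "(\<Sum>u<n. n - d u) + (\<Sum>u<n. d u) = n * n"
    unfolding sum.distrib[symmetric] using dn by simp
  ultimately show e: "2 * card F + 2 * (\<Sum>u<n. n - d u) = order" by (simp add: order_def)
  then show cF: "card F \<le> order" by simp
  have "class_of F (jl i) \<inter> class_of F (jl i') = {}" if "i < c" "i' < c" "i \<noteq> i'" for i i'
    using jl_inj that by (auto simp: class_of_def inj_on_def)
  then have "card (\<Union>i<c. class_of F (jl i)) = (\<Sum>i<c. card (class_of F (jl i)))"
    using fF by (intro card_UN_disjoint) (auto simp: class_of_def)
  moreover have "card (\<Union>i<c. class_of F (jl i)) \<le> card F"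
    using fF by (intro card_mono) (auto simp: class_of_def)
  moreover have "(\<Sum>i<c. dm i) \<le> (\<Sum>i<c. card (class_of F (jl i)))" by (rule sum_mono) (use F(3) in simp)
  ultimately show s: "(\<Sum>i<c. dm i) \<le> card F" by simp
  show "demand_cap i = dm i" if "i < c" for i
  proof -
    have "dm i \<le> (\<Sum>i<c. dm i)" using that by (intro member_le_sum) auto
    then show ?thesis using s cF by (simp add: demand_cap_def)
  qed
qed

text \<open>Each edge of \<open>F\<close> is realised by one of its two copies, the counted one for
  exactly \<open>dm i\<close> edges of the \<open>i\<close>-th class. The cores of \<open>u\<close>
  absorb the \<open>n - d u\<close> ports that \<open>F\<close> leaves free.\<close>

lemma solution_imp_id_matching:
  assumes sol: "solution F"
  shows "\<exists>M. id_matching M \<and> sum id_type M = target"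
proof -
  have F: "F \<subseteq> pairs" "\<And>u. u < n \<Longrightarrow> card (incident F u) = d u" "\<And>i. i < c \<Longrightarrow> dm i \<le> card (class_of F (jl i))"
    using sol by (auto simp: solution_def)
  note facts = solution_facts[OF sol]
  have fF: "finite F" using F(1) finite_pairs finite_subset by blast
  have p: "v < u \<and> u < n \<and> v < n" if "(u, v) \<in> F" for u v using F that by (auto simp: pairs_def)
  have "\<exists>C. C \<subseteq> class_of F (jl i) \<and> card C = dm i" if "i < c" for i
    using obtain_subset_with_card_n[OF F(3)[OF that]] by metis
  then obtain C where C: "\<And>i. i < c \<Longrightarrow> C i \<subseteq> class_of F (jl i) \<and> card (C i) = dm i" by metis
  define L where "L = (\<Union>i<c. C i)"
  have LF: "L \<subseteq> F" using C by (auto simp: L_def class_of_def)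
  have Lcl: "{q \<in> L. lab (fst q) (snd q) = jl i} = C i" if "i < c" for i
  proof (intro equalityI subsetI)
    fix q assume "q \<in> {q \<in> L. lab (fst q) (snd q) = jl i}"
    then obtain i' where i': "i' < c" "q \<in> C i'" "lab (fst q) (snd q) = jl i" by (auto simp: L_def)
    then have "jl i' = jl i" using C[OF i'(1)] by (auto simp: class_of_def)
    then show "q \<in> C i" using i' that jl_inj by (auto simp: inj_on_def)
  qed (use that C[OF that] in \<open>auto simp: L_def class_of_def\<close>)
  have "\<exists>g. bij_betw g {..<n - d u} ({..<n} - nbrs F u)" if u: "u < n" for u
  proof -
    have "card ({..<n} - nbrs F u) = n - d u"
      using card_incident[OF F(1) u] F(2)[OF u] by (subst card_Diff_subset) (auto simp: nbrs_def)
    then show ?thesis using ex_bij_betw_nat_finite[of "{..<n} - nbrs F u"] by (simp add: atLeast0LessThan)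
  qed
  then obtain g where g: "\<And>u. u < n \<Longrightarrow> bij_betw (g u) {..<n - d u} ({..<n} - nbrs F u)" by metis
  have gn: "g u i < n \<and> g u i \<notin> nbrs F u" if "u < n" "i < n - d u" for u i
    using bij_betwE[OF g[OF that(1)]] that(2) by auto
  have ginj: "i = i'" if "u < n" "i < n - d u" "i' < n - d u" "g u i = g u i'" for u i i'
    using bij_betw_imp_inj_on[OF g[OF that(1)]] that(2-4) by (auto simp: inj_on_def)
  define f1 where "f1 q = (pt (fst q) (snd q), pt (snd q) (fst q), if q \<in> L then 1 else 0 :: nat)" for q
  define f2 where "f2 q = (core (fst q) (snd q), pt (fst q) (g (fst q) (snd q)), 0 :: nat)" for q
  define I2 where "I2 = (SIGMA u:{..<n}. {..<n - d u})"
  define M where "M = f1 ` F \<union> f2 ` I2"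
  have inj1: "inj_on f1 F"
    by (rule inj_onI) (auto simp: f1_def pt_eq_iff dest!: p)
  have inj2: "inj_on f2 I2"
    by (rule inj_onI) (auto simp: f2_def I2_def core_eq_iff)
  have disj12: "id_ends (f1 q) \<inter> id_ends (f2 q') = {}" if "q \<in> F" "q' \<in> I2" for q q'
  proof -
    obtain u v u' i where q: "q = (u, v)" "q' = (u', i)" by force
    have a: "v < u" "u < n" "v < n" "u' < n" "i < n - d u'" using that p[of u v] by (auto simp: q I2_def)
    note b = gn[OF a(4,5)]
    have "pt u v \<noteq> pt u' (g u' i)" "pt v u \<noteq> pt u' (g u' i)"
      using a b that(1) by (auto simp: pt_eq_iff nbrs_def q)
    then show ?thesis using a core_neq_pt[of u v u' i] core_neq_pt[of v u u' i]
      by (auto simp: id_ends_def f1_def f2_def q)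
  qed
  have disj1: "id_ends (f1 q) \<inter> id_ends (f1 q') = {}" if "q \<in> F" "q' \<in> F" "q \<noteq> q'" for q q'
    using that p[of "fst q" "snd q"] p[of "fst q'" "snd q'"]
    by (auto simp: id_ends_def f1_def pt_eq_iff prod_eq_iff)
  have disj2: "id_ends (f2 q) \<inter> id_ends (f2 q') = {}" if "q \<in> I2" "q' \<in> I2" "q \<noteq> q'" for q q'
  proof -
    obtain u i u' i' where q: "q = (u, i)" "q' = (u', i')" by force
    have a: "u < n" "i < n - d u" "u' < n" "i' < n - d u'" using that by (auto simp: q I2_def)
    have ne: "u \<noteq> u' \<or> i \<noteq> i'" using that q by auto
    have "core u i \<noteq> core u' i'" using a ne by (simp add: core_eq_iff)
    moreover have "pt u (g u i) \<noteq> pt u' (g u' i')"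
      using ne ginj[OF a(1,2)] a gn[OF a(1,2)] gn[OF a(3,4)] by (auto simp: pt_eq_iff)
    moreover have "core u i \<noteq> pt u' (g u' i')" "core u' i' \<noteq> pt u (g u i)"
      using a gn core_neq_pt(1) by auto
    ultimately show ?thesis by (auto simp: id_ends_def f2_def q)
  qed
  have "f1 ` F \<subseteq> port_ids"
  proof
    fix k assume "k \<in> f1 ` F"
    then obtain u v where "(u, v) \<in> F" "k = f1 (u, v)" by auto
    then show "k \<in> port_ids" using F(1) unfolding port_ids_def f1_def by force
  qed
  moreover have "f2 ` I2 \<subseteq> core_ids" using gn by (fastforce simp: core_ids_def f2_def I2_def)
  moreover have "id_ends k \<inter> id_ends l = {}" if kl: "k \<in> M" "l \<in> M" "k \<noteq> l" for k l
  proof -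
    consider q q' where "k = f1 q" "l = f1 q'" "q \<in> F" "q' \<in> F" | q q' where "k = f1 q" "l = f2 q'" "q \<in> F" "q' \<in> I2"
      | q q' where "k = f2 q" "l = f1 q'" "q \<in> I2" "q' \<in> F" | q q' where "k = f2 q" "l = f2 q'" "q \<in> I2" "q' \<in> I2"
      using kl unfolding M_def by blast
    then show ?thesis
    proof cases
      case 1 then show ?thesis using disj1 kl(3) by blast
    next
      case 2 then show ?thesis using disj12 by blast
    next
      case 3 then show ?thesis using disj12 by blast
    next
      case 4 then show ?thesis using disj2 kl(3) by blast
    qed
  qed
  ultimately have "id_matching M"
    unfolding id_matching_def M_def by blast
  moreover have "sum id_type M = target"
  proof -
    have fI: "finite I2" by (simp add: I2_def)
    have "f1 q \<noteq> f2 q'" if "q \<in> F" "q' \<in> I2" for q q'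
      using disj12[OF that] by (auto simp: id_ends_def)
    then have "f1 ` F \<inter> f2 ` I2 = {}" by blast
    then have "sum id_type M = sum id_type (f1 ` F) + sum id_type (f2 ` I2)"
      unfolding M_def using fF fI by (intro sum.union_disjoint) auto
    also have "sum id_type (f2 ` I2) = (\<Sum>q\<in>I2. 2)"
      by (subst sum.reindex[OF inj2]) (simp add: id_type_def f2_def)
    also have "\<dots> = 2 * (\<Sum>u<n. n - d u)" by (simp add: I2_def card_SigmaI)
    also have "sum id_type (f1 ` F) = (\<Sum>q\<in>F. 2 + (if q \<in> L then stride (lab (fst q) (snd q)) else 0))"
      by (subst sum.reindex[OF inj1])
         (use p in \<open>auto simp: id_type_def f1_def pt_div_mod intro!: sum.cong\<close>)
    also have "\<dots> = 2 * card F + (\<Sum>q\<in>L. stride (lab (fst q) (snd q)))"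
      unfolding sum_two_plus_if[OF fF] by (rule arg_cong[of _ _ "\<lambda>A. _ + sum _ A"]) (use LF in blast)
    also have "(\<Sum>q\<in>L. stride (lab (fst q) (snd q))) = (\<Sum>i<c. demand_cap i * step_weight i)"
      using finite_subset[OF LF fF] Lcl C facts(3) by (simp add: sum_stride)
    finally show ?thesis using facts(5) by (simp add: target_def)
  qed
  ultimately show ?thesis by blast
qed

lemma finite_ids: "finite (core_ids \<union> port_ids)"
proof -
  have "core_ids \<subseteq> (\<lambda>(u, i, v). (core u i, pt u v, 0)) ` ({..<n} \<times> {..<n} \<times> {..<n})"
    by (force simp: core_ids_def)
  moreover have "port_ids \<subseteq> (\<lambda>((u, v), b). (pt u v, pt v u, b)) ` (pairs \<times> {..<2})"
    by (force simp: port_ids_def)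
  ultimately show ?thesis using finite_pairs by (auto dest: finite_subset)
qed

text \<open>\<open>F\<close> need not be related to \<open>M\<close>; its existence guarantees that
  no demand was capped and that \<open>d u \<le> n\<close>. Then \<open>target\<close> can be
  decoded digit by digit: first the size of \<open>M\<close>, then the number of counted edges, and
  finally their distribution over the classes.\<close>

lemma id_matching_imp_solution:
  assumes sol: "solution F" and M: "id_matching M" "sum id_type M = target"
  shows "solution (chosen M)"
proof -
  note facts = solution_facts[OF sol]
  define Q where "Q = order + 1"
  have MI: "M \<subseteq> core_ids \<union> port_ids" and
    uniq: "\<And>k l x. k \<in> M \<Longrightarrow> l \<in> M \<Longrightarrow> x \<in> id_ends k \<Longrightarrow> x \<in> id_ends l \<Longrightarrow> k = l"
    using M(1) unfolding id_matching_def by blast+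
  have fM: "finite M" using MI finite_ids finite_subset by blast
  define V where "V = {..<n * n} \<union> (\<lambda>(u, i). core u i) ` (SIGMA u:{..<n}. {..<n - d u})"
  have cardV: "card V = order"
  proof -
    have "inj_on (\<lambda>(u, i). core u i) (SIGMA u:{..<n}. {..<n - d u})"
      by (rule inj_onI) (auto simp: core_eq_iff)
    then have "card ((\<lambda>(u, i). core u i) ` (SIGMA u:{..<n}. {..<n - d u})) = (\<Sum>u<n. n - d u)"
      by (simp add: card_image card_SigmaI)
    moreover have "{..<n * n} \<inter> (\<lambda>(u, i). core u i) ` (SIGMA u:{..<n}. {..<n - d u}) = {}"
      by (auto simp: core_def)
    ultimately show ?thesis unfolding V_def order_def by (subst card_Un_disjoint) auto
  qed
  have finV: "finite V" by (simp add: V_def)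
  have endsV: "id_ends k \<subseteq> V \<and> card (id_ends k) = 2" if k: "k \<in> M" for k
  proof -
    have "k \<in> core_ids \<union> port_ids" using MI k by blast
    then show ?thesis
    proof
      assume "k \<in> core_ids"
      then obtain u i v where a: "k = (core u i, pt u v, 0)" "u < n" "i < n - d u" "v < n"
        unfolding core_ids_def by blast
      have "core u i \<in> V" unfolding V_def using a by force
      then show ?thesis using a pt_less[of u v] core_neq_pt[of u v u i] by (auto simp: id_ends_def V_def)
    next
      assume "k \<in> port_ids"
      then obtain u v b where a: "k = (pt u v, pt v u, b)" "v < u" "u < n"
        unfolding port_ids_def pairs_def by blast
      then show ?thesis using pt_less[of u v] pt_less[of v u] by (auto simp: id_ends_def V_def pt_eq_iff)
    qed
  qed
  have cardU: "card (\<Union>k\<in>M. id_ends k) = 2 * card M"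
  proof (subst card_UN_disjoint)
    show "\<forall>k\<in>M. \<forall>l\<in>M. k \<noteq> l \<longrightarrow> id_ends k \<inter> id_ends l = {}" using uniq by blast
    show "(\<Sum>k\<in>M. card (id_ends k)) = 2 * card M" using endsV by simp
  qed (use fM in \<open>auto simp: id_ends_def\<close>)
  have UV: "(\<Union>k\<in>M. id_ends k) \<subseteq> V" using endsV by blast
  \<comment> \<open>A matching covers at most \<open>order < Q\<close> vertices, so the lowest digit
    in base \<open>Q\<close> does not overflow.\<close>
  have le: "2 * card M \<le> order" using card_mono[OF finV UV] cardU cardV by simp
  define M1 where "M1 = {k \<in> M. snd (snd k) \<noteq> 0}"
  define lb where "lb k = lab (fst k div n) (fst k mod n)" for k :: "nat \<times> nat \<times> nat"
  define a where "a i = card {k \<in> M1. lb k = jl i}" for i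
  have fM1: "finite M1" using fM by (simp add: M1_def)
  have "sum id_type M = 2 * card M + (\<Sum>k\<in>M1. stride (lb k))"
  proof -
    have "sum id_type M = (\<Sum>k\<in>M. 2 + (if snd (snd k) \<noteq> 0 then stride (lb k) else 0))"
      by (rule sum.cong[OF refl]) (simp add: id_type_def lb_def)
    then show ?thesis unfolding sum_two_plus_if[OF fM] M1_def .
  qed
  also have "(\<Sum>k\<in>M1. stride (lb k)) = (\<Sum>i<c. a i * step_weight i)"
    unfolding a_def by (rule sum_stride[OF fM1])
  finally have "2 * card M + (\<Sum>i<c. a i * step_weight i) = order + (\<Sum>i<c. dm i * step_weight i)"
    using M(2) facts(3) by (simp add: target_def)
  moreover have sw: "(\<Sum>i<c. b i * step_weight i) = Q * ((\<Sum>i<c. b i) + Q * (\<Sum>i<c. b i * place i))" for b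
    unfolding step_weight_def Q_def[symmetric]
    by (simp add: sum_distrib_left sum.distrib[symmetric] algebra_simps)
  ultimately have "2 * card M + Q * ((\<Sum>i<c. a i) + Q * (\<Sum>i<c. a i * place i)) =
      order + Q * ((\<Sum>i<c. dm i) + Q * (\<Sum>i<c. dm i * place i))" by simp
  then have 1: "2 * card M = order"
    and 2: "(\<Sum>i<c. a i) + Q * (\<Sum>i<c. a i * place i) = (\<Sum>i<c. dm i) + Q * (\<Sum>i<c. dm i * place i)"
    using radix_split[of "2 * card M" Q order "(\<Sum>i<c. a i) + Q * (\<Sum>i<c. a i * place i)"
        "(\<Sum>i<c. dm i) + Q * (\<Sum>i<c. dm i * place i)"] le unfolding Q_def by linarith+
  have "(\<Sum>i<c. a i) = card (\<Union>i<c. {k \<in> M1. lb k = jl i})"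
    unfolding a_def using fM1 jl_inj by (subst card_UN_disjoint) (auto simp: inj_on_def)
  also have "\<dots> \<le> card M" using fM by (intro card_mono) (auto simp: M1_def)
  \<comment> \<open>There are at most \<open>card M\<close> counted edges, so the second digit does
    not overflow either. Both the number of counted edges and their place value sum are then known,
    as the digit lemma demands.\<close>
  finally have "(\<Sum>i<c. a i) < Q" using le by (simp add: Q_def)
  moreover have "(\<Sum>i<c. dm i) < Q" using facts(1,4) by (simp add: Q_def)
  ultimately have 3: "(\<Sum>i<c. a i) = (\<Sum>i<c. dm i)" "(\<Sum>i<c. a i * place i) = (\<Sum>i<c. dm i * place i)"
    using radix_split[OF _ _ 2] by blast+
  have pl: "place (Suc i) = (dm i + 1) * place i" if "i < c" for i
    using place_Suc[of i] facts(3)[OF that] by simp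
  have "(\<Sum>i<c. a i * place i) + 1 = (0 + 1) * place c"
    using mixed_radix_max[of place c dm, OF place_0 pl] 3(2) by simp
  then have ai: "a i = dm i" if "i < c" for i
    using mixed_radix_digit_sum(2)[of c dm place a 0 i, OF dm_pos place_0 pl] 3(1) that by blast
  \<comment> \<open>Equality in the count of covered vertices means that \<open>M\<close> is
    perfect.\<close>
  have cover: "(\<Union>k\<in>M. id_ends k) = V"
    by (rule card_subset_eq[OF finV UV]) (simp add: cardU cardV 1)
  have sub: "chosen M \<subseteq> pairs" by (auto simp: chosen_def)
  have "dm i \<le> card (class_of (chosen M) (jl i))" if i: "i < c" for i
  proof -
    have "a i \<le> card (class_of (chosen M) (jl i))" unfolding a_def
    proof (rule card_inj_on_le)
      let ?f = "\<lambda>k :: nat \<times> nat \<times> nat. (fst k div n, fst k mod n)"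
      have rep: "\<exists>u v b. k = (pt u v, pt v u, b) \<and> (u, v) \<in> pairs \<and> ?f k = (u, v)" if "k \<in> M1" for k
      proof -
        have "k \<in> port_ids" using that MI by (auto simp: M1_def core_ids_def)
        then obtain u v b where "k = (pt u v, pt v u, b)" "(u, v) \<in> pairs" unfolding port_ids_def by blast
        then show ?thesis using pt_div_mod[of v u] by (auto simp: pairs_def)
      qed
      show "inj_on ?f {k \<in> M1. lb k = jl i}"
      proof (rule inj_onI)
        fix k k' assume k: "k \<in> {k \<in> M1. lb k = jl i}" "k' \<in> {k \<in> M1. lb k = jl i}" "?f k = ?f k'"
        obtain u v b u' v' b' where "k = (pt u v, pt v u, b)" "?f k = (u, v)" "k' = (pt u' v', pt v' u', b')" "?f k' = (u', v')"
          using rep[of k] rep[of k'] k by blast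
        then have "fst k = fst k'" using k(3) by simp
        then show "k = k'" using uniq[of k k' "fst k"] k by (auto simp: M1_def id_ends_def)
      qed
      show "?f ` {k \<in> M1. lb k = jl i} \<subseteq> class_of (chosen M) (jl i)"
      proof
        fix q assume "q \<in> ?f ` {k \<in> M1. lb k = jl i}"
        then obtain k where k: "k \<in> M1" "lb k = jl i" "q = ?f k" by auto
        obtain u v b where r: "k = (pt u v, pt v u, b)" "(u, v) \<in> pairs" "?f k = (u, v)" using rep[OF k(1)] by blast
        then show "q \<in> class_of (chosen M) (jl i)"
          using k by (auto simp: class_of_def chosen_def M1_def lb_def)
      qed
      show "finite (class_of (chosen M) (jl i))"
        using finite_subset[OF sub finite_pairs] by (simp add: class_of_def)
    qed
    then show ?thesis using ai[OF i] by simp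
  qed
  moreover have "card (incident (chosen M) u) = d u" if u: "u < n" for u
  proof -
    \<comment> \<open>A core is adjacent only to the ports of its own vertex.\<close>
    have "\<exists>v<n. (core u i, pt u v, 0) \<in> M" if i: "i < n - d u" for i
    proof -
      have "core u i \<in> (\<Union>k\<in>M. id_ends k)" unfolding cover V_def using u i by force
      then obtain k where k: "k \<in> M" "core u i \<in> id_ends k" by blast
      from k(1) MI have "k \<in> core_ids \<union> port_ids" by blast
      then show ?thesis
      proof
        assume "k \<in> core_ids"
        then obtain u' i' v where b: "k = (core u' i', pt u' v, 0)" "u' < n" "i' < n - d u'" "v < n"
          unfolding core_ids_def by blast
        then have "core u i = core u' i'" using k(2) core_neq_pt(1)[of u' v u i] by (auto simp: id_ends_def)
        then have "u = u'" "i = i'" using core_eq_iff[of i i' u u'] b i by auto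
        then show ?thesis using b k(1) by blast
      next
        assume "k \<in> port_ids"
        then obtain u' v b where b: "k = (pt u' v, pt v u', b)" "v < u'" "u' < n"
          unfolding port_ids_def pairs_def by blast
        then show ?thesis using k(2) core_neq_pt(1)[of u' v u i] core_neq_pt(1)[of v u' u i]
          by (auto simp: id_ends_def)
      qed
    qed
    then obtain r where r: "\<And>i. i < n - d u \<Longrightarrow> r i < n \<and> (core u i, pt u (r i), 0) \<in> M" by metis
    have rinj: "inj_on r {..<n - d u}"
    proof (rule inj_onI)
      fix i i' assume b: "i \<in> {..<n - d u}" "i' \<in> {..<n - d u}" "r i = r i'"
      then have "(core u i, pt u (r i), 0 :: nat) = (core u i', pt u (r i'), 0)"
        using r[of i] r[of i'] by (intro uniq[of _ _ "pt u (r i)"]) (auto simp: id_ends_def)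
      then show "i = i'" using core_eq_iff[of i i' u u] b by auto
    qed
    \<comment> \<open>The ports not taken by cores are matched along edges of the graph. Their
      number is \<open>n - (n - d u)\<close>, which is \<open>d u\<close> because
      \<open>d u \<le> n\<close>.\<close>
    have "nbrs (chosen M) u = {..<n} - r ` {..<n - d u}"
    proof (intro equalityI subsetI)
      fix v assume "v \<in> nbrs (chosen M) u"
      then have v: "v < n" "(u, v) \<in> chosen M \<or> (v, u) \<in> chosen M" by (auto simp: nbrs_def)
      then obtain b where "(pt u v, pt v u, b) \<in> M \<or> (pt v u, pt u v, b) \<in> M"
        by (auto simp: chosen_def)
      then obtain k where k: "k \<in> M" "pt u v \<in> id_ends k" "fst k \<in> {pt u v, pt v u}" by (auto simp: id_ends_def)
      have "v \<noteq> r i" if i: "i < n - d u" for i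
      proof
        assume "v = r i"
        then have "k = (core u i, pt u v, 0)" using r[OF i] k by (intro uniq[of _ _ "pt u v"]) (auto simp: id_ends_def)
        then show False using k(3) core_neq_pt(1)[OF u v(1)] core_neq_pt(1)[OF v(1) u] by auto
      qed
      then show "v \<in> {..<n} - r ` {..<n - d u}" using v by auto
    next
      fix v assume v: "v \<in> {..<n} - r ` {..<n - d u}"
      then have vn: "v < n" by simp
      have "pt u v \<in> (\<Union>k\<in>M. id_ends k)" unfolding cover V_def using pt_less[OF u vn] by simp
      then obtain k where k: "k \<in> M" "pt u v \<in> id_ends k" by blast
      from k(1) MI have "k \<in> core_ids \<union> port_ids" by blast
      then show "v \<in> nbrs (chosen M) u"
      proof
        assume "k \<in> core_ids"
        then obtain u' i' v' where b: "k = (core u' i', pt u' v', 0)" "u' < n" "i' < n - d u'" "v' < n"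
          unfolding core_ids_def by blast
        then have "pt u v = pt u' v'" using k(2) core_neq_pt(1)[OF u vn, of u' i'] by (auto simp: id_ends_def)
        then have "u = u'" "v = v'" using pt_eq_iff b vn by auto
        moreover have "k = (core u' i', pt u' (r i'), 0)"
          using r[of i'] b k(1) \<open>u = u'\<close> by (intro uniq[of _ _ "core u i'"]) (auto simp: id_ends_def)
        ultimately have "v = r i'" using b r[of i'] pt_eq_iff[of v "r i'" u u] by auto
        then show ?thesis using v b \<open>u = u'\<close> by auto
      next
        assume "k \<in> port_ids"
        then obtain u' v' b where b: "k = (pt u' v', pt v' u', b)" "v' < u'" "u' < n" "(u', v') \<in> pairs"
          unfolding port_ids_def pairs_def by blast
        then have "u = u' \<and> v = v' \<or> u = v' \<and> v = u'" using k(2) u vn by (auto simp: id_ends_def pt_eq_iff)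
        then show ?thesis using b k(1) vn by (auto simp: nbrs_def chosen_def)
      qed
    qed
    then have "card (nbrs (chosen M) u) = n - (n - d u)"
      using rinj r by (subst \<open>nbrs (chosen M) u = _\<close>, subst card_Diff_subset) (auto simp: card_image)
    then show ?thesis using card_incident[OF sub u] facts(2)[OF u] by simp
  qed
  ultimately show ?thesis using sub by (simp add: solution_def)
qed

end

section \<open>Weakest preconditions with running time\<close>

lemma upd_eq [simp]: "upd s x i c x = (s x)(i := c)"
  by (simp add: upd_def)

lemma upd_neq [simp]: "y \<noteq> x \<Longrightarrow> upd s x i c y = s y"
  by (simp add: upd_def)

fun writes :: "com \<Rightarrow> nat set" where
  "writes Skip = {}"
| "writes (Store x a b) = {x}"
| "writes (Flip x a) = {x}"
| "writes (Seq c d) = writes c \<union> writes d"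
| "writes (Cond b c d) = writes c \<union> writes d"
| "writes (While b c) = writes c"

fun flip_free :: "com \<Rightarrow> bool" where
  "flip_free (Flip x a) = False"
| "flip_free (Seq c d) = (flip_free c \<and> flip_free d)"
| "flip_free (Cond b c d) = (flip_free c \<and> flip_free d)"
| "flip_free (While b c) = flip_free c"
| "flip_free _ = True"

fun reads :: "aexp \<Rightarrow> nat set" where
  "reads (Const c) = {}"
| "reads (Fetch x a) = insert x (reads a)"
| "reads (Plus a b) = reads a \<union> reads b"
| "reads (Minus a b) = reads a \<union> reads b"

definition frame :: "com \<Rightarrow> mem \<Rightarrow> bool stream \<Rightarrow> mem \<Rightarrow> bool stream \<Rightarrow> bool" where
  "frame c s \<omega> s' \<omega>' \<longleftrightarrow> (\<forall>x. x \<notin> writes c \<longrightarrow> s' x = s x) \<and> (flip_free c \<longrightarrow> \<omega>' = \<omega>)"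

lemma frameD: "frame c s \<omega> s' \<omega>' \<Longrightarrow> x \<notin> writes c \<Longrightarrow> s' x = s x"
  by (simp add: frame_def)

lemma frame_tape: "frame c s \<omega> s' \<omega>' \<Longrightarrow> flip_free c \<Longrightarrow> \<omega>' = \<omega>"
  by (simp add: frame_def)

lemma exec_frame: "exec c s \<omega> t s' \<omega>' \<Longrightarrow> frame c s \<omega> s' \<omega>'"
  by (induction rule: exec.induct) (auto simp: frame_def)

lemma aval_cong: "(\<And>x. x \<in> reads a \<Longrightarrow> s x = s' x) \<Longrightarrow> aval a s = aval a s'"
  by (induction a) auto

fun cost :: "com \<Rightarrow> nat" where
  "cost Skip = 1"
| "cost (Store x a b) = 1"
| "cost (Flip x a) = 1"
| "cost (Seq c d) = cost c + cost d"
| "cost (Cond b c d) = cost c + cost d + 1"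
| "cost (While b c) = cost c + 2"

fun depth :: "com \<Rightarrow> nat" where
  "depth (Seq c d) = max (depth c) (depth d)"
| "depth (Cond b c d) = max (depth c) (depth d)"
| "depth (While b c) = Suc (depth c)"
| "depth _ = 0"

text \<open>\<open>B\<close> bounds the number of passes of every single execution of a loop; it enters through \<open>wp_For\<close>.\<close>

definition wp :: "nat \<Rightarrow> com \<Rightarrow> (mem \<Rightarrow> bool stream \<Rightarrow> bool) \<Rightarrow> mem \<Rightarrow> bool stream \<Rightarrow> bool" where
  "wp B c Q s \<omega> \<longleftrightarrow>
     (\<exists>t s' \<omega>'. exec c s \<omega> t s' \<omega>' \<and> t \<le> cost c * Suc B ^ depth c \<and> Q s' \<omega>')"

text \<open>The frame comes for free, so specifications and loop invariants mention only what
  changes.\<close>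

lemma wp_mono: "wp B c Q s \<omega> \<Longrightarrow> (\<And>s' \<omega>'. frame c s \<omega> s' \<omega>' \<Longrightarrow> Q s' \<omega>' \<Longrightarrow> Q' s' \<omega>') \<Longrightarrow> wp B c Q' s \<omega>"
  unfolding wp_def using exec_frame by blast

lemma wp_Skip: "Q s \<omega> \<Longrightarrow> wp B Skip Q s \<omega>"
  unfolding wp_def using exec.Skip[of s \<omega>] by (intro exI conjI, assumption) auto

lemma wp_Store: "Q (upd s x (aval a s) (aval b s)) \<omega> \<Longrightarrow> wp B (Store x a b) Q s \<omega>"
  unfolding wp_def using exec.Store[of x a b s \<omega>] by (intro exI conjI, assumption) auto

lemma wp_Flip: "Q (upd s x (aval a s) (of_bool (shd \<omega>))) (stl \<omega>) \<Longrightarrow> wp B (Flip x a) Q s \<omega>"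
  unfolding wp_def using exec.Flip[of x a s \<omega>] by (intro exI conjI, assumption) auto

lemma cost_depth_mono: "d \<le> d' \<Longrightarrow> t \<le> k * Suc B ^ d \<Longrightarrow> t \<le> k * Suc B ^ d'"
  by (erule order_trans) (intro mult_le_mono order_refl power_increasing, simp_all)

lemma wp_Seq: "wp B c (wp B d Q) s \<omega> \<Longrightarrow> wp B (Seq c d) Q s \<omega>"
proof -
  assume "wp B c (wp B d Q) s \<omega>"
  then obtain t s' \<omega>' t' s'' \<omega>'' where 1: "exec c s \<omega> t s' \<omega>'" "t \<le> cost c * Suc B ^ depth c"
    and 2: "exec d s' \<omega>' t' s'' \<omega>''" "t' \<le> cost d * Suc B ^ depth d" "Q s'' \<omega>''"
    unfolding wp_def by blast
  have "t + t' \<le> cost (Seq c d) * Suc B ^ depth (Seq c d)"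
    using cost_depth_mono[OF _ 1(2), of "depth (Seq c d)"] cost_depth_mono[OF _ 2(2), of "depth (Seq c d)"]
    by (simp add: distrib_right)
  then show ?thesis unfolding wp_def using exec.Seq[OF 1(1) 2(1)] 2(3) by blast
qed

lemma wp_Cond:
  assumes "bval b s \<Longrightarrow> wp B c Q s \<omega>" "\<not> bval b s \<Longrightarrow> wp B d Q s \<omega>"
  shows "wp B (Cond b c d) Q s \<omega>"
proof -
  obtain e t s' \<omega>' where e: "e = (if bval b s then c else d)" "exec e s \<omega> t s' \<omega>'"
    "t \<le> cost e * Suc B ^ depth e" "Q s' \<omega>'"
    using assms unfolding wp_def by (cases "bval b s") auto
  have "t \<le> cost e * Suc B ^ depth (Cond b c d)"
    by (rule cost_depth_mono[OF _ e(3)]) (simp add: e(1))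
  moreover have "cost e + 1 \<le> cost (Cond b c d)" by (simp add: e(1))
  moreover have "1 \<le> Suc B ^ depth (Cond b c d)" by simp
  ultimately have "t + 1 \<le> (cost e + 1) * Suc B ^ depth (Cond b c d)"
    by (simp only: distrib_right)
  also have "\<dots> \<le> cost (Cond b c d) * Suc B ^ depth (Cond b c d)"
    using \<open>cost e + 1 \<le> cost (Cond b c d)\<close> by (rule mult_le_mono1)
  finally have "t + 1 \<le> cost (Cond b c d) * Suc B ^ depth (Cond b c d)" .
  moreover have "exec (Cond b c d) s \<omega> (t + 1) s' \<omega>'"
    using e(1,2) exec.Cond_True[of b s c \<omega> t s' \<omega>' d] exec.Cond_False[of b s d \<omega> t s' \<omega>' c]
    by (cases "bval b s") simp_all
  ultimately show ?thesis unfolding wp_def using e(4) by blast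
qed

text \<open>The loop variable is cell 0 of array \<open>i\<close>; the bound is evaluated anew before each pass.\<close>

definition For :: "nat \<Rightarrow> aexp \<Rightarrow> com \<Rightarrow> com" where
  "For i b c = Seq (Store i (Const 0) (Const 0))
     (While (Less (Fetch i (Const 0)) b) (Seq c (Store i (Const 0) (Plus (Fetch i (Const 0)) (Const 1)))))"

lemma writes_For [simp]: "writes (For i b c) = insert i (writes c)"
  by (auto simp: For_def)

lemma flip_free_For [simp]: "flip_free (For i b c) = flip_free c"
  by (simp add: For_def)

text \<open>The body changes neither the loop variable nor anything the bound reads, so there are
  exactly \<open>n \<le> B\<close> passes. All loops of the program have this form, which is why
  each nesting level costs one factor \<open>Suc B\<close>.\<close>

lemma wp_For:
  assumes i: "i \<notin> writes c" "reads b \<inter> insert i (writes c) = {}" and n: "aval b s = n" "n \<le> B"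
    and init: "I 0 (upd s i 0 0) \<omega>"
    and step: "\<And>k s' \<omega>'. k < n \<Longrightarrow> frame (For i b c) s \<omega> s' \<omega>' \<Longrightarrow> s' i 0 = k \<Longrightarrow> I k s' \<omega>' \<Longrightarrow>
      wp B c (\<lambda>s'' \<omega>''. I (Suc k) (upd s'' i 0 (Suc k)) \<omega>'') s' \<omega>'"
    and final: "\<And>s' \<omega>'. frame (For i b c) s \<omega> s' \<omega>' \<Longrightarrow> s' i 0 = n \<Longrightarrow> I n s' \<omega>' \<Longrightarrow> Q s' \<omega>'"
  shows "wp B (For i b c) Q s \<omega>"
proof -
  define W where "W = While (Less (Fetch i (Const 0)) b) (Seq c (Store i (Const 0) (Plus (Fetch i (Const 0)) (Const 1))))"
  define T where "T = cost c * Suc B ^ depth c"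
  have bn: "aval b s' = n" if "frame (For i b c) s \<omega> s' \<omega>'" for s' \<omega>'
  proof -
    have "aval b s' = aval b s"
      by (rule aval_cong) (use that i(2) in \<open>auto simp: frame_def For_def\<close>)
    then show ?thesis using n by simp
  qed
  \<comment> \<open>A pass costs at most \<open>T\<close> for the body, one store and one test; the
    final failing test adds 1.\<close>
  have loop: "\<exists>t s'' \<omega>''. exec W s' \<omega>' t s'' \<omega>'' \<and> t \<le> j * (T + 2) + 1 \<and>
      frame (For i b c) s \<omega> s'' \<omega>'' \<and> s'' i 0 = n \<and> I n s'' \<omega>''"
    if "j + k = n" "frame (For i b c) s \<omega> s' \<omega>'" "s' i 0 = k" "I k s' \<omega>'" for j k s' \<omega>'
    using that
  proof (induction j arbitrary: k s' \<omega>')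
    case 0
    then have "\<not> bval (Less (Fetch i (Const 0)) b) s'" using bn by simp
    from exec.While_False[OF this] have "exec W s' \<omega>' 1 s' \<omega>'" by (simp add: W_def)
    then show ?case using 0 by (intro exI[of _ 1]) auto
  next
    case (Suc j)
    then have b: "bval (Less (Fetch i (Const 0)) b) s'" using bn by simp
    have "wp B c (\<lambda>s'' \<omega>''. I (Suc k) (upd s'' i 0 (Suc k)) \<omega>'') s' \<omega>'"
      using Suc.prems by (intro step) auto
    then obtain t1 s1 \<omega>1 where 1: "exec c s' \<omega>' t1 s1 \<omega>1" "t1 \<le> T" "I (Suc k) (upd s1 i 0 (Suc k)) \<omega>1"
      unfolding wp_def T_def by blast
    have f: "frame c s' \<omega>' s1 \<omega>1" by (rule exec_frame[OF 1(1)])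
    have s1i: "s1 i = s' i" using f i(1) by (simp add: frame_def)
    have "exec (Store i (Const 0) (Plus (Fetch i (Const 0)) (Const 1))) s1 \<omega>1 1 (upd s1 i 0 (Suc k)) \<omega>1"
      using exec.Store[of i "Const 0" "Plus (Fetch i (Const 0)) (Const 1)" s1 \<omega>1] Suc.prems(3) s1i by simp
    note 2 = exec.Seq[OF 1(1) this]
    have "frame (For i b c) s \<omega> (upd s1 i 0 (Suc k)) \<omega>1"
      using f Suc.prems(2) by (auto simp: frame_def)
    then obtain t2 s2 \<omega>2 where 3: "exec W (upd s1 i 0 (Suc k)) \<omega>1 t2 s2 \<omega>2" "t2 \<le> j * (T + 2) + 1"
      "frame (For i b c) s \<omega> s2 \<omega>2" "s2 i 0 = n" "I n s2 \<omega>2"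
      using Suc.IH[of "Suc k" "upd s1 i 0 (Suc k)" \<omega>1] Suc.prems(1) 1(3) by auto
    have "exec W s' \<omega>' (t1 + 1 + t2 + 1) s2 \<omega>2"
      using exec.While_True[OF b 2 3(1)[unfolded W_def]] by (simp add: W_def)
    moreover have "t1 + 1 + t2 + 1 \<le> Suc j * (T + 2) + 1" using 1(2) 3(2) by simp
    ultimately show ?case using 3 by blast
  qed
  have st: "exec (Store i (Const 0) (Const 0)) s \<omega> 1 (upd s i 0 0) \<omega>"
    using exec.Store[of i "Const 0" "Const 0" s \<omega>] by simp
  have "frame (For i b c) s \<omega> (upd s i 0 0) \<omega>" by (auto simp: frame_def)
  then obtain t s' \<omega>' where t: "exec W (upd s i 0 0) \<omega> t s' \<omega>'" "t \<le> n * (T + 2) + 1"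
    "frame (For i b c) s \<omega> s' \<omega>'" "s' i 0 = n" "I n s' \<omega>'"
    using loop[of n 0 "upd s i 0 0" \<omega>] init by auto
  have "exec (For i b c) s \<omega> (1 + t) s' \<omega>'"
    unfolding For_def using exec.Seq[OF st t(1)] by (simp add: W_def)
  moreover have "1 + t \<le> cost (For i b c) * Suc B ^ depth (For i b c)"
  proof -
    have p: "1 \<le> Suc B ^ depth c" by simp
    have "T + 2 \<le> (cost c + 2) * Suc B ^ depth c" using p unfolding T_def by (simp only: distrib_right)
    then have "n * (T + 2) \<le> B * ((cost c + 2) * Suc B ^ depth c)" using n(2) mult_le_mono by blast
    moreover have "2 \<le> (cost c + 2) * Suc B ^ depth c"
      using mult_le_mono[OF order_refl p, of "cost c + 2"] by simp
    ultimately have "1 + t \<le> Suc B * ((cost c + 2) * Suc B ^ depth c)"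
      using t(2) by simp
    also have "\<dots> \<le> cost (For i b c) * Suc B ^ depth (For i b c)"
      by (simp add: For_def algebra_simps)
    finally show ?thesis .
  qed
  ultimately show ?thesis unfolding wp_def using final[OF t(3-5)] by blast
qed

section \<open>The program\<close>

notation Seq (infixr ";;" 60)

abbreviation (input) sc :: "nat \<Rightarrow> aexp" where "sc x \<equiv> Fetch x (Const 0)"
abbreviation (input) set_sc :: "nat \<Rightarrow> aexp \<Rightarrow> com" where "set_sc x a \<equiv> Store x (Const 0) a"

text \<open>Names of arrays; a scalar is cell 0 of its array. As these abbreviations are not used for output, proofs
  mostly refer to an array by its number.\<close>

abbreviation (input) r_in :: nat where "r_in \<equiv> 0"
abbreviation (input) r_out :: nat where "r_out \<equiv> 1"
abbreviation (input) r_n :: nat where "r_n \<equiv> 2"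
abbreviation (input) r_nsq :: nat where "r_nsq \<equiv> 3"
abbreviation (input) r_row :: nat where "r_row \<equiv> 4"
abbreviation (input) r_deg :: nat where "r_deg \<equiv> 5"
abbreviation (input) r_dptr :: nat where "r_dptr \<equiv> 6"
abbreviation (input) r_order :: nat where "r_order \<equiv> 7"
abbreviation (input) r_src :: nat where "r_src \<equiv> 8"
abbreviation (input) r_dst :: nat where "r_dst \<equiv> 9"
abbreviation (input) r_type :: nat where "r_type \<equiv> 10"
abbreviation (input) r_edges :: nat where "r_edges \<equiv> 11"
abbreviation (input) r_base :: nat where "r_base \<equiv> 12"
abbreviation (input) r_place :: nat where "r_place \<equiv> 13"
abbreviation (input) r_target :: nat where "r_target \<equiv> 14"
abbreviation (input) r_stride :: nat where "r_stride \<equiv> 15"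
abbreviation (input) r_bound :: nat where "r_bound \<equiv> 16"
abbreviation (input) r_range :: nat where "r_range \<equiv> 17"
abbreviation (input) r_bits :: nat where "r_bits \<equiv> 18"
abbreviation (input) r_big :: nat where "r_big \<equiv> 19"
abbreviation (input) r_weight :: nat where "r_weight \<equiv> 20"
abbreviation (input) r_low :: nat where "r_low \<equiv> 21"
abbreviation (input) r_max :: nat where "r_max \<equiv> 22"
abbreviation (input) r_xrow :: nat where "r_xrow \<equiv> 23"
abbreviation (input) r_verts :: nat where "r_verts \<equiv> 24"
abbreviation (input) r_total :: nat where "r_total \<equiv> 25"
abbreviation (input) r_walk :: nat where "r_walk \<equiv> 26"
abbreviation (input) r_cdeg :: nat where "r_cdeg \<equiv> 27"
abbreviation (input) r_ccnt :: nat where "r_ccnt \<equiv> 28"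
abbreviation (input) r_ok :: nat where "r_ok \<equiv> 29"
abbreviation (input) r_u :: nat where "r_u \<equiv> 30"
abbreviation (input) r_v :: nat where "r_v \<equiv> 31"
abbreviation (input) r_i :: nat where "r_i \<equiv> 32"
abbreviation (input) r_k :: nat where "r_k \<equiv> 33"
abbreviation (input) r_x :: nat where "r_x \<equiv> 34"
abbreviation (input) r_c :: nat where "r_c \<equiv> 35"
abbreviation (input) r_h :: nat where "r_h \<equiv> 36"
abbreviation (input) r_w :: nat where "r_w \<equiv> 37"
abbreviation (input) r_t :: nat where "r_t \<equiv> 38"
abbreviation (input) r_label :: nat where "r_label \<equiv> 40"
abbreviation (input) r_acc :: nat where "r_acc \<equiv> 41"
abbreviation (input) r_skip :: nat where "r_skip \<equiv> 42"
abbreviation (input) r_prev :: nat where "r_prev \<equiv> 43"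
abbreviation (input) r_coin :: nat where "r_coin \<equiv> 44"
abbreviation (input) r_step :: nat where "r_step \<equiv> 45"
abbreviation (input) r_cap :: nat where "r_cap \<equiv> 46"
abbreviation (input) r_old :: nat where "r_old \<equiv> 47"

definition push_edge :: "aexp \<Rightarrow> aexp \<Rightarrow> aexp \<Rightarrow> com" where
  "push_edge a b t = Store r_src (sc r_edges) a ;; Store r_dst (sc r_edges) b ;; Store r_type (sc r_edges) t ;;
     set_sc r_edges (Plus (sc r_edges) (Const 1))"

text \<open>Multiples of \<open>n\<close> are tabulated by repeated addition, since matrix indices
  cannot be computed by multiplication.\<close>

definition setup_rows :: com where
  "setup_rows = set_sc r_n (Fetch r_in (Const 1)) ;; set_sc r_nsq (Const 0) ;;
     For r_u (sc r_n) (Store r_row (sc r_u) (sc r_nsq) ;; set_sc r_nsq (Plus (sc r_nsq) (sc r_n)))"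

definition setup_degrees :: com where
  "setup_degrees = Cond (Equal (sc r_in) (Const 0))
     (For r_u (sc r_n) (Store r_deg (sc r_u) (Const 1)) ;; set_sc r_dptr (Plus (Const 2) (sc r_nsq)))
     (For r_u (sc r_n) (Store r_deg (sc r_u) (Fetch r_in (Plus (Plus (Const 2) (sc r_nsq)) (sc r_u)))) ;;
      set_sc r_dptr (Plus (Plus (Const 2) (sc r_nsq)) (sc r_n)))"

definition core_edges :: com where
  "core_edges = set_sc r_edges (Const 0) ;; set_sc r_order (sc r_nsq) ;;
     For r_u (sc r_n) (For r_i (Minus (sc r_n) (Fetch r_deg (sc r_u)))
       (For r_v (sc r_n)
          (push_edge (Plus (sc r_nsq) (Plus (Fetch r_row (sc r_u)) (sc r_i))) (Plus (Fetch r_row (sc r_u)) (sc r_v)) (Const 2)) ;;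
        set_sc r_order (Plus (sc r_order) (Const 1))))"

abbreviation (input) demand_index :: aexp where
  "demand_index \<equiv> Plus (Fetch r_in (Plus (Plus (sc r_dptr) (Const 1)) (Plus (sc r_i) (sc r_i)))) (Const 2)"

abbreviation (input) demand_value :: aexp where
  "demand_value \<equiv> Fetch r_in (Plus (Plus (sc r_dptr) (Const 2)) (Plus (sc r_i) (sc r_i)))"

text \<open>The truncated difference \<open>m - (m - order)\<close> is the minimum of both, that is,
  the capped demand. \<open>r_old\<close> holds the current place value while repeated addition
  multiplies it by the cap plus 1.\<close>

definition setup_strides :: com where
  "setup_strides = set_sc r_base (Plus (sc r_order) (Const 1)) ;; set_sc r_place (Const 0) ;;
     For r_t (sc r_base) (set_sc r_place (Plus (sc r_place) (sc r_base))) ;; set_sc r_target (sc r_order) ;;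
     For r_i (Fetch r_in (sc r_dptr))
       (set_sc r_step (Plus (sc r_base) (sc r_place)) ;;
        set_sc r_cap (Minus demand_value (Minus demand_value (sc r_order))) ;;
        Store r_stride demand_index (sc r_step) ;;
        set_sc r_old (sc r_place) ;;
        For r_t (sc r_cap) (set_sc r_target (Plus (sc r_target) (sc r_step)) ;; set_sc r_place (Plus (sc r_place) (sc r_old))))"

abbreviation (input) pair_index :: aexp where
  "pair_index \<equiv> Plus (Fetch r_row (sc r_u)) (sc r_v)"

definition port_edges :: com where
  "port_edges = For r_u (sc r_n) (For r_v (sc r_u)
     (set_sc r_label (Fetch r_in (Plus (Const 2) pair_index)) ;;
      Cond (Equal (sc r_label) (Const 0)) Skip
        (push_edge pair_index (Plus (Fetch r_row (sc r_v)) (sc r_u)) (Const 2) ;;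
         push_edge pair_index (Plus (Fetch r_row (sc r_v)) (sc r_u)) (Plus (Const 2) (Fetch r_stride (sc r_label))))))"

text \<open>Looks for a power of two that is at least \<open>n\<close> times the number of edges.
  The loop has a fixed number of passes and a conditional body, so that it fits
  \<open>wp_For\<close>.\<close>

definition setup_range :: com where
  "setup_range = set_sc r_bound (Const 0) ;; For r_i (sc r_n) (set_sc r_bound (Plus (sc r_bound) (sc r_edges))) ;;
     set_sc r_range (Const 1) ;; set_sc r_bits (Const 0) ;;
     For r_i (sc r_bound) (Cond (Less (sc r_range) (sc r_bound))
       (set_sc r_range (Plus (sc r_range) (sc r_range)) ;; set_sc r_bits (Plus (sc r_bits) (Const 1))) Skip) ;;
     set_sc r_big (Const 1) ;; For r_i (sc r_edges) (set_sc r_big (Plus (sc r_big) (sc r_range)))"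

definition draw_weights :: com where
  "draw_weights = For r_k (sc r_edges)
     (set_sc r_acc (Const 0) ;;
      For r_i (sc r_bits) (Flip r_coin (Const 0) ;; set_sc r_acc (Plus (Plus (sc r_acc) (sc r_acc)) (sc r_coin))) ;;
      For r_t (Fetch r_type (sc r_k)) (set_sc r_acc (Plus (sc r_acc) (sc r_big))) ;;
      Store r_weight (sc r_k) (sc r_acc))"

text \<open>Weights from \<open>r_low\<close> up to but excluding \<open>r_max\<close> are those
  with type sum \<open>target\<close> and an arbitrary random sum below
  \<open>r_big\<close>.\<close>

definition setup_tables :: com where
  "setup_tables = set_sc r_low (Const 0) ;; For r_t (sc r_target) (set_sc r_low (Plus (sc r_low) (sc r_big))) ;;
     set_sc r_max (Plus (sc r_low) (sc r_big)) ;; set_sc r_verts (Plus (sc r_nsq) (sc r_nsq)) ;; set_sc r_acc (Const 0) ;;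
     For r_x (sc r_max) (Store r_xrow (sc r_x) (sc r_acc) ;; set_sc r_acc (Plus (sc r_acc) (sc r_verts)))"

text \<open>For bits, \<open>(a - b) + (b - a)\<close> with truncated subtraction is the exclusive or.\<close>

definition xor_into :: "nat \<Rightarrow> aexp \<Rightarrow> aexp \<Rightarrow> com" where
  "xor_into x a e = Store x a (Plus (Minus (Fetch x a) e) (Minus e (Fetch x a)))"

text \<open>\<open>r_walk\<close> is a flattened matrix with a row for each weight and a column for
  each vertex; \<open>r_xrow\<close> holds the row offsets. Edges are undirected, so each is used in
  both directions.\<close>

definition extend_walk :: "nat \<Rightarrow> nat \<Rightarrow> com" where
  "extend_walk a b = Cond (Less (Fetch b (sc r_k)) (sc r_h))
     (xor_into r_walk (Plus (Fetch r_xrow (sc r_x)) (Fetch b (sc r_k)))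
       (Fetch r_walk (Plus (sc r_prev) (Fetch a (sc r_k))))) Skip"

text \<open>Skipping the edges with source \<open>r_skip\<close> removes both copies of a pair, and
  no core edge, since the source of a core edge is a core.\<close>

definition walk_edge :: com where
  "walk_edge = Cond (Conj (Neg (Equal (Fetch r_src (sc r_k)) (sc r_skip))) (Neg (Less (sc r_x) (Fetch r_weight (sc r_k)))))
     (set_sc r_prev (Fetch r_xrow (Minus (sc r_x) (Fetch r_weight (sc r_k)))) ;;
      extend_walk r_src r_dst ;; extend_walk r_dst r_src)
     Skip"

text \<open>Weights are positive, so processing the rows by increasing weight reads only finished
  rows.\<close>

definition walk_table :: com where
  "walk_table =
     For r_x (sc r_max) (For r_c (sc r_verts) (Store r_walk (Plus (Fetch r_xrow (sc r_x)) (sc r_c)) (Const 0)) ;;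
        Store r_walk (Plus (Fetch r_xrow (sc r_x)) (sc r_h)) (Fetch r_total (sc r_x))) ;;
     For r_x (sc r_max) (For r_k (sc r_edges) walk_edge)"

definition parity_table :: com where
  "parity_table = For r_x (sc r_max) (Store r_total (sc r_x) (Const 0)) ;; Store r_total (Const 0) (Const 1) ;;
     For r_h (sc r_verts) (walk_table ;;
       For r_x (sc r_max) (For r_c (sc r_h) (xor_into r_total (sc r_x) (Fetch r_walk (Plus (Fetch r_xrow (sc r_x)) (sc r_c))))))"

definition collect_edge :: com where
  "collect_edge = Store r_out (Plus (Plus (Fetch r_out (Const 1)) (Fetch r_out (Const 1))) (Const 2)) (sc r_u) ;;
     Store r_out (Plus (Plus (Fetch r_out (Const 1)) (Fetch r_out (Const 1))) (Const 3)) (sc r_v) ;;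
     Store r_out (Const 1) (Plus (Fetch r_out (Const 1)) (Const 1)) ;;
     Store r_cdeg (sc r_u) (Plus (Fetch r_cdeg (sc r_u)) (Const 1)) ;;
     Store r_cdeg (sc r_v) (Plus (Fetch r_cdeg (sc r_v)) (Const 1)) ;;
     Store r_ccnt (sc r_label) (Plus (Fetch r_ccnt (sc r_label)) (Const 1))"

text \<open>A pair is taken if the number of matchings of the required weight that avoid it is even;
  this is meaningful only if the weight occurs once, and \<open>verify\<close> catches the other
  cases. Only counters of labels with a demand are reset, as only these are compared later.\<close>

definition candidate :: com where
  "candidate = Store r_out (Const 1) (Const 0) ;; For r_u (sc r_n) (Store r_cdeg (sc r_u) (Const 0)) ;;
     For r_i (Fetch r_in (sc r_dptr)) (Store r_ccnt demand_index (Const 0)) ;;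
     For r_u (sc r_n) (For r_v (sc r_u)
       (set_sc r_label (Fetch r_in (Plus (Const 2) pair_index)) ;;
        Cond (Equal (sc r_label) (Const 0)) Skip
         (set_sc r_skip pair_index ;; parity_table ;;
          Cond (Equal (Fetch r_total (Plus (sc r_low) (sc r_w))) (Const 0)) collect_edge Skip)))"

definition verify :: com where
  "verify = set_sc r_ok (Const 1) ;;
     For r_u (sc r_n) (Cond (Equal (Fetch r_cdeg (sc r_u)) (Fetch r_deg (sc r_u))) Skip (set_sc r_ok (Const 0))) ;;
     For r_i (Fetch r_in (sc r_dptr)) (Cond (Less (Fetch r_ccnt demand_index) demand_value) (set_sc r_ok (Const 0)) Skip) ;;
     set_sc r_out (sc r_ok)"

definition search :: com where
  "search = For r_w (sc r_big) (Cond (Equal (sc r_out) (Const 0)) (candidate ;; verify) Skip)"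

definition factor_program :: com where
  "factor_program = setup_rows ;; setup_degrees ;; core_edges ;; setup_strides ;; port_edges ;;
     setup_range ;; draw_weights ;; setup_tables ;; search"

lemma writes_push_edge [simp]: "writes (push_edge a b t) = {8, 9, 10, 11}"
  by (auto simp: push_edge_def)

lemma flip_free_push_edge [simp]: "flip_free (push_edge a b t)"
  by (simp add: push_edge_def)

section \<open>Correctness of the set-up\<close>

context factor_instance
begin

text \<open>An f-factor input has \<open>n\<close> degrees between the matrix and the demands, a
  matching input has none.\<close>

definition dpos :: "mem \<Rightarrow> nat" where
  "dpos s = 2 + n * n + (if s r_in 0 = 0 then 0 else n)"

definition reads_input :: "mem \<Rightarrow> bool" where
  "reads_input s \<longleftrightarrow> s r_in 1 = n \<and> (\<forall>u<n. \<forall>v<n. s r_in (2 + (u * n + v)) = lab u v) \<and>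
     (\<forall>u<n. d u = (if s r_in 0 = 0 then 1 else s r_in (2 + n * n + u))) \<and>
     s r_in (dpos s) = c \<and>
     (\<forall>i<c. s r_in (dpos s + 1 + (i + i)) + 2 = jl i \<and> s r_in (dpos s + 2 + (i + i)) = dm i)"

lemma wp_setup_rows:
  assumes "s r_in 1 = n" "n \<le> B"
  shows "wp B setup_rows (\<lambda>s' \<omega>'. s' r_n 0 = n \<and> s' r_nsq 0 = n * n \<and> (\<forall>u<n. s' r_row u = u * n)) s \<omega>"
  unfolding setup_rows_def
  apply (intro wp_Seq wp_Store)
  apply (rule wp_For[where n = n and I = "\<lambda>k s' \<omega>'. s' r_n 0 = n \<and> s' r_nsq 0 = k * n \<and> (\<forall>u<k. s' r_row u = u * n)"])
  using assms by (auto intro!: wp_Seq wp_Store simp: less_Suc_eq)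

lemma wp_setup_degrees:
  assumes "reads_input s" "s r_n 0 = n" "s r_nsq 0 = n * n" "n \<le> B"
  shows "wp B setup_degrees (\<lambda>s' \<omega>'. (\<forall>u<n. s' r_deg u = d u) \<and> s' r_dptr 0 = dpos s) s \<omega>"
  unfolding setup_degrees_def
proof (rule wp_Cond; rule wp_Seq)
  assume b: "bval (Equal (sc r_in) (Const 0)) s"
  show "wp B (For r_u (sc r_n) (Store r_deg (sc r_u) (Const 1))) (wp B (set_sc r_dptr (Plus (Const 2) (sc r_nsq)))
      (\<lambda>s' \<omega>'. (\<forall>u<n. s' r_deg u = d u) \<and> s' r_dptr 0 = dpos s)) s \<omega>"
    by (rule wp_For[where n = n and I = "\<lambda>k s' \<omega>'. \<forall>u<k. s' r_deg u = d u"])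
      (use b assms in \<open>auto intro!: wp_Store simp: less_Suc_eq frameD reads_input_def dpos_def\<close>)
next
  assume b: "\<not> bval (Equal (sc r_in) (Const 0)) s"
  show "wp B (For r_u (sc r_n) (Store r_deg (sc r_u) (Fetch r_in (Plus (Plus (Const 2) (sc r_nsq)) (sc r_u)))))
     (wp B (set_sc r_dptr (Plus (Plus (Const 2) (sc r_nsq)) (sc r_n)))
      (\<lambda>s' \<omega>'. (\<forall>u<n. s' r_deg u = d u) \<and> s' r_dptr 0 = dpos s)) s \<omega>"
    by (rule wp_For[where n = n and I = "\<lambda>k s' \<omega>'. \<forall>u<k. s' r_deg u = d u"])
      (use b assms in \<open>auto intro!: wp_Store simp: less_Suc_eq frameD reads_input_def dpos_def\<close>)
qed

definition edges_at :: "mem \<Rightarrow> (nat \<times> nat \<times> nat) list \<Rightarrow> bool" where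
  "edges_at s ids \<longleftrightarrow> s r_edges 0 = length ids \<and>
     (\<forall>k<length ids. s r_src k = fst (ids ! k) \<and> s r_dst k = fst (snd (ids ! k)) \<and> s r_type k = id_type (ids ! k))"

lemma edges_at_cong:
  "edges_at s ids \<Longrightarrow> s' 8 = s 8 \<Longrightarrow> s' 9 = s 9 \<Longrightarrow> s' 10 = s 10 \<Longrightarrow> s' 11 = s 11 \<Longrightarrow> edges_at s' ids"
  by (simp add: edges_at_def)

lemma edges_at_upd [simp]:
  "x \<notin> {8, 9, 10, 11} \<Longrightarrow> edges_at (upd s x i v) ids = edges_at s ids"
  by (simp add: edges_at_def)

lemma wp_push_edge:
  assumes "edges_at s ids" "aval a s = fst x" "aval b s = fst (snd x)" "aval t s = id_type x"
    and "reads b \<inter> {8, 9, 10, 11} = {}" "reads t \<inter> {8, 9, 10, 11} = {}"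
  shows "wp B (push_edge a b t) (\<lambda>s' \<omega>'. edges_at s' (ids @ [x])) s \<omega>"
proof -
  have b: "aval b (upd s 8 i v) = aval b s" for i v
    by (rule aval_cong) (use assms(5) in \<open>auto simp: upd_def\<close>)
  have t: "aval t (upd (upd s 8 i v) 9 i' v') = aval t s" for i v i' v'
    by (rule aval_cong) (use assms(6) in \<open>auto simp: upd_def\<close>)
  show ?thesis
    unfolding push_edge_def
    by (intro wp_Seq wp_Store)
       (use assms(1-4) in \<open>auto simp: b t edges_at_def nth_append less_Suc_eq\<close>)
qed

definition core_list :: "nat \<Rightarrow> nat \<Rightarrow> (nat \<times> nat \<times> nat) list" where
  "core_list u i = map (\<lambda>v. (core u i, pt u v, 0)) [0..<n]"

definition vertex_list :: "nat \<Rightarrow> (nat \<times> nat \<times> nat) list" where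
  "vertex_list u = concat (map (core_list u) [0..<n - d u])"

definition cores :: "(nat \<times> nat \<times> nat) list" where
  "cores = concat (map vertex_list [0..<n])"

definition setup_done :: "mem \<Rightarrow> bool" where
  "setup_done s \<longleftrightarrow> s r_n 0 = n \<and> s r_nsq 0 = n * n \<and> (\<forall>u<n. s r_row u = u * n) \<and>
     (\<forall>u<n. s r_deg u = d u) \<and> s r_dptr 0 = dpos s \<and> reads_input s"

lemma wp_core_edges:
  assumes st: "setup_done s" and B: "n \<le> B"
  shows "wp B core_edges (\<lambda>s' \<omega>'. edges_at s' cores \<and> s' r_order 0 = order) s \<omega>"
  unfolding core_edges_def
proof (intro wp_Seq wp_Store, rule wp_For[where n = n and I = "\<lambda>u s' \<omega>'.
    edges_at s' (concat (map vertex_list [0..<u])) \<and> s' 7 0 = n * n + (\<Sum>u<u. n - d u)"], goal_cases)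
  case (6 u s1 \<omega>1)
  have s1: "s1 2 0 = n" "s1 3 0 = n * n" "s1 4 u = u * n" "s1 5 u = d u"
    using frameD[OF 6(2)] st 6(1) by (simp_all add: setup_done_def)
  note u = 6(1,3) and I1 = 6(4)
  show ?case
  proof (rule wp_For[where n = "n - d u" and I = "\<lambda>i s' \<omega>'.
      edges_at s' (concat (map vertex_list [0..<u]) @ concat (map (core_list u) [0..<i])) \<and>
      s' 7 0 = n * n + (\<Sum>u<u. n - d u) + i"], goal_cases)
    case (6 i s2 \<omega>2)
    have s2: "s2 2 = s1 2" "s2 3 = s1 3" "s2 4 = s1 4" "s2 30 = s1 30" using frameD[OF 6(2)] by auto
    note i = 6(3) and I2 = 6(4)
    show ?case
    proof (rule wp_Seq, rule wp_For[where n = n and I = "\<lambda>v s' \<omega>'. edges_at s' (concat (map vertex_list [0..<u]) @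
        concat (map (core_list u) [0..<i]) @ map (\<lambda>v. (core u i, pt u v, 0)) [0..<v])"], goal_cases)
      case (6 v s3 \<omega>3)
      have s3: "s3 3 = s1 3" "s3 4 = s1 4" "s3 30 = s1 30" "s3 32 = s2 32" using frameD[OF 6(2)] s2 by auto
      show ?case
        by (rule wp_mono[OF wp_push_edge[OF 6(4), where x = "(core u i, pt u v, 0)"]])
          (use s1 s3 u i 6(3) in \<open>auto simp: core_def pt_def id_type_def\<close>)
    next
      case (7 s3 \<omega>3)
      have "s3 7 = s2 7" using frameD[OF 7(1)] by auto
      then show ?case by (intro wp_Store) (use I2 7(3) in \<open>simp add: core_list_def\<close>)
    qed (use I2 s1 s2 B in simp_all)
  qed (use I1 u s1 B in \<open>simp_all add: vertex_list_def\<close>)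
qed (use st B in \<open>simp_all add: setup_done_def edges_at_def cores_def order_def\<close>)

lemma reads_input_cong: "s' 0 = s 0 \<Longrightarrow> reads_input s' = reads_input s"
  by (simp add: reads_input_def dpos_def)

lemma setup_done_cong:
  "setup_done s \<Longrightarrow> s' 0 = s 0 \<Longrightarrow> s' 2 = s 2 \<Longrightarrow> s' 3 = s 3 \<Longrightarrow> s' 4 = s 4 \<Longrightarrow> s' 5 = s 5 \<Longrightarrow> s' 6 = s 6 \<Longrightarrow>
    setup_done s'"
  using reads_input_cong[of s' s] by (simp add: setup_done_def dpos_def)

lemma demand_data:
  assumes "setup_done s" "i < c"
  shows "s 0 (s 6 0) = c" "s 0 (s 6 0 + 1 + (i + i)) + 2 = jl i" "s 0 (s 6 0 + 2 + (i + i)) = dm i"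
  using assms by (auto simp: setup_done_def reads_input_def)

lemma demand_number: "setup_done s \<Longrightarrow> s 0 (s 6 0) = c"
  by (simp add: setup_done_def reads_input_def)

text \<open>Only labels with a demand are written, whereas \<open>stride\<close> is 0 at all other
  labels; hence the array has to be zero initially.\<close>

lemma wp_setup_strides:
  assumes st: "setup_done s" and s7: "s r_order 0 = order" and s15: "s r_stride = (\<lambda>_. 0)"
    and B: "order + 1 \<le> B" "c \<le> B"
  shows "wp B setup_strides (\<lambda>s' \<omega>'. s' r_stride = stride \<and> s' r_target 0 = target) s \<omega>"
  unfolding setup_strides_def
proof (intro wp_Seq wp_Store, rule wp_For[where n = "order + 1" and I = "\<lambda>t s' \<omega>'. s' 13 0 = t * (order + 1)"], goal_cases)
  case (7 s1 \<omega>1)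
  have s1: "s1 12 0 = order + 1" "s1 13 0 = (order + 1) * (order + 1)" "s1 7 0 = order" "s1 15 = (\<lambda>_. 0)"
    "\<And>x. x \<in> {0, 2, 3, 4, 5, 6} \<Longrightarrow> s1 x = s x"
    using frameD[OF 7(1)] 7(3) s7 s15 by auto
  show ?case
  proof (rule wp_Seq, rule wp_Store, rule wp_For[where n = c and I = "\<lambda>k s' \<omega>'.
      s' 13 0 = (order + 1) * (order + 1) * place k \<and>
      s' 14 0 = order + (\<Sum>i<k. demand_cap i * step_weight i) \<and>
      s' 15 = (\<lambda>l. \<Sum>i | i < k \<and> jl i = l. step_weight i)"], goal_cases)
    case (6 k s2 \<omega>2)
    have s2: "s2 12 0 = order + 1" "s2 7 0 = order" "\<And>x. x \<in> {0, 2, 3, 4, 5, 6} \<Longrightarrow> s2 x = s x"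
      using frameD[OF 6(2)] s1 by auto
    have I: "s2 13 0 = (order + 1) * (order + 1) * place k" "s2 14 0 = order + (\<Sum>i<k. demand_cap i * step_weight i)"
      "s2 15 = (\<lambda>l. \<Sum>i | i < k \<and> jl i = l. step_weight i)"
      using 6(4) by auto
    have st2: "setup_done s2" by (rule setup_done_cong[OF st]) (simp_all add: s2)
    note dd = demand_data[OF st2 6(1)]
    have cap: "dm k - (dm k - order) = demand_cap k" by (simp add: demand_cap_def)
    have sw: "order + 1 + (order + 1) * (order + 1) * place k = step_weight k" by (simp add: step_weight_def)
    \<comment> \<open>By injectivity of \<open>jl\<close> the sum for the label \<open>jl k\<close>
      has a single term, so one plain store extends the whole table.\<close>
    have str: "(\<lambda>l. \<Sum>i | i < k \<and> jl i = l. step_weight i)(jl k := step_weight k) =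
        (\<lambda>l. \<Sum>i | i < Suc k \<and> jl i = l. step_weight i)"
    proof
      fix l
      have "{i. i < Suc k \<and> jl i = jl k} = {k}"
        using jl_inj 6(1) by (auto simp: inj_on_def less_Suc_eq)
      moreover have "{i. i < Suc k \<and> jl i = l} = {i. i < k \<and> jl i = l}" if "l \<noteq> jl k"
        using that by (auto simp: less_Suc_eq)
      ultimately show "((\<lambda>l. \<Sum>i | i < k \<and> jl i = l. step_weight i)(jl k := step_weight k)) l =
        (\<Sum>i | i < Suc k \<and> jl i = l. step_weight i)" by simp
    qed
    show ?case
    proof (intro wp_Seq wp_Store, rule wp_For[where n = "demand_cap k" and I = "\<lambda>t s' \<omega>'.
        s' 13 0 = (order + 1) * (order + 1) * place k * (t + 1) \<and>
        s' 14 0 = order + (\<Sum>i<k. demand_cap i * step_weight i) + t * step_weight k"], goal_cases)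
      case 3
      then show ?case using dd cap 6(3) s2 by simp
    next
      case 4
      then show ?case using B by (simp add: demand_cap_def)
    next
      case 5
      then show ?case using I by simp
    next
      case (6 t s3 \<omega>3)
      have "s3 45 0 = step_weight k" "s3 47 0 = (order + 1) * (order + 1) * place k"
        using frameD[OF 6(2), of 45] frameD[OF 6(2), of 47] I s2 sw by simp_all
      then show ?case using 6(4) by (intro wp_Seq wp_Store) (simp add: algebra_simps)
    next
      case (7 s3 \<omega>3)
      have "s3 15 = (s2 15)(jl k := step_weight k)"
        using frameD[OF 7(1), of 15] dd I s2 sw \<open>s2 r_i 0 = k\<close> by (simp add: fun_eq_iff)
      then show ?case using 7(3) I str by (simp add: place_Suc algebra_simps)
    qed auto
  next
    case 3
    then show ?case using demand_number[OF st] s1 by simp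
  qed (use s1 B in \<open>auto simp: place_0 target_def stride_def[abs_def]\<close>)
next
  case (6 t s1 \<omega>1)
  have "s1 12 0 = order + 1" using frameD[OF 6(2), of 12] s7 by simp
  then show ?case using 6(4) by (intro wp_Store) simp
qed (use s7 B in auto)

definition port_pair :: "nat \<Rightarrow> nat \<Rightarrow> (nat \<times> nat \<times> nat) list" where
  "port_pair u v = (if lab u v = 0 then [] else [(pt u v, pt v u, 0), (pt u v, pt v u, 1)])"

definition port_row :: "nat \<Rightarrow> (nat \<times> nat \<times> nat) list" where
  "port_row u = concat (map (port_pair u) [0..<u])"

definition ids :: "(nat \<times> nat \<times> nat) list" where
  "ids = cores @ concat (map port_row [0..<n])"

lemma wp_port_edges:
  assumes st: "setup_done s" and s15: "s r_stride = stride" and e: "edges_at s cores" and B: "n \<le> B"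
  shows "wp B port_edges (\<lambda>s' \<omega>'. edges_at s' ids) s \<omega>"
  unfolding port_edges_def
proof (rule wp_For[where n = n and I = "\<lambda>u s' \<omega>'. edges_at s' (cores @ concat (map port_row [0..<u]))"], goal_cases)
  case (6 u s1 \<omega>1)
  have f1: "s1 x = s x" if "x \<in> {0, 2, 3, 4, 5, 6, 15}" for x using frameD[OF 6(2), of x] that by auto
  note u = 6(1) and u1 = 6(3)
  show ?case
  proof (rule wp_For[where n = u and I = "\<lambda>v s' \<omega>'. edges_at s' (cores @ concat (map port_row [0..<u]) @
      concat (map (port_pair u) [0..<v]))"], goal_cases)
    case (6 v s2 \<omega>2)
    have f2: "s2 x = s x" if "x \<in> {0, 2, 3, 4, 5, 6, 15}" for x using frameD[OF 6(2), of x] f1[of x] that by auto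
    have u2: "s2 30 0 = u" "s2 31 0 = v" using frameD[OF 6(2), of 30] u1 6(3) by auto
    have vn: "v < n" using 6(1) u by simp
    have rows: "s2 4 u = u * n" "s2 4 v = v * n" using st u vn by (simp_all add: f2 setup_done_def)
    have l: "s2 0 (2 + (u * n + v)) = lab u v"
      using st u vn unfolding setup_done_def reads_input_def by (simp add: f2)
    let ?L = "cores @ concat (map port_row [0..<u]) @ concat (map (port_pair u) [0..<v])"
    let ?s = "upd s2 40 0 (lab u v)"
    let ?c1 = "push_edge pair_index (Plus (Fetch r_row (sc r_v)) (sc r_u)) (Const 2)"
    let ?c2 = "push_edge pair_index (Plus (Fetch r_row (sc r_v)) (sc r_u)) (Plus (Const 2) (Fetch r_stride (sc r_label)))"
    have e2: "edges_at ?s ?L" using 6(4) by simp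
    have pairs: "wp B (?c1 ;; ?c2) (\<lambda>s'' \<omega>''. edges_at s'' ((?L @ [(pt u v, pt v u, 0)]) @ [(pt u v, pt v u, 1)])) ?s \<omega>2"
    proof (rule wp_Seq, rule wp_mono[OF wp_push_edge[OF e2, where x = "(pt u v, pt v u, 0)"]], goal_cases)
      case (6 s3 \<omega>3)
      have s3: "s3 4 = s2 4" "s3 30 = s2 30" "s3 31 = s2 31" "s3 15 = stride" "s3 40 0 = lab u v"
        using frameD[OF 6(1)] f2[of 15] s15 by auto
      show ?case
        by (rule wp_push_edge[OF 6(2)]) (use s3 rows u2 vn in \<open>auto simp: pt_def id_type_def pt_div_mod[unfolded pt_def]\<close>)
    qed (use rows u2 in \<open>auto simp: pt_def id_type_def\<close>)
    show ?case
    proof (rule wp_Seq, rule wp_Store)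
      have eq: "upd s2 40 (aval (Const 0) s2) (aval (Fetch r_in (Plus (Const 2) pair_index)) s2) = ?s"
        using l rows u2 by simp
      show "wp B (Cond (Equal (sc r_label) (Const 0)) Skip (?c1 ;; ?c2))
        (\<lambda>s'' \<omega>''. edges_at (upd s'' 31 0 (Suc v)) (cores @ concat (map port_row [0..<u]) @ concat (map (port_pair u) [0..<Suc v])))
        (upd s2 40 (aval (Const 0) s2) (aval (Fetch r_in (Plus (Const 2) pair_index)) s2)) \<omega>2"
        unfolding eq
      proof (rule wp_Cond)
        assume "bval (Equal (sc r_label) (Const 0)) ?s"
        then show "wp B Skip (\<lambda>s'' \<omega>''. edges_at (upd s'' 31 0 (Suc v)) (cores @ concat (map port_row [0..<u]) @
            concat (map (port_pair u) [0..<Suc v]))) ?s \<omega>2"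
          using e2 by (intro wp_Skip) (simp add: port_pair_def)
      next
        assume "\<not> bval (Equal (sc r_label) (Const 0)) ?s"
        then show "wp B (?c1 ;; ?c2) (\<lambda>s'' \<omega>''. edges_at (upd s'' 31 0 (Suc v)) (cores @ concat (map port_row [0..<u]) @
            concat (map (port_pair u) [0..<Suc v]))) ?s \<omega>2"
          by (intro wp_mono[OF pairs]) (simp add: port_pair_def)
      qed
    qed
  qed (use 6 B in \<open>auto simp: port_row_def\<close>)
qed (use st e B in \<open>auto simp: setup_done_def ids_def\<close>)

text \<open>The exponent reached after \<open>k\<close> passes of the doubling loop in
  \<open>setup_range\<close>.\<close>

fun bit_length :: "nat \<Rightarrow> nat \<Rightarrow> nat" where
  "bit_length L 0 = 0"
| "bit_length L (Suc k) = (if 2 ^ bit_length L k < L then Suc (bit_length L k) else bit_length L k)"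

lemma bit_length_le: "bit_length L k \<le> k"
  by (induction k) auto

text \<open>Doubling happens only below \<open>L\<close>; the additional 1 covers
  \<open>L = 0\<close>.\<close>

lemma bit_length_upper: "2 ^ bit_length L k \<le> 2 * L + 1"
  by (induction k) auto

text \<open>If \<open>L\<close> passes were too few, each of them would have doubled, and
  \<open>2 ^ L < L\<close> would follow.\<close>

lemma bit_length_lower: "L \<le> 2 ^ bit_length L L"
proof (rule ccontr)
  have inc: "2 ^ bit_length L k < L \<Longrightarrow> bit_length L k = k" for k
  proof (induction k)
    case (Suc k)
    then have "2 ^ bit_length L k < L" by (auto split: if_splits)
    then show ?case using Suc by simp
  qed simp
  assume "\<not> L \<le> 2 ^ bit_length L L"
  then have "2 ^ L < L" using inc[of L] by simp
  then show False using less_exp[of L] by simp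
qed

definition nbits :: nat where
  "nbits = bit_length (n * length ids) (n * length ids)"

text \<open>Larger than the sum of the random weights of any set of edges, so the type sum and the
  random sum can be read off a total weight.\<close>

definition modulus :: nat where
  "modulus = length ids * 2 ^ nbits + 1"

lemma wp_setup_range:
  assumes s: "s r_n 0 = n" "s r_edges 0 = length ids" and B: "n \<le> B" "length ids \<le> B" "n * length ids \<le> B"
  shows "wp B setup_range (\<lambda>s' \<omega>'. s' r_bits 0 = nbits \<and> s' r_big 0 = modulus) s \<omega>"
  unfolding setup_range_def
proof (rule wp_Seq, rule wp_Store, rule wp_Seq,
    rule wp_For[where n = n and I = "\<lambda>i s' \<omega>'. s' 16 0 = i * length ids"], goal_cases)
  case (6 k s1 \<omega>1)
  have "s1 11 0 = length ids" using frameD[OF 6(2), of 11] s by simp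
  then show ?case using 6(4) by (intro wp_Store) simp
next
  case (7 s1 \<omega>1)
  have s1: "s1 11 0 = length ids" "s1 16 0 = n * length ids" using frameD[OF 7(1), of 11] s 7(3) by auto
  show ?case
  proof (rule wp_Seq, rule wp_Store, rule wp_Seq, rule wp_Store, rule wp_Seq,
      rule wp_For[where n = "n * length ids" and I = "\<lambda>i s' \<omega>'. s' 18 0 = bit_length (n * length ids) i \<and>
        s' 17 0 = 2 ^ bit_length (n * length ids) i"], goal_cases)
    case (6 k s2 \<omega>2)
    have "s2 16 0 = n * length ids" using frameD[OF 6(2), of 16] s1 by simp
    then show ?case using 6(4) by (intro wp_Cond wp_Seq wp_Store wp_Skip) auto
  next
    case (7 s2 \<omega>2)
    have s2: "s2 11 0 = length ids" "s2 17 0 = 2 ^ nbits" "s2 18 0 = nbits"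
      using frameD[OF 7(1), of 11] s1 7(3) by (auto simp: nbits_def)
    show ?case
    proof (rule wp_Seq, rule wp_Store, rule wp_For[where n = "length ids" and I = "\<lambda>i s' \<omega>'. s' 19 0 = i * 2 ^ nbits + 1"], goal_cases)
      case (6 k s3 \<omega>3)
      have "s3 17 0 = 2 ^ nbits" using frameD[OF 6(2), of 17] s2 by simp
      then show ?case using 6(4) by (intro wp_Store) simp
    next
      case (7 s3 \<omega>3)
      have "s3 18 0 = nbits" using frameD[OF 7(1), of 18] s2 by simp
      then show ?case using 7(3) by (simp add: modulus_def)
    qed (use s2 B in auto)
  qed (use s1 B in auto)
qed (use s B in auto)

definition random_weight :: "bool list \<Rightarrow> nat \<Rightarrow> nat" where
  "random_weight bs k = bin (block nbits k bs)"

lemma block_stake: "k < m \<Longrightarrow> block r k (stake (m * r) \<omega>) = stake r (sdrop (k * r) \<omega>)"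
proof -
  assume "k < m"
  then have "(k + 1) * r \<le> m * r" by (intro mult_le_mono1) simp
  then have "min r (m * r - k * r) = r" by simp
  then show ?thesis by (simp add: block_def drop_stake take_stake)
qed

text \<open>Edge \<open>k\<close> receives block \<open>k\<close> of a tape prefix of fixed length,
  which is the form the isolation bound expects.\<close>

lemma wp_draw_weights:
  assumes s: "s r_edges 0 = length ids" "\<And>k. k < length ids \<Longrightarrow> s r_type k = id_type (ids ! k)"
      "s r_bits 0 = nbits" "s r_big 0 = modulus"
    and B: "length ids \<le> B" "nbits \<le> B" "\<And>k. k < length ids \<Longrightarrow> id_type (ids ! k) \<le> B"
  shows "wp B draw_weights (\<lambda>s' \<omega>'. \<forall>k<length ids. s' r_weight k =
      random_weight (stake (length ids * nbits) \<omega>) k + modulus * id_type (ids ! k)) s \<omega>"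
  unfolding draw_weights_def
proof (rule wp_For[where n = "length ids" and I = "\<lambda>k s' \<omega>'. \<omega>' = sdrop (k * nbits) \<omega> \<and>
    (\<forall>k'<k. s' 20 k' = random_weight (stake (length ids * nbits) \<omega>) k' + modulus * id_type (ids ! k'))"], goal_cases)
  case (6 k s1 \<omega>1)
  have s1: "s1 11 = s 11" "s1 10 = s 10" "s1 18 = s 18" "s1 19 = s 19" using frameD[OF 6(2)] by auto
  note k = 6(1) and k1 = 6(3) and I1 = 6(4)
  show ?case
  proof (rule wp_Seq, rule wp_Store, rule wp_Seq, rule wp_For[where n = nbits and I = "\<lambda>i s' \<omega>'.
      \<omega>' = sdrop (k * nbits + i) \<omega> \<and> s' 41 0 = bin (stake i (sdrop (k * nbits) \<omega>))"], goal_cases)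
    case (6 i s2 \<omega>2)
    then show ?case
      by (intro wp_Seq wp_Flip wp_Store) (simp add: sdrop_simps sdrop_snth stake_Suc del: stake.simps)
  next
    case (7 s2 \<omega>2)
    have s2: "s2 10 = s 10" "s2 33 0 = k" "s2 19 = s 19" "s2 20 = s1 20" using frameD[OF 7(1)] s1 k1 by auto
    have w2: "\<omega>2 = sdrop (Suc k * nbits) \<omega>" using 7(3) by (simp add: add.commute)
    show ?case
    proof (rule wp_Seq, rule wp_For[where n = "id_type (ids ! k)" and I = "\<lambda>t s' \<omega>'.
        s' 41 0 = random_weight (stake (length ids * nbits) \<omega>) k + modulus * t"], goal_cases)
      case (6 t s3 \<omega>3)
      have "s3 19 0 = modulus" using frameD[OF 6(2), of 19] s2 s by simp
      then show ?case using 6(4) by (intro wp_Store) simp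
    next
      case (7 s3 \<omega>3)
      have s3: "s3 33 0 = k" "s3 20 = s1 20" "\<omega>3 = \<omega>2" using frameD[OF 7(1)] frame_tape[OF 7(1)] s2 by auto
      show ?case using 7(3) s3 w2 I1 by (intro wp_Store) (auto simp: less_Suc_eq)
    qed (use 7 s2 s k B in \<open>auto simp: random_weight_def block_stake\<close>)
  qed (use I1 s s1 B in auto)
qed (use s B in auto)

lemma wp_setup_tables:
  assumes s: "s r_target 0 = target" "s r_big 0 = modulus" "s r_nsq 0 = n * n"
    and B: "target \<le> B" "modulus * (target + 1) \<le> B"
  shows "wp B setup_tables (\<lambda>s' \<omega>'. s' r_low 0 = modulus * target \<and> s' r_max 0 = modulus * (target + 1) \<and>
    s' r_verts 0 = 2 * (n * n) \<and> (\<forall>x<modulus * (target + 1). s' r_xrow x = x * (2 * (n * n)))) s \<omega>"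
  unfolding setup_tables_def
proof (rule wp_Seq, rule wp_Store, rule wp_Seq, rule wp_For[where n = target and I = "\<lambda>i s' \<omega>'. s' 21 0 = modulus * i"], goal_cases)
  case (6 k s1 \<omega>1)
  have "s1 19 0 = modulus" using frameD[OF 6(2), of 19] s by simp
  then show ?case using 6(4) by (intro wp_Store) simp
next
  case (7 s1 \<omega>1)
  have s1: "s1 19 0 = modulus" "s1 21 0 = modulus * target" "s1 3 0 = n * n"
    using frameD[OF 7(1), of 19] frameD[OF 7(1), of 3] s 7(3) by auto
  show ?case
  proof (intro wp_Seq wp_Store, rule wp_For[where n = "modulus * (target + 1)" and I = "\<lambda>k s' \<omega>'.
      s' 41 0 = k * (2 * (n * n)) \<and> (\<forall>x<k. s' 23 x = x * (2 * (n * n)))"], goal_cases)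
    case (6 k s2 \<omega>2)
    have "s2 24 0 = 2 * (n * n)" using frameD[OF 6(2), of 24] s1 by simp
    then show ?case using 6(3,4) by (intro wp_Seq wp_Store) (auto simp: less_Suc_eq)
  next
    case (7 s2 \<omega>2)
    have "s2 24 0 = 2 * (n * n)" "s2 21 0 = modulus * target" "s2 22 0 = modulus * (target + 1)"
      using frameD[OF 7(1), of 24] frameD[OF 7(1), of 21] frameD[OF 7(1), of 22] s1 by simp_all
    then show ?case using 7(3) by simp
  qed (use s1 B in auto)
qed (use s B in auto)

end

section \<open>Correctness of the search\<close>

lemma xor_mod2: "(a mod 2 - b mod 2) + (b mod 2 - a mod 2) = (a + b) mod (2 :: nat)"
  by (cases "even a"; cases "even b") (simp_all add: mod2_eq_if)

lemma index_eq_iff: "a < V \<Longrightarrow> b < V \<Longrightarrow> x * V + a = y * V + b \<longleftrightarrow> x = y \<and> a = (b :: nat)"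
  by (metis add.commute div_less div_mult_self1 mod_less mod_mult_self1 add_0 not_less_zero)

lemma writes_walk_edge [simp]: "writes walk_edge = {26, 43}" and flip_free_walk_edge [simp]: "flip_free walk_edge"
  by (auto simp: walk_edge_def extend_walk_def xor_into_def)

lemma writes_walk_table [simp]: "writes walk_table = {26, 33, 34, 35, 43}" and flip_free_walk_table [simp]: "flip_free walk_table"
  by (auto simp: walk_table_def)

lemma writes_parity_table [simp]: "writes parity_table = {25, 26, 33, 34, 35, 36, 43}"
  and flip_free_parity_table [simp]: "flip_free parity_table"
  by (auto simp: parity_table_def xor_into_def)

text \<open>\<open>X\<close> is the number of rows (weights) and \<open>V\<close> the number of
  columns (vertices); edges with source \<open>q\<close> are left out.\<close>

locale walk_tables =
  fixes m V X q :: nat and sr ds wt :: "nat \<Rightarrow> nat"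
  assumes sr_less: "k < m \<Longrightarrow> sr k < V" and ds_less: "k < m \<Longrightarrow> ds k < V"
    and sr_neq_ds: "k < m \<Longrightarrow> sr k \<noteq> ds k" and wt_pos: "k < m \<Longrightarrow> 0 < wt k" and X_pos: "0 < X"
begin

definition kept :: "nat set" where
  "kept = {k. k < m \<and> sr k \<noteq> q}"

abbreviation total :: "nat \<Rightarrow> nat \<Rightarrow> nat" where
  "total h \<equiv> walk_seq_count kept sr ds wt h"

abbreviation walks :: "nat \<Rightarrow> nat \<Rightarrow> nat \<Rightarrow> nat" where
  "walks h x a \<equiv> walk_count kept sr ds wt (total h) h x a"

definition loaded :: "mem \<Rightarrow> bool" where
  "loaded s \<longleftrightarrow> s r_edges 0 = m \<and> s r_max 0 = X \<and> s r_verts 0 = V \<and> s r_skip 0 = q \<and>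
     (\<forall>x<X. s r_xrow x = x * V) \<and> (\<forall>k<m. s r_src k = sr k \<and> s r_dst k = ds k \<and> s r_weight k = wt k)"

lemma loaded_cong:
  "loaded s \<Longrightarrow> (\<And>x. x \<in> {8, 9, 11, 20, 22, 23, 24, 42} \<Longrightarrow> s' x = s x) \<Longrightarrow> loaded s'"
  by (simp add: loaded_def)

definition contribution :: "nat \<Rightarrow> nat \<Rightarrow> nat \<Rightarrow> nat \<Rightarrow> nat" where
  "contribution h x k a = (if wt k \<le> x \<and> 0 < wt k then
     (if ds k = a \<and> a < h then walks h (x - wt k) (sr k) else 0) +
     (if sr k = a \<and> a < h then walks h (x - wt k) (ds k) else 0) else 0)"

definition partial_walks :: "nat \<Rightarrow> nat \<Rightarrow> nat \<Rightarrow> nat \<Rightarrow> nat" where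
  "partial_walks h x j a = (if a = h then total h x else 0) + (\<Sum>k | k < j \<and> sr k \<noteq> q. contribution h x k a)"

lemma partial_walks_0: "partial_walks h x 0 a = (if a = h then total h x else 0)"
  by (simp add: partial_walks_def)

lemma partial_walks_Suc:
  "partial_walks h x (Suc j) a = partial_walks h x j a + (if sr j \<noteq> q then contribution h x j a else 0)"
proof -
  have "{k. k < Suc j \<and> sr k \<noteq> q} = (if sr j \<noteq> q then insert j {k. k < j \<and> sr k \<noteq> q} else {k. k < j \<and> sr k \<noteq> q})"
    by (auto simp: less_Suc_eq)
  then show ?thesis by (simp add: partial_walks_def)
qed

lemma partial_walks_final: "partial_walks h x m a = walks h x a"
  unfolding partial_walks_def contribution_def kept_def[symmetric] walk_count.simps[of kept _ _ _ _ h x a] ..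

text \<open>The state in the middle of row \<open>x\<close> after \<open>j\<close> edges: earlier
  rows are complete, later rows hold only the starts at \<open>h\<close>.\<close>

definition walk_rows :: "nat \<Rightarrow> nat \<Rightarrow> nat \<Rightarrow> mem \<Rightarrow> bool" where
  "walk_rows h x j s \<longleftrightarrow> (\<forall>y<X. \<forall>a<V. s r_walk (y * V + a) =
     (if y < x then walks h y a mod 2 else if y = x then partial_walks h x j a mod 2
      else if a = h then total h y mod 2 else 0))"

lemma wp_walk_edge:
  assumes l: "loaded s" and r: "walk_rows h x j s" and j: "j < m" "x < X" "h < V"
    and s: "s r_k 0 = j" "s r_x 0 = x" "s r_h 0 = h"
  shows "wp B walk_edge (\<lambda>s' \<omega>'. walk_rows h x (Suc j) s') s \<omega>"
proof -
  have l1: "s 8 j = sr j" "s 9 j = ds j" "s 20 j = wt j" "s 42 0 = q" "s 23 x = x * V" "s 23 (x - wt j) = (x - wt j) * V"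
    using l j by (auto simp: loaded_def)
  have lt: "sr j < V" "ds j < V" "sr j \<noteq> ds j" "0 < wt j" using sr_less ds_less sr_neq_ds wt_pos j by auto
  show ?thesis
  proof (cases "sr j \<noteq> q \<and> wt j \<le> x")
    case False
    then have "partial_walks h x (Suc j) a = partial_walks h x j a" for a
      by (auto simp: partial_walks_Suc contribution_def)
    then have "walk_rows h x (Suc j) s" using r by (simp add: walk_rows_def)
    then show ?thesis unfolding walk_edge_def using False l1 s
      by (intro wp_Cond wp_Skip) auto
  next
    case True
    have xw: "x - wt j < x" using True lt by simp
    have prev: "s 26 ((x - wt j) * V + a) = walks h (x - wt j) a mod 2" if "a < V" for a
      using r xw j that by (simp add: walk_rows_def)
    have cur: "s 26 (x * V + a) = partial_walks h x j a mod 2" if "a < V" for a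
      using r j that by (simp add: walk_rows_def)
    \<comment> \<open>Entries are read from an earlier row than the one written, so the update in
      one direction does not disturb the other.\<close>
    have ne: "(x - wt j) * V + a \<noteq> x * V + b" if "a < V" "b < V" for a b
      using index_eq_iff[OF that] xw by simp
    define e1 where "e1 = (if ds j < h then (s 26)(x * V + ds j := (partial_walks h x j (ds j) + walks h (x - wt j) (sr j)) mod 2) else s 26)"
    define e2 where "e2 = (if sr j < h then e1(x * V + sr j := (partial_walks h x j (sr j) + walks h (x - wt j) (ds j)) mod 2) else e1)"
    have cur1: "e1 (x * V + sr j) = partial_walks h x j (sr j) mod 2"
      using cur[OF lt(1)] lt index_eq_iff[OF lt(1,2)] by (simp add: e1_def)
    have prev1: "e1 ((x - wt j) * V + ds j) = walks h (x - wt j) (ds j) mod 2"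
      using prev[OF lt(2)] ne[OF lt(2,2)] by (simp add: e1_def)
    have rows: "walk_rows h x (Suc j) s'" if s': "s' 26 = e2" for s'
      unfolding walk_rows_def
    proof (intro allI impI)
      fix y a assume y: "y < X" and a: "a < V"
      have old: "s 26 (y * V + a) = (if y < x then walks h y a mod 2 else if y = x then partial_walks h x j a mod 2
        else if a = h then total h y mod 2 else 0)" using r y a by (simp add: walk_rows_def)
      have "e2 (y * V + a) = (if y = x then partial_walks h x (Suc j) a mod 2 else s 26 (y * V + a))"
        using a lt True cur[OF a] index_eq_iff[OF a lt(1), of y x] index_eq_iff[OF a lt(2), of y x]
        by (auto simp: e2_def e1_def partial_walks_Suc contribution_def)
      then show "s' 26 (y * V + a) = (if y < x then walks h y a mod 2 else if y = x then partial_walks h x (Suc j) a mod 2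
        else if a = h then total h y mod 2 else 0)" using old s' by auto
    qed
    define s1 where "s1 = upd s 43 0 ((x - wt j) * V)"
    define s2 where "s2 = (if ds j < h then upd s1 26 (x * V + ds j) ((partial_walks h x j (ds j) + walks h (x - wt j) (sr j)) mod 2) else s1)"
    have s2: "s2 26 = e1" "\<And>y. y \<noteq> 26 \<Longrightarrow> s2 y = s1 y" by (auto simp: s2_def s1_def e1_def)
    show ?thesis unfolding walk_edge_def
    proof (rule wp_Cond)
      show "wp B Skip (\<lambda>s' \<omega>'. walk_rows h x (Suc j) s') s \<omega>"
        if "\<not> bval (Conj (Neg (Equal (Fetch r_src (sc r_k)) (sc r_skip))) (Neg (Less (sc r_x) (Fetch r_weight (sc r_k))))) s"
        using that True l1 s by simp
      have 1: "upd s 43 (aval (Const 0) s) (aval (Fetch r_xrow (Minus (sc r_x) (Fetch r_weight (sc r_k)))) s) = s1"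
        using l1 s by (simp add: s1_def)
      have s1: "\<And>y. y \<noteq> 43 \<Longrightarrow> s1 y = s y" "s1 43 0 = (x - wt j) * V" by (auto simp: s1_def)
      show "wp B (set_sc r_prev (Fetch r_xrow (Minus (sc r_x) (Fetch r_weight (sc r_k)))) ;;
          extend_walk r_src r_dst ;; extend_walk r_dst r_src) (\<lambda>s' \<omega>'. walk_rows h x (Suc j) s') s \<omega>"
      proof (rule wp_Seq, rule wp_Store, unfold 1, rule wp_Seq)
        have "wp B (extend_walk r_src r_dst) (\<lambda>s' \<omega>'. s' = s2) s1 \<omega>"
          unfolding extend_walk_def xor_into_def
          by (intro wp_Cond wp_Store wp_Skip)
             (use s s1 l1 lt cur[OF lt(2)] prev[OF lt(1)] in \<open>simp_all add: s2_def xor_mod2\<close>)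
        then show "wp B (extend_walk r_src r_dst)
            (wp B (extend_walk r_dst r_src) (\<lambda>s' \<omega>'. walk_rows h x (Suc j) s')) s1 \<omega>"
        proof (rule wp_mono)
          fix s' \<omega>' assume s': "s' = s2"
          show "wp B (extend_walk r_dst r_src) (\<lambda>s' \<omega>'. walk_rows h x (Suc j) s') s' \<omega>'"
            unfolding s' extend_walk_def xor_into_def
            by (intro wp_Cond wp_Store wp_Skip rows)
               (use s s1 s2 l1 lt cur1 prev1 in \<open>simp_all add: e2_def xor_mod2\<close>)
        qed
      qed
    qed
  qed
qed

lemma wp_walk_table:
  assumes l: "loaded s" and d: "\<And>x. x < X \<Longrightarrow> s r_total x = total h x mod 2" and h: "h < V" "s r_h 0 = h"
    and B: "X \<le> B" "V \<le> B" "m \<le> B"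
  shows "wp B walk_table (\<lambda>s' \<omega>'. \<forall>x<X. \<forall>a<V. s' r_walk (x * V + a) = walks h x a mod 2) s \<omega>"
  unfolding walk_table_def
proof (rule wp_Seq, rule wp_For[where n = X and I = "\<lambda>k s' \<omega>'. \<forall>x<k. \<forall>a<V. s' 26 (x * V + a) = (if a = h then total h x mod 2 else 0)"], goal_cases)
  case (6 k s1 \<omega>1)
  have f1: "s1 y = s y" if "y \<notin> {26, 34, 35}" for y using frameD[OF 6(2), of y] that by auto
  have l1: "loaded s1" by (rule loaded_cong[OF l]) (auto simp: f1)
  note k = 6(1,3) and I = 6(4)
  show ?case
  proof (rule wp_Seq, rule wp_For[where n = V and I = "\<lambda>j s' \<omega>'. (\<forall>x<k. \<forall>a<V. s' 26 (x * V + a) = (if a = h then total h x mod 2 else 0)) \<and>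
      (\<forall>a<j. s' 26 (k * V + a) = 0)"], goal_cases)
    case (6 j s2 \<omega>2)
    have s2: "s2 34 0 = k" "s2 23 k = k * V"
      using frameD[OF 6(2), of 34] frameD[OF 6(2), of 23] k l1 by (auto simp: loaded_def)
    show ?case
    proof (rule wp_Store)
      have "(x * V + a = k * V + j) = False" if "x < k" "a < V" for x a
        using index_eq_iff[OF that(2) 6(1), of x k] that by simp
      then show "(\<forall>x<k. \<forall>a<V. upd (upd s2 26 (aval (Plus (Fetch r_xrow (sc r_x)) (sc r_c)) s2) (aval (Const 0) s2)) 35 0 (Suc j) 26 (x * V + a) =
          (if a = h then total h x mod 2 else 0)) \<and>
        (\<forall>a<Suc j. upd (upd s2 26 (aval (Plus (Fetch r_xrow (sc r_x)) (sc r_c)) s2) (aval (Const 0) s2)) 35 0 (Suc j) 26 (k * V + a) = 0)"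
        using 6(3,4) s2 by (auto simp: less_Suc_eq)
    qed
  next
    case (7 s2 \<omega>2)
    have s2: "s2 34 0 = k" "s2 23 k = k * V" "s2 25 k = total h k mod 2" "s2 36 0 = h"
      using frameD[OF 7(1), of 34] frameD[OF 7(1), of 23] frameD[OF 7(1), of 25] frameD[OF 7(1), of 36] f1 k l1 d h
      by (auto simp: loaded_def)
    have "(x * V + a = k * V + h) = (x = k \<and> a = h)" if "a < V" for x a
      using index_eq_iff[OF that h(1), of x k] .
    then show ?case
      by (intro wp_Store) (use 7(3) s2 in \<open>auto simp: less_Suc_eq\<close>)
  qed (use I l1 k B in \<open>auto simp: loaded_def\<close>)
next
  case (7 s1 \<omega>1)
  have f1: "s1 y = s y" if "y \<notin> {26, 34, 35}" for y using frameD[OF 7(1), of y] that by auto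
  have l1: "loaded s1" by (rule loaded_cong[OF l]) (auto simp: f1)
  note I1 = 7(3)
  show ?case
  proof (rule wp_For[where n = X and I = "\<lambda>x s' \<omega>'. walk_rows h x 0 s'"], goal_cases)
    case (6 x s2 \<omega>2)
    have f2: "s2 y = s y" if "y \<notin> {26, 33, 34, 35, 43}" for y using frameD[OF 6(2), of y] f1[of y] that by auto
    note x = 6(1,3)
    show ?case
    proof (rule wp_For[where n = m and I = "\<lambda>j s' \<omega>'. walk_rows h x j s'"], goal_cases)
      case (6 j s3 \<omega>3)
      have f3: "s3 y = s2 y" if "y \<notin> {26, 33, 43}" for y using frameD[OF 6(2), of y] that by auto
      have l3: "loaded s3" by (rule loaded_cong[OF l]) (auto simp: f2 f3)
      have "wp B walk_edge (\<lambda>s' \<omega>'. walk_rows h x (Suc j) s') s3 \<omega>3"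
        by (rule wp_walk_edge[OF l3 6(4)]) (use 6 x h in \<open>auto simp: f2 f3\<close>)
      then show ?case by (rule wp_mono) (simp add: walk_rows_def)
    next
      case (7 s3 \<omega>3)
      then show ?case by (auto simp: walk_rows_def partial_walks_final partial_walks_0 less_Suc_eq)
    next
      case 3
      then show ?case using l f2 by (auto simp: loaded_def)
    next
      case 5
      then show ?case using 6(4) by (simp add: walk_rows_def)
    qed (use B in auto)
  next
    case 5
    then show ?case using I1 by (auto simp: walk_rows_def partial_walks_0)
  next
    case (7 s2 \<omega>2)
    then show ?case by (auto simp: walk_rows_def)
  qed (use l1 B in \<open>auto simp: loaded_def\<close>)
qed (use l B in \<open>auto simp: loaded_def\<close>)

text \<open>The outer loop carries out the recursion of \<open>walk_seq_count\<close> modulo 2,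
  starting from the empty vertex set, whose only matching has weight 0.\<close>

lemma wp_parity_table:
  assumes l: "loaded s" and B: "X \<le> B" "V \<le> B" "m \<le> B"
  shows "wp B parity_table (\<lambda>s' \<omega>'. \<forall>x<X. s' r_total x = total V x mod 2) s \<omega>"
  unfolding parity_table_def
proof (rule wp_Seq, rule wp_For[where n = X and I = "\<lambda>k s' \<omega>'. \<forall>x<k. s' 25 x = 0"], goal_cases)
  case (6 k s1 \<omega>1)
  then show ?case by (intro wp_Store) (auto simp: less_Suc_eq)
next
  case (7 s1 \<omega>1)
  have f1: "s1 y = s y" if "y \<notin> {25, 34}" for y using frameD[OF 7(1), of y] that by auto
  show ?case
  proof (rule wp_Seq, rule wp_Store, rule wp_For[where n = V and I = "\<lambda>h s' \<omega>'. \<forall>x<X. s' 25 x = total h x mod 2"], goal_cases)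
    case (6 h s2 \<omega>2)
    have f2: "s2 y = s y" if "y \<notin> {25, 26, 33, 34, 35, 36, 43}" for y
      using frameD[OF 6(2), of y] f1[of y] that by (auto simp: xor_into_def)
    have l2: "loaded s2" by (rule loaded_cong[OF l]) (auto simp: f2)
    note h = 6(1,3) and I2 = 6(4)
    have "wp B walk_table (\<lambda>s' \<omega>'. \<forall>x<X. \<forall>a<V. s' r_walk (x * V + a) = walks h x a mod 2) s2 \<omega>2"
      by (rule wp_walk_table[OF l2]) (use h I2 B in auto)
    then show ?case
    proof (rule wp_Seq[OF wp_mono], goal_cases)
      case (1 s3 \<omega>3)
      have f3: "s3 y = s2 y" if "y \<notin> {26, 33, 34, 35, 43}" for y using frameD[OF 1(1), of y] that by auto
      have l3: "loaded s3" by (rule loaded_cong[OF l2]) (auto simp: f3)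
      have W: "s3 26 (x * V + a) = walks h x a mod 2" if "x < X" "a < V" for x a using 1(2) that by simp
      have D3: "s3 25 x = total h x mod 2" if "x < X" for x using I2 that by (simp add: f3)
      show ?case
      proof (rule wp_For[where n = X and I = "\<lambda>k s' \<omega>'. \<forall>x<X. s' 25 x = (if x < k then total (Suc h) x else total h x) mod 2"], goal_cases)
        case (6 k s4 \<omega>4)
        have f4: "s4 y = s3 y" if "y \<notin> {25, 34, 35}" for y using frameD[OF 6(2), of y] that by (auto simp: xor_into_def)
        note k = 6(1,3) and I4 = 6(4)
        show ?case
        proof (rule wp_For[where n = h and I = "\<lambda>j s' \<omega>'. \<forall>x<X. s' 25 x =
            (if x < k then total (Suc h) x else if x = k then total h k + (\<Sum>a<j. walks h k a) else total h x) mod 2"], goal_cases)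
          case (6 j s5 \<omega>5)
          have f5: "s5 y = s4 y" if "y \<notin> {25, 35}" for y using frameD[OF 6(2), of y] that by (auto simp: xor_into_def)
          have s5: "s5 23 k = k * V" "s5 26 (k * V + j) = walks h k j mod 2" "s5 34 0 = k" "s5 35 0 = j"
            "s5 25 k = (total h k + (\<Sum>a<j. walks h k a)) mod 2"
            using l3 W[of k j] k h(1) 6(1,3,4) by (auto simp: f5 f4 loaded_def)
          show ?case unfolding xor_into_def
            by (rule wp_Store) (use 6(4) k s5 in \<open>auto simp: xor_mod2 add.assoc\<close>)
        next
          case 3
          then show ?case using h f3[of 36] f4[of 36] by simp
        next
          case 4
          then show ?case using h B by simp
        next
          case 5
          then show ?case using I4 by auto
        next
          case (7 s5 \<omega>5)
          then show ?case by (auto simp: less_Suc_eq)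
        qed (auto simp: xor_into_def)
      next
        case 5
        then show ?case using D3 by simp
      next
        case (7 s4 \<omega>4)
        then show ?case by simp
      qed (use l3 B in \<open>auto simp: xor_into_def loaded_def\<close>)
    qed
  next
    case 5
    then show ?case using 7(3) by auto
  qed (use l f1 B in \<open>auto simp: xor_into_def loaded_def\<close>)
qed (use l B in \<open>auto simp: loaded_def\<close>)

end

lemma writes_collect_edge [simp]: "writes collect_edge = {1, 27, 28}" and flip_free_collect_edge [simp]: "flip_free collect_edge"
  by (auto simp: collect_edge_def)

lemma writes_candidate [simp]: "writes candidate = {1, 25, 26, 27, 28, 30, 31, 32, 33, 34, 35, 36, 40, 42, 43}"
  and flip_free_candidate [simp]: "flip_free candidate"
  by (auto simp: candidate_def)

lemma writes_verify [simp]: "writes verify = {1, 29, 30, 32}" and flip_free_verify [simp]: "flip_free verify"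
  by (auto simp: verify_def)

section \<open>From parity tables to verified candidates\<close>

context factor_instance
begin

lemma set_cores: "set cores = core_ids"
  unfolding cores_def vertex_list_def core_list_def core_ids_def by force

lemma set_ids: "set ids = core_ids \<union> port_ids"
proof -
  have "set (concat (map port_row [0..<n])) = port_ids"
  proof (intro equalityI subsetI)
    fix k assume "k \<in> set (concat (map port_row [0..<n]))"
    then show "k \<in> port_ids"
      unfolding port_row_def port_pair_def port_ids_def pairs_def by (force split: if_splits)
  next
    fix k assume "k \<in> port_ids"
    then obtain u v b where k: "k = (pt u v, pt v u, b)" "v < u" "u < n" "lab u v \<noteq> 0" "b < 2"
      unfolding port_ids_def pairs_def by blast
    then have "k \<in> set (port_pair u v)" by (auto simp: port_pair_def less_2_cases_iff)
    then have "k \<in> set (port_row u)" using k(2) by (force simp: port_row_def)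
    then show "k \<in> set (concat (map port_row [0..<n]))" using k(3) by force
  qed
  then show ?thesis by (simp add: ids_def set_cores)
qed

lemma distinct_concat_map_upt:
  assumes "\<And>i. i < m \<Longrightarrow> distinct (f i)" "\<And>i j x. i < m \<Longrightarrow> j < m \<Longrightarrow> x \<in> set (f i) \<Longrightarrow> x \<in> set (f j) \<Longrightarrow> i = j"
  shows "distinct (concat (map f [0..<m]))"
  using assms
proof (induction m)
  case (Suc m)
  have "distinct (concat (map f [0..<m]))" using Suc.prems by (intro Suc.IH) (auto intro: less_SucI)
  moreover have "x \<notin> set (f m)" if "x \<in> set (f i)" "i < m" for x i
    using Suc.prems(2)[of i m x] that by auto
  ultimately show ?case using Suc.prems(1) by auto
qed simp

lemma distinct_ids: "distinct ids"
proof -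
  have "distinct (core_list u i)" for u i
    unfolding core_list_def by (auto simp: distinct_map inj_on_def pt_def)
  then have "distinct (vertex_list u)" for u
    unfolding vertex_list_def by (rule distinct_concat_map_upt) (auto simp: core_list_def core_eq_iff)
  then have 1: "distinct cores"
    unfolding cores_def by (rule distinct_concat_map_upt) (auto simp: vertex_list_def core_list_def core_eq_iff)
  have "distinct (port_pair u v)" for u v by (simp add: port_pair_def)
  then have "distinct (port_row u)" if "u < n" for u
    unfolding port_row_def
    by (rule distinct_concat_map_upt) (use that in \<open>auto simp: port_pair_def pt_def split: if_splits\<close>)
  then have 2: "distinct (concat (map port_row [0..<n]))"
    by (rule distinct_concat_map_upt) (auto simp: port_row_def port_pair_def pt_eq_iff split: if_splits)
  have "x \<notin> set (concat (map port_row [0..<n]))" if x: "x \<in> set cores" for x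
  proof
    assume "x \<in> set (concat (map port_row [0..<n]))"
    then obtain u v b where "x = (pt u v, pt v u, b)" "v < u" "u < n"
      unfolding port_row_def port_pair_def by (auto split: if_splits)
    moreover obtain u' i w where "x = (core u' i, pt u' w, 0)"
      using x unfolding set_cores core_ids_def by blast
    ultimately show False using core_neq_pt(1)[of u v u' i] by auto
  qed
  then show ?thesis unfolding ids_def using 1 2 by auto
qed

abbreviation source :: "nat \<Rightarrow> nat" where "source k \<equiv> fst (ids ! k)"
abbreviation sink :: "nat \<Rightarrow> nat" where "sink k \<equiv> fst (snd (ids ! k))"

definition weight :: "bool list \<Rightarrow> nat \<Rightarrow> nat" where
  "weight bs k = random_weight bs k + modulus * id_type (ids ! k)"

lemma id_endpoints:
  assumes "x \<in> set ids"
  shows "fst x < 2 * (n * n)" "fst (snd x) < 2 * (n * n)" "fst x \<noteq> fst (snd x)"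
proof -
  have "fst x < 2 * (n * n) \<and> fst (snd x) < 2 * (n * n) \<and> fst x \<noteq> fst (snd x)"
    using assms unfolding set_ids
  proof
    assume "x \<in> core_ids"
    then obtain u i v where "x = (core u i, pt u v, 0)" "u < n" "i < n" "v < n" unfolding core_ids_def by auto
    then show ?thesis using pt_less[of u i] pt_less[of u v] by (auto simp: core_def)
  next
    assume "x \<in> port_ids"
    then obtain u v b where "x = (pt u v, pt v u, b)" "v < u" "u < n" unfolding port_ids_def pairs_def by auto
    then show ?thesis using pt_less[of u v] pt_less[of v u] pt_eq_iff[of u v v u] by auto
  qed
  then show "fst x < 2 * (n * n)" "fst (snd x) < 2 * (n * n)" "fst x \<noteq> fst (snd x)" by auto
qed

lemma weight_pos: "0 < weight bs k"
  by (simp add: weight_def modulus_def id_type_def)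

lemma walk_tables_ids: "walk_tables (length ids) (2 * (n * n)) (modulus * (target + 1)) source sink (weight bs)"
  by unfold_locales (use id_endpoints in \<open>auto simp: weight_pos modulus_def\<close>)

text \<open>Deleting all edges with source \<open>pt u v\<close> deletes exactly the two copies of
  the pair.\<close>

definition edge_parity :: "bool list \<Rightarrow> nat \<Rightarrow> nat \<Rightarrow> nat \<Rightarrow> nat" where
  "edge_parity bs w u v = walk_seq_count {k. k < length ids \<and> source k \<noteq> pt u v} source sink (weight bs)
     (2 * (n * n)) (modulus * target + w) mod 2"

definition cand :: "bool list \<Rightarrow> nat \<Rightarrow> (nat \<times> nat) set" where
  "cand bs w = {(u, v) \<in> pairs. edge_parity bs w u v = 0}"

definition ready :: "bool list \<Rightarrow> mem \<Rightarrow> bool" where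
  "ready bs s \<longleftrightarrow> setup_done s \<and> s r_edges 0 = length ids \<and> s r_big 0 = modulus \<and>
     (\<forall>k<length ids. s r_src k = source k \<and> s r_dst k = sink k \<and> s r_weight k = weight bs k) \<and>
     s r_low 0 = modulus * target \<and> s r_max 0 = modulus * (target + 1) \<and> s r_verts 0 = 2 * (n * n) \<and>
     (\<forall>x<modulus * (target + 1). s r_xrow x = x * (2 * (n * n)))"

lemma ready_cong:
  "ready bs s \<Longrightarrow> (\<And>x. x \<in> {0, 2, 3, 4, 5, 6, 8, 9, 11, 19, 20, 21, 22, 23, 24} \<Longrightarrow> s' x = s x) \<Longrightarrow> ready bs s'"
  using setup_done_cong[of s s'] by (simp add: ready_def)

text \<open>Degrees and class sizes are counted while the list grows, so \<open>verify\<close> need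
  not scan the output.\<close>

definition collected :: "(nat \<times> nat) set \<Rightarrow> mem \<Rightarrow> bool" where
  "collected S s \<longleftrightarrow> (\<exists>ps. distinct ps \<and> set ps = S \<and> s r_out 1 = length ps \<and>
     (\<forall>i<length ps. s r_out (2 * i + 2) = fst (ps ! i) \<and> s r_out (2 * i + 3) = snd (ps ! i))) \<and>
     (\<forall>u<n. s r_cdeg u = card (incident S u)) \<and> (\<forall>i<c. s r_ccnt (jl i) = card (class_of S (jl i)))"

lemma collected_cong: "collected S s \<Longrightarrow> s' 1 = s 1 \<Longrightarrow> s' 27 = s 27 \<Longrightarrow> s' 28 = s 28 \<Longrightarrow> collected S s'"
  by (simp add: collected_def)

lemma collected_upd [simp]: "x \<notin> {1, 27, 28} \<Longrightarrow> collected S (upd s x i v) = collected S s"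
  by (simp add: collected_def)

lemma wp_collect_edge:
  assumes col: "collected S s" and uv: "(u, v) \<notin> S" "v < u" "u < n" and fin: "finite S"
    and s: "s r_u 0 = u" "s r_v 0 = v" "s r_label 0 = lab u v"
  shows "wp B collect_edge (\<lambda>s' \<omega>'. collected (insert (u, v) S) s' \<and> s' r_out 0 = s r_out 0) s \<omega>"
proof -
  obtain ps where ps: "distinct ps" "set ps = S" "s 1 1 = length ps"
    "\<And>i. i < length ps \<Longrightarrow> s 1 (2 * i + 2) = fst (ps ! i) \<and> s 1 (2 * i + 3) = snd (ps ! i)"
    using col unfolding collected_def by blast
  define L where "L = length ps"
  define A where "A = (s 1)(L + L + 2 := u, L + L + 3 := v, 1 := L + 1)"
  define D where "D = (s 27)(u := s 27 u + 1, v := s 27 v + 1)"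
  define C where "C = (s 28)(lab u v := s 28 (lab u v) + 1)"
  have A0: "A 0 = s 1 0" and A1: "A 1 = L + 1" by (simp_all add: A_def)
  have entries: "A (2 * i + 2) = fst ((ps @ [(u, v)]) ! i) \<and> A (2 * i + 3) = snd ((ps @ [(u, v)]) ! i)"
    if i: "i < length (ps @ [(u, v)])" for i
  proof (cases "i < L")
    case True
    then have "2 * i + 2 \<noteq> L + L + 2" "2 * i + 2 \<noteq> L + L + 3" "2 * i + 3 \<noteq> L + L + 2" "2 * i + 3 \<noteq> L + L + 3" by presburger+
    then show ?thesis using ps(4)[of i] True by (simp add: A_def L_def nth_append)
  next
    case False
    then have "i = L" using i by (simp add: L_def)
    then show ?thesis by (simp add: A_def nth_append L_def[symmetric])
  qed
  define qs where "qs = ps @ [(u, v)]"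
  have qs: "distinct qs" "set qs = insert (u, v) S" "A 1 = length qs"
    using ps(1,2) uv A1 by (auto simp: L_def qs_def)
  have "\<forall>i<length qs. A (2 * i + 2) = fst (qs ! i) \<and> A (2 * i + 3) = snd (qs ! i)"
    using entries unfolding qs_def by blast
  with qs have out: "\<exists>ps. distinct ps \<and> set ps = insert (u, v) S \<and> A 1 = length ps \<and>
     (\<forall>i<length ps. A (2 * i + 2) = fst (ps ! i) \<and> A (2 * i + 3) = snd (ps ! i))" by metis
  have inc: "incident (insert (u, v) S) x = (if x = u \<or> x = v then insert (u, v) (incident S x) else incident S x)" for x
    by (auto simp: incident_def)
  have deg: "D x = card (incident (insert (u, v) S) x)" if "x < n" for x
    using col uv fin that unfolding collected_def inc by (auto simp: D_def incident_def)
  have cl: "class_of (insert (u, v) S) l = (if l = lab u v then insert (u, v) (class_of S l) else class_of S l)" for l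
    by (auto simp: class_of_def)
  have cnt: "C (jl i) = card (class_of (insert (u, v) S) (jl i))" if "i < c" for i
    using col uv fin that unfolding collected_def cl by (auto simp: C_def class_of_def)
  have final: "collected (insert (u, v) S) s' \<and> s' 1 0 = s 1 0" if "s' 1 = A" "s' 27 = D" "s' 28 = C" for s'
    unfolding collected_def that using out deg cnt A0 by blast
  show ?thesis
    unfolding collect_edge_def
    by (intro wp_Seq wp_Store, rule final) (use s ps(3) uv in \<open>simp_all add: A_def D_def C_def L_def fun_eq_iff\<close>)
qed

lemma wp_candidate:
  assumes r: "ready bs s" and w: "s r_w 0 = w" "w < modulus"
    and B: "n \<le> B" "c \<le> B" "length ids \<le> B" "modulus * (target + 1) \<le> B" "2 * (n * n) \<le> B"
  shows "wp B candidate (\<lambda>s' \<omega>'. collected (cand bs w) s' \<and> s' r_out 0 = s r_out 0) s \<omega>"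
  unfolding candidate_def
proof (rule wp_Seq, rule wp_Store, rule wp_Seq, rule wp_For[where n = n and I = "\<lambda>k s' \<omega>'. \<forall>u<k. s' 27 u = 0"], goal_cases)
  case (6 k s1 \<omega>1)
  then show ?case by (intro wp_Store) (auto simp: less_Suc_eq)
next
  case (7 s1 \<omega>1)
  have f1: "s1 y = s y" if "y \<notin> {1, 27, 30}" for y using frameD[OF 7(1), of y] that by auto
  have s1: "s1 1 1 = 0" "s1 1 0 = s 1 0" "\<And>u. u < n \<Longrightarrow> s1 27 u = 0" using frameD[OF 7(1), of 1] 7(3) by auto
  have r1: "ready bs s1" by (rule ready_cong[OF r]) (auto simp: f1)
  then have sd1: "setup_done s1" by (simp add: ready_def)
  show ?case
  proof (rule wp_Seq, rule wp_For[where n = c and I = "\<lambda>k s' \<omega>'. \<forall>i<k. s' 28 (jl i) = 0"], goal_cases)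
    case (6 k s2 \<omega>2)
    have "setup_done s2" by (rule setup_done_cong[OF sd1]) (use frameD[OF 6(2)] in auto)
    note dd = demand_data[OF this 6(1)]
    then show ?case using 6(3,4) by (intro wp_Store) (auto simp: less_Suc_eq)
  next
    case 3
    then show ?case using demand_number[OF sd1] by simp
  next
    case (7 s2 \<omega>2)
    have f2: "s2 y = s y" if "y \<notin> {1, 27, 28, 30, 32}" for y using frameD[OF 7(1), of y] f1[of y] that by auto
    have s2: "s2 1 = s1 1" "s2 27 = s1 27" using frameD[OF 7(1)] by auto
    have r2: "ready bs s2" by (rule ready_cong[OF r]) (auto simp: f2)
    have c2: "collected {} s2" unfolding collected_def s2 using s1 7(3)
      by (auto simp: incident_def class_of_def)
    show ?case
    proof (rule wp_For[where n = n and I = "\<lambda>k s' \<omega>'. collected {p \<in> cand bs w. fst p < k} s' \<and> s' 1 0 = s 1 0"], goal_cases)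
      case (6 u s3 \<omega>3)
      have f3: "s3 y = s2 y" if "y \<notin> {1, 25, 26, 27, 28, 30, 31, 33, 34, 35, 36, 40, 42, 43}" for y
        using frameD[OF 6(2), of y] that by auto
      note u = 6(1,3) and I3 = 6(4)
      \<comment> \<open>Pairs are visited in lexicographic order; \<open>?S j\<close> holds the
        candidates met before \<open>(u, j)\<close>.\<close>
      let ?S = "\<lambda>j. {p \<in> cand bs w. fst p < u \<or> fst p = u \<and> snd p < j}"
      show ?case
      proof (rule wp_For[where n = u and I = "\<lambda>j s' \<omega>'. collected (?S j) s' \<and> s' 1 0 = s 1 0"], goal_cases)
        case (6 v s4 \<omega>4)
        have f4: "s4 y = s3 y" if "y \<notin> {1, 25, 26, 27, 28, 31, 33, 34, 35, 36, 40, 42, 43}" for y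
          using frameD[OF 6(2), of y] that by auto
        have r4: "ready bs s4" by (rule ready_cong[OF r2]) (auto simp: f4 f3)
        have vn: "v < n" using 6(1) u by simp
        have s4: "s4 30 0 = u" "s4 31 0 = v" "s4 37 0 = w" "s4 4 u = u * n" "s4 0 (2 + (u * n + v)) = lab u v"
          using u(2) 6(3) w(1) f4[of 30] f4[of 37] f3[of 37] f2[of 37] r4 u(1) vn
          unfolding ready_def setup_done_def reads_input_def by auto
        define s5 where "s5 = upd s4 40 0 (lab u v)"
        have s5: "upd s4 40 (aval (Const 0) s4) (aval (Fetch r_in (Plus (Const 2) pair_index)) s4) = s5"
          using s4 by (simp add: s5_def)
        have f5: "s5 y = s4 y" if "y \<noteq> 40" for y using that by (simp add: s5_def)
        have c5: "collected (?S v) s5" "s5 1 0 = s 1 0" using 6(4) by (simp_all add: s5_def)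
        show ?case
        proof (rule wp_Seq, rule wp_Store, unfold s5, rule wp_Cond)
          assume "bval (Equal (sc r_label) (Const 0)) s5"
          then have "(u, v) \<notin> cand bs w" by (simp add: s5_def cand_def pairs_def)
          then have "?S (Suc v) = ?S v" by (auto simp: less_Suc_eq)
          then show "wp B Skip (\<lambda>s'' \<omega>''. collected (?S (Suc v)) (upd s'' 31 0 (Suc v)) \<and> upd s'' 31 0 (Suc v) 1 0 = s 1 0) s5 \<omega>4"
            using c5 by (intro wp_Skip) simp
        next
          assume "\<not> bval (Equal (sc r_label) (Const 0)) s5"
          then have lab: "lab u v \<noteq> 0" by (simp add: s5_def)
          define s6 where "s6 = upd s5 42 0 (pt u v)"
          have s6: "upd s5 42 (aval (Const 0) s5) (aval pair_index s5) = s6"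
            using s4 by (simp add: s6_def f5 pt_def)
          have f6: "s6 y = s5 y" if "y \<noteq> 42" for y using that by (simp add: s6_def)
          have r6: "ready bs s6" by (rule ready_cong[OF r4]) (auto simp: f6 f5)
          interpret wt: walk_tables "length ids" "2 * (n * n)" "modulus * (target + 1)" "pt u v" source sink "weight bs"
            by (rule walk_tables_ids)
          have "wt.loaded s6" unfolding wt.loaded_def using r6 by (simp add: ready_def s6_def)
          note parity = wt.wp_parity_table[OF this B(4,5,3)]
          have inS: "?S (Suc v) = (if edge_parity bs w u v = 0 then insert (u, v) (?S v) else ?S v)"
            using lab u(1) 6(1) by (auto simp: less_Suc_eq cand_def pairs_def)
          have wX: "modulus * target + w < modulus * (target + 1)" using w(2) by simp
          show "wp B (set_sc r_skip pair_index ;; parity_table ;;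
              Cond (Equal (Fetch r_total (Plus (sc r_low) (sc r_w))) (Const 0)) collect_edge Skip)
            (\<lambda>s'' \<omega>''. collected (?S (Suc v)) (upd s'' 31 0 (Suc v)) \<and> upd s'' 31 0 (Suc v) 1 0 = s 1 0) s5 \<omega>4"
          proof (rule wp_Seq, rule wp_Store, unfold s6, rule wp_Seq[OF wp_mono[OF parity]])
            fix s7 \<omega>7
            assume fr: "frame parity_table s6 \<omega>4 s7 \<omega>7"
              and D: "\<forall>x<modulus * (target + 1). s7 25 x = wt.total (2 * (n * n)) x mod 2"
            have f7: "s7 y = s5 y" if "y \<notin> {25, 26, 33, 34, 35, 36, 42, 43}" for y
              using frameD[OF fr, of y] f6[of y] that by auto
            have low: "s7 21 0 = modulus * target" "s7 37 0 = w"
              using r4 s4 by (simp_all add: f7 f5 ready_def)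
            have p: "s7 25 (modulus * target + w) = edge_parity bs w u v"
              using D wX by (simp add: edge_parity_def wt.kept_def)
            have c7: "collected (?S v) s7" "s7 1 0 = s 1 0"
              using c5 collected_cong[OF c5(1), of s7] by (simp_all add: f7)
            show "wp B (Cond (Equal (Fetch r_total (Plus (sc r_low) (sc r_w))) (Const 0)) collect_edge Skip)
              (\<lambda>s'' \<omega>''. collected (?S (Suc v)) (upd s'' 31 0 (Suc v)) \<and> upd s'' 31 0 (Suc v) 1 0 = s 1 0) s7 \<omega>7"
            proof (rule wp_Cond)
              assume "bval (Equal (Fetch r_total (Plus (sc r_low) (sc r_w))) (Const 0)) s7"
              then have z: "edge_parity bs w u v = 0" using low p by simp
              have "finite (?S v)" by (rule finite_subset[OF _ finite_pairs]) (auto simp: cand_def)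
              then have "wp B collect_edge (\<lambda>s' \<omega>'. collected (insert (u, v) (?S v)) s' \<and> s' r_out 0 = s7 r_out 0) s7 \<omega>7"
                using c7(1) 6(1) u(1) s4 by (intro wp_collect_edge) (auto simp: f7 f5, simp add: s5_def)
              then show "wp B collect_edge (\<lambda>s'' \<omega>''. collected (?S (Suc v)) (upd s'' 31 0 (Suc v)) \<and> upd s'' 31 0 (Suc v) 1 0 = s 1 0) s7 \<omega>7"
                by (rule wp_mono) (use z inS c7(2) in simp)
            next
              assume "\<not> bval (Equal (Fetch r_total (Plus (sc r_low) (sc r_w))) (Const 0)) s7"
              then have "edge_parity bs w u v \<noteq> 0" using low p by simp
              then show "wp B Skip (\<lambda>s'' \<omega>''. collected (?S (Suc v)) (upd s'' 31 0 (Suc v)) \<and> upd s'' 31 0 (Suc v) 1 0 = s 1 0) s7 \<omega>7"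
                using inS c7 by (intro wp_Skip) simp
            qed
          qed
        qed
      next
        case (7 s4 \<omega>4)
        have "?S u = {p \<in> cand bs w. fst p < Suc u}" by (auto simp: cand_def pairs_def)
        then show ?case using 7(3) by simp
      qed (use u I3 B in auto)
    next
      case (7 s3 \<omega>3)
      have "{p \<in> cand bs w. fst p < n} = cand bs w" by (auto simp: cand_def pairs_def)
      then show ?case using 7(3) by simp
    qed (use c2 s1 s2 r2 B in \<open>auto simp: ready_def setup_done_def\<close>)
  qed (use B in auto)
qed (use r B in \<open>auto simp: ready_def setup_done_def\<close>)

lemma wp_verify:
  assumes sd: "setup_done s" and col: "collected S s" and S: "S \<subseteq> pairs" and B: "n \<le> B" "c \<le> B"
  shows "wp B verify (\<lambda>s' \<omega>'. s' r_out = (s r_out)(0 := of_bool (solution S))) s \<omega>"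
  unfolding verify_def
proof (rule wp_Seq, rule wp_Store, rule wp_Seq,
    rule wp_For[where n = n and I = "\<lambda>k s' \<omega>'. s' 29 0 = of_bool (\<forall>u<k. card (incident S u) = d u)"], goal_cases)
  case (6 k s1 \<omega>1)
  have "s1 27 k = card (incident S k)" "s1 5 k = d k"
    using frameD[OF 6(2), of 27] frameD[OF 6(2), of 5] col sd 6(1) by (auto simp: collected_def setup_done_def)
  then show ?case using 6(3,4) by (intro wp_Cond wp_Skip wp_Store) (auto simp: less_Suc_eq)
next
  case (7 s1 \<omega>1)
  have f1: "s1 y = s y" if "y \<notin> {29, 30}" for y using frameD[OF 7(1), of y] that by auto
  have sd1: "setup_done s1" by (rule setup_done_cong[OF sd]) (auto simp: f1)
  note I1 = 7(3)
  show ?case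
  proof (rule wp_Seq, rule wp_For[where n = c and I = "\<lambda>k s' \<omega>'. s' 29 0 = of_bool ((\<forall>u<n. card (incident S u) = d u) \<and>
      (\<forall>i<k. dm i \<le> card (class_of S (jl i))))"], goal_cases)
    case (6 k s2 \<omega>2)
    have f2: "s2 y = s y" if "y \<notin> {29, 30, 32}" for y using frameD[OF 6(2), of y] f1[of y] that by auto
    have "setup_done s2" by (rule setup_done_cong[OF sd]) (auto simp: f2)
    note dd = demand_data[OF this 6(1)]
    have cn: "s2 28 (jl k) = card (class_of S (jl k))" using col 6(1) by (simp add: f2 collected_def)
    have bv: "bval (Less (Fetch r_ccnt demand_index) demand_value) s2 = (card (class_of S (jl k)) < dm k)"
      using dd(2,3) 6(3) cn by simp
    show ?case using 6(4)
      by (intro wp_Cond wp_Skip wp_Store) (auto simp del: bval.simps One_nat_def simp: bv less_Suc_eq)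
  next
    case 3
    then show ?case using demand_number[OF sd1] by simp
  next
    case (7 s2 \<omega>2)
    have "s2 1 = s 1" using frameD[OF 7(1), of 1] f1[of 1] by simp
    then show ?case using 7(3) S by (intro wp_Store) (simp add: solution_def)
  qed (use I1 B in auto)
qed (use sd B in \<open>auto simp: setup_done_def\<close>)

lemma collected_out_edges:
  assumes "collected S s" "s r_out 0 \<noteq> 0"
  shows "out_edges s = Some ((\<lambda>(u, v). {u, v}) ` S)"
proof -
  obtain ps where ps: "set ps = S" "s 1 1 = length ps"
    "\<And>i. i < length ps \<Longrightarrow> s 1 (2 * i + 2) = fst (ps ! i) \<and> s 1 (2 * i + 3) = snd (ps ! i)"
    using assms(1) unfolding collected_def by blast
  have "{{s 1 (2 * i + 2), s 1 (2 * i + 3)} | i. i < s 1 1} = (\<lambda>i. {s 1 (2 * i + 2), s 1 (2 * i + 3)}) ` {..<length ps}"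
    unfolding ps(2) by blast
  also have "\<dots> = (\<lambda>i. {fst (ps ! i), snd (ps ! i)}) ` {..<length ps}"
    by (rule image_cong) (use ps(3) in simp_all)
  also have "\<dots> = (\<lambda>(u, v). {u, v}) ` set ps"
    unfolding set_conv_nth by (auto simp: case_prod_unfold)
  finally show ?thesis using assms(2) ps(1) by (simp add: out_edges_def)
qed

text \<open>Failure is specified too: an empty output means that every value \<open>w\<close> was
  refuted. Both soundness and the success probability rest on this.\<close>

definition outcome :: "bool list \<Rightarrow> mem \<Rightarrow> bool" where
  "outcome bs s \<longleftrightarrow> (case out_edges s of None \<Rightarrow> \<forall>w<modulus. \<not> solution (cand bs w)
     | Some F \<Rightarrow> \<exists>w<modulus. solution (cand bs w) \<and> F = (\<lambda>(u, v). {u, v}) ` cand bs w)"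

lemma wp_search:
  assumes r: "ready bs s" and out: "s r_out 0 = 0"
    and B: "n \<le> B" "c \<le> B" "length ids \<le> B" "modulus * (target + 1) \<le> B" "2 * (n * n) \<le> B" "modulus \<le> B"
  shows "wp B search (\<lambda>s' \<omega>'. outcome bs s') s \<omega>"
  unfolding search_def outcome_def
proof (rule wp_For[where n = modulus and I = "\<lambda>w s' \<omega>'. s' 1 0 = 0 \<and> (\<forall>w'<w. \<not> solution (cand bs w')) \<or>
    s' 1 0 \<noteq> 0 \<and> (\<exists>w<modulus. solution (cand bs w) \<and> out_edges s' = Some ((\<lambda>(u, v). {u, v}) ` cand bs w))"], goal_cases)
  case (6 w s1 \<omega>1)
  have f1: "s1 y = s y" if "y \<notin> {1, 25, 26, 27, 28, 29, 30, 31, 32, 33, 34, 35, 36, 37, 40, 42, 43}" for y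
    using frameD[OF 6(2), of y] that by auto
  have r1: "ready bs s1" by (rule ready_cong[OF r]) (auto simp: f1)
  have oe: "out_edges (upd s' 37 0 (Suc w)) = out_edges s'" for s' by (simp add: out_edges_def)
  let ?I = "\<lambda>w s'. s' 1 0 = 0 \<and> (\<forall>w'<w. \<not> solution (cand bs w')) \<or>
    s' 1 0 \<noteq> 0 \<and> (\<exists>w<modulus. solution (cand bs w) \<and> out_edges s' = Some ((\<lambda>(u, v). {u, v}) ` cand bs w))"
  have I1: "?I w s1" by (rule 6(4))
  show ?case
  proof (rule wp_Cond)
    assume "\<not> bval (Equal (sc r_out) (Const 0)) s1"
    then show "wp B Skip (\<lambda>s'' \<omega>''. ?I (Suc w) (upd s'' 37 0 (Suc w))) s1 \<omega>1"
      using I1 by (intro wp_Skip) (simp add: oe)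
  next
    assume b: "bval (Equal (sc r_out) (Const 0)) s1"
    have old: "\<forall>w'<w. \<not> solution (cand bs w')" using I1 b by auto
    show "wp B (candidate ;; verify) (\<lambda>s'' \<omega>''. ?I (Suc w) (upd s'' 37 0 (Suc w))) s1 \<omega>1"
    proof (rule wp_Seq[OF wp_mono[OF wp_candidate[OF r1 6(3,1) B(1-5)]]])
      fix s2 \<omega>2
      assume fr: "frame candidate s1 \<omega>1 s2 \<omega>2" and c2: "collected (cand bs w) s2 \<and> s2 1 0 = s1 1 0"
      have "setup_done s2"
        by (rule setup_done_cong[of s1]) (use r1 frameD[OF fr] in \<open>auto simp: ready_def\<close>)
      then have "wp B verify (\<lambda>s' \<omega>'. s' r_out = (s2 r_out)(0 := of_bool (solution (cand bs w)))) s2 \<omega>2"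
        using c2 B by (intro wp_verify) (auto simp: cand_def)
      then show "wp B verify (\<lambda>s'' \<omega>''. ?I (Suc w) (upd s'' 37 0 (Suc w))) s2 \<omega>2"
      proof (rule wp_mono)
        fix s3 \<omega>3
        assume fr3: "frame verify s2 \<omega>2 s3 \<omega>3" and s3: "s3 1 = (s2 1)(0 := of_bool (solution (cand bs w)))"
        have c3: "collected (cand bs w) s3"
          using c2 frameD[OF fr3, of 27] frameD[OF fr3, of 28] unfolding collected_def s3 by simp
        show "?I (Suc w) (upd s3 37 0 (Suc w))"
        proof (cases "solution (cand bs w)")
          case True
          then show ?thesis using collected_out_edges[OF c3] s3 6(1) by (auto simp: oe)
        next
          case False
          then show ?thesis using old s3 by (auto simp: less_Suc_eq)
        qed
      qed
    qed
  qed
next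
  case (7 s1 \<omega>1)
  then show ?case by (auto simp: out_edges_def)
qed (use r out B in \<open>auto simp: ready_def\<close>)

end

lemma writes_setup [simp]:
  "writes setup_rows = {2, 3, 4, 30}" "writes setup_degrees = {5, 6, 30}"
  "writes core_edges = {7, 8, 9, 10, 11, 30, 31, 32}" "writes setup_strides = {12, 13, 14, 15, 32, 38, 45, 46, 47}"
  "writes port_edges = {8, 9, 10, 11, 30, 31, 40}" "writes setup_range = {16, 17, 18, 19, 32}"
  "writes draw_weights = {20, 32, 33, 38, 41, 44}" "writes setup_tables = {21, 22, 23, 24, 34, 38, 41}"
  by (auto simp: setup_rows_def setup_degrees_def core_edges_def setup_strides_def port_edges_def setup_range_def
      draw_weights_def setup_tables_def)

context factor_instance
begin

definition loop_bound :: "nat \<Rightarrow> bool" where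
  "loop_bound B \<longleftrightarrow> n \<le> B \<and> order + 1 \<le> B \<and> c \<le> B \<and> length ids \<le> B \<and> n * length ids \<le> B \<and> nbits \<le> B \<and>
     (\<forall>k<length ids. id_type (ids ! k) \<le> B) \<and> target \<le> B \<and> modulus * (target + 1) \<le> B \<and> 2 * (n * n) \<le> B \<and> modulus \<le> B"

text \<open>Everything before \<open>draw_weights\<close> is free of coin flips, so the random
  weights come from a prefix of the original tape.\<close>

lemma wp_program:
  assumes inp: "reads_input s" and out: "s r_out 0 = 0" and st: "s r_stride = (\<lambda>_. 0)" and B: "loop_bound B"
  shows "wp B factor_program (\<lambda>s' \<omega>'. outcome (stake (length ids * nbits) \<omega>) s') s \<omega>"
  unfolding factor_program_def
proof (rule wp_Seq[OF wp_mono[OF wp_setup_rows]])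
  show "s r_in 1 = n" using inp by (simp add: reads_input_def)
  show "n \<le> B" using B by (simp add: loop_bound_def)
  fix s1 \<omega>1
  assume 1: "frame setup_rows s \<omega> s1 \<omega>1" "s1 2 0 = n \<and> s1 3 0 = n * n \<and> (\<forall>u<n. s1 4 u = u * n)"
  have w1: "\<omega>1 = \<omega>" using frame_tape[OF 1(1)] by (simp add: setup_rows_def)
  have f1: "s1 x = s x" if "x \<notin> {2, 3, 4, 30}" for x using frameD[OF 1(1), of x] that by simp
  have i1: "reads_input s1" using inp reads_input_cong[of s1 s] f1[of 0] by simp
  show "wp B (setup_degrees ;; core_edges ;; setup_strides ;; port_edges ;; setup_range ;; draw_weights ;; setup_tables ;; search)
     (\<lambda>s' \<omega>'. outcome (stake (length ids * nbits) \<omega>) s') s1 \<omega>1"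
  proof (rule wp_Seq[OF wp_mono[OF wp_setup_degrees[OF i1]]], goal_cases)
    case (4 s2 \<omega>2)
    have w2: "\<omega>2 = \<omega>" using frame_tape[OF 4(1)] w1 by (simp add: setup_degrees_def)
    have f2: "s2 x = s1 x" if "x \<notin> {5, 6, 30}" for x using frameD[OF 4(1), of x] that by simp
    have d2: "setup_done s2"
      using 1(2) 4(2) i1 reads_input_cong[of s2 s1] by (simp add: setup_done_def f2 dpos_def)
    show ?case
    proof (rule wp_Seq[OF wp_mono[OF wp_core_edges[OF d2]]], goal_cases)
      case (2 s3 \<omega>3)
      have w3: "\<omega>3 = \<omega>" using frame_tape[OF 2(1)] w2 by (simp add: core_edges_def)
      have f3: "s3 x = s2 x" if "x \<notin> {7, 8, 9, 10, 11, 30, 31, 32}" for x using frameD[OF 2(1), of x] that by simp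
      have d3: "setup_done s3" by (rule setup_done_cong[OF d2]) (simp_all add: f3)
      have e3: "edges_at s3 cores" "s3 7 0 = order" using 2(2) by auto
      show ?case
      proof (rule wp_Seq[OF wp_mono[OF wp_setup_strides[OF d3 e3(2)]]], goal_cases)
        case 1
        then show ?case using st by (simp add: f1 f2 f3)
      next
        case (4 s4 \<omega>4)
        have w4: "\<omega>4 = \<omega>" using frame_tape[OF 4(1)] w3 by (simp add: setup_strides_def)
        have f4: "s4 x = s3 x" if "x \<notin> {12, 13, 14, 15, 32, 38, 45, 46, 47}" for x using frameD[OF 4(1), of x] that by simp
        have d4: "setup_done s4" by (rule setup_done_cong[OF d3]) (simp_all add: f4)
        have e4: "edges_at s4 cores" by (rule edges_at_cong[OF e3(1)]) (simp_all add: f4)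
        note t4 = 4(2)
        show ?case
        proof (rule wp_Seq[OF wp_mono[OF wp_port_edges[OF d4 _ e4]]], goal_cases)
          case (3 s5 \<omega>5)
          have w5: "\<omega>5 = \<omega>" using frame_tape[OF 3(1)] w4 by (simp add: port_edges_def)
          have f5: "s5 x = s4 x" if "x \<notin> {8, 9, 10, 11, 30, 31, 40}" for x using frameD[OF 3(1), of x] that by simp
          have d5: "setup_done s5" by (rule setup_done_cong[OF d4]) (simp_all add: f5)
          note e5 = 3(2)
          show ?case
          proof (rule wp_Seq[OF wp_mono[OF wp_setup_range]], goal_cases)
            case (6 s6 \<omega>6)
            have w6: "\<omega>6 = \<omega>" using frame_tape[OF 6(1)] w5 by (simp add: setup_range_def)
            have f6: "s6 x = s5 x" if "x \<notin> {16, 17, 18, 19, 32}" for x using frameD[OF 6(1), of x] that by simp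
            have d6: "setup_done s6" by (rule setup_done_cong[OF d5]) (simp_all add: f6)
            have e6: "edges_at s6 ids" by (rule edges_at_cong[OF e5]) (simp_all add: f6)
            note b6 = 6(2)
            show ?case
            proof (rule wp_Seq[OF wp_mono[OF wp_draw_weights]], goal_cases)
              case (8 s7 \<omega>7)
              have f7: "s7 x = s6 x" if "x \<notin> {20, 32, 33, 38, 41, 44}" for x using frameD[OF 8(1), of x] that by simp
              have d7: "setup_done s7" by (rule setup_done_cong[OF d6]) (simp_all add: f7)
              have e7: "edges_at s7 ids" by (rule edges_at_cong[OF e6]) (simp_all add: f7)
              have wt: "\<forall>k<length ids. s7 20 k = weight (stake (length ids * nbits) \<omega>) k"
                using 8(2) by (simp add: weight_def w6)
              show ?case
              proof (rule wp_Seq[OF wp_mono[OF wp_setup_tables]], goal_cases)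
                case (6 s8 \<omega>8)
                have f8: "s8 x = s7 x" if "x \<notin> {21, 22, 23, 24, 34, 38, 41}" for x using frameD[OF 6(1), of x] that by simp
                have "setup_done s8" by (rule setup_done_cong[OF d7]) (simp_all add: f8)
                then have r: "ready (stake (length ids * nbits) \<omega>) s8"
                  using e7 wt 6(2) b6 by (simp add: ready_def edges_at_def f8 f7)
                have "s8 1 0 = 0" using out by (simp add: f8 f7 f6 f5 f4 f3 f2 f1)
                then show ?case using B by (intro wp_search[OF r]) (auto simp: loop_bound_def)
              qed (use t4 b6 d7 B in \<open>auto simp: f7 f6 f5 setup_done_def loop_bound_def\<close>)
            qed (use e6 b6 B in \<open>auto simp: edges_at_def loop_bound_def\<close>)
          qed (use d5 e5 B in \<open>auto simp: setup_done_def edges_at_def loop_bound_def\<close>)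
        qed (use t4 B in \<open>auto simp: loop_bound_def\<close>)
      qed (use B in \<open>auto simp: loop_bound_def\<close>)
    qed (use B in \<open>auto simp: loop_bound_def\<close>)
  qed (use 1 B in \<open>auto simp: loop_bound_def\<close>)
qed

section \<open>Isolation implies that some candidate passes the verification\<close>

definition family :: "nat set set" where
  "family = {M. M \<subseteq> {..<length ids} \<and> id_matching ((!) ids ` M) \<and> (\<Sum>k\<in>M. id_type (ids ! k)) = target}"

lemma inj_on_ids: "M \<subseteq> {..<length ids} \<Longrightarrow> inj_on ((!) ids) M"
  by (rule inj_on_nth[OF distinct_ids]) auto

lemma finite_family: "finite family"
  by (rule finite_subset[of _ "Pow {..<length ids}"]) (auto simp: family_def)

text \<open>Matchings are moved from edge triples to positions in \<open>ids\<close>, since the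
  isolation bound speaks of subsets of \<open>{..<m}\<close>.\<close>

lemma family_nonempty:
  assumes "solution F"
  shows "family \<noteq> {}"
proof -
  obtain M where M: "id_matching M" "sum id_type M = target" using solution_imp_id_matching[OF assms] by blast
  define M' where "M' = {k. k < length ids \<and> ids ! k \<in> M}"
  have sub: "M' \<subseteq> {..<length ids}" by (auto simp: M'_def)
  have "M \<subseteq> set ids" using M(1) set_ids by (simp add: id_matching_def)
  then have img: "(!) ids ` M' = M" by (force simp: M'_def in_set_conv_nth)
  have "(\<Sum>k\<in>M'. id_type (ids ! k)) = target"
    using M(2) sum.reindex[OF inj_on_ids[OF sub], of id_type] img by (simp add: comp_def)
  then have "M' \<in> family" using sub M(1) img by (simp add: family_def)
  then show ?thesis by blast
qed

lemma random_weight_sum_less: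
  assumes "M \<subseteq> {..<length ids}"
  shows "sum (random_weight bs) M < modulus"
proof -
  have "random_weight bs k \<le> 2 ^ nbits" for k
  proof -
    have "length (block nbits k bs) \<le> nbits" by (simp add: block_def)
    then have "2 ^ length (block nbits k bs) \<le> (2 :: nat) ^ nbits" by simp
    then show ?thesis unfolding random_weight_def
      using bin_less[of "block nbits k bs"] by linarith
  qed
  then have "sum (random_weight bs) M \<le> card M * 2 ^ nbits"
    using sum_bounded_above[of M "random_weight bs" "2 ^ nbits"] by simp
  also have "\<dots> \<le> length ids * 2 ^ nbits" using card_mono[OF _ assms] by (intro mult_le_mono1) simp
  finally show ?thesis by (simp add: modulus_def)
qed

text \<open>Let \<open>w\<close> be the least random sum. The weight
  \<open>modulus * target + w\<close> splits uniquely, so every matching of that weight has type sum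
  \<open>target\<close> and lies in \<open>family\<close>; isolation leaves only \<open>M\<close>.
  The parity for a pair is therefore 0 exactly if \<open>M\<close> uses a copy of it.\<close>

lemma isolating_imp_candidate:
  assumes sol: "solution F" and iso: "isolating family (random_weight bs)"
  shows "\<exists>w<modulus. solution (cand bs w)"
proof -
  obtain M where M: "M \<in> family" and min: "\<And>M'. M' \<in> family \<Longrightarrow> M' \<noteq> M \<Longrightarrow> sum (random_weight bs) M < sum (random_weight bs) M'"
    using iso unfolding isolating_def by blast
  have Mf: "M \<subseteq> {..<length ids}" "id_matching ((!) ids ` M)" "(\<Sum>k\<in>M. id_type (ids ! k)) = target"
    using M by (auto simp: family_def)
  define w where "w = sum (random_weight bs) M"
  have w: "w < modulus" unfolding w_def by (rule random_weight_sum_less[OF Mf(1)])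
  have sumw: "sum (weight bs) M' = sum (random_weight bs) M' + modulus * (\<Sum>k\<in>M'. id_type (ids ! k))" for M'
    by (simp add: weight_def sum.distrib sum_distrib_left)
  have in_ids: "ids ! k \<in> core_ids \<union> port_ids" if "k < length ids" for k using that set_ids nth_mem by blast
  have parity: "edge_parity bs w u v = (if \<exists>k\<in>M. source k = pt u v then 0 else 1)" for u v
  proof -
    define K where "K = {k. k < length ids \<and> source k \<noteq> pt u v}"
    interpret wm: weighted_multigraph K source sink "weight bs"
      by unfold_locales (use id_endpoints(3) weight_pos in \<open>auto simp: K_def\<close>)
    have ends: "wm.ends k = id_ends (ids ! k)" for k by (simp add: wm.ends_def id_ends_def)
    have "{M' \<in> wm.matchings {..<2 * (n * n)}. sum (weight bs) M' = modulus * target + w} = (if M \<subseteq> K then {M} else {})"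
    proof (intro equalityI subsetI)
      fix M' assume "M' \<in> {M' \<in> wm.matchings {..<2 * (n * n)}. sum (weight bs) M' = modulus * target + w}"
      then have M': "M' \<subseteq> K" "\<forall>k\<in>M'. \<forall>l\<in>M'. k \<noteq> l \<longrightarrow> wm.ends k \<inter> wm.ends l = {}"
        "sum (weight bs) M' = modulus * target + w" by (auto simp: wm.matchings_def)
      have sub: "M' \<subseteq> {..<length ids}" using M'(1) by (auto simp: K_def)
      have "sum (random_weight bs) M' + modulus * (\<Sum>k\<in>M'. id_type (ids ! k)) = w + modulus * target"
        using M'(3) sumw[of M'] by simp
      from radix_split[OF random_weight_sum_less[OF sub] w this]
      have rw: "sum (random_weight bs) M' = w" "(\<Sum>k\<in>M'. id_type (ids ! k)) = target" by auto
      have "id_matching ((!) ids ` M')"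
        unfolding id_matching_def
      proof (intro conjI ballI impI)
        show "(!) ids ` M' \<subseteq> core_ids \<union> port_ids" using in_ids sub by blast
        fix k l assume "k \<in> (!) ids ` M'" "l \<in> (!) ids ` M'" "k \<noteq> l"
        then obtain i j where "k = ids ! i" "l = ids ! j" "i \<in> M'" "j \<in> M'" "i \<noteq> j" by auto
        then show "id_ends k \<inter> id_ends l = {}" using M'(2) ends by auto
      qed
      then have "M' \<in> family" using sub rw by (simp add: family_def)
      then have "M' = M" using min[of M'] rw(1) by (auto simp: w_def)
      then show "M' \<in> (if M \<subseteq> K then {M} else {})" using M'(1) by simp
    next
      fix M' assume "M' \<in> (if M \<subseteq> K then {M} else {})"
      then have M': "M' = M" "M \<subseteq> K" by (auto split: if_splits)
      have "wm.ends k \<inter> wm.ends l = {}" if "k \<in> M" "l \<in> M" "k \<noteq> l" for k l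
      proof -
        have "ids ! k \<noteq> ids ! l" using inj_on_ids[OF Mf(1)] that by (auto simp: inj_on_def)
        then show ?thesis using Mf(2) that unfolding id_matching_def ends by blast
      qed
      moreover have "wm.ends k \<subseteq> {..<2 * (n * n)}" if "k \<in> M" for k
        using Mf(1) that id_endpoints(1,2)[of "ids ! k"] by (auto simp: wm.ends_def)
      ultimately have "M \<in> wm.matchings {..<2 * (n * n)}" using M'(2) by (auto simp: wm.matchings_def)
      then show "M' \<in> {M' \<in> wm.matchings {..<2 * (n * n)}. sum (weight bs) M' = modulus * target + w}"
        using M' sumw[of M] Mf(3) by (simp add: w_def)
    qed
    then have "card {M' \<in> wm.matchings {..<2 * (n * n)}. sum (weight bs) M' = modulus * target + w} =
        (if M \<subseteq> K then 1 else 0)" by simp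
    moreover have "M \<subseteq> K \<longleftrightarrow> \<not> (\<exists>k\<in>M. source k = pt u v)" using Mf(1) by (auto simp: K_def)
    ultimately show ?thesis
      using wm.walk_seq_count_parity[of "2 * (n * n)" "modulus * target + w"]
      by (simp add: edge_parity_def K_def)
  qed
  have "cand bs w = chosen ((!) ids ` M)"
  proof -
    \<comment> \<open>A core number is never a port number, so an edge of \<open>M\<close> with
      source \<open>pt u v\<close> is a copy of this pair.\<close>
    have iff: "(\<exists>k\<in>M. source k = pt u v) \<longleftrightarrow> (\<exists>b. (pt u v, pt v u, b) \<in> (!) ids ` M)" if uv: "(u, v) \<in> pairs" for u v
    proof
      assume "\<exists>k\<in>M. source k = pt u v"
      then obtain k where k: "k \<in> M" "source k = pt u v" by blast
      have n: "u < n" "v < n" using uv by (auto simp: pairs_def)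
      have "ids ! k \<in> core_ids \<union> port_ids" using k(1) Mf(1) in_ids by auto
      then show "\<exists>b. (pt u v, pt v u, b) \<in> (!) ids ` M"
      proof
        assume "ids ! k \<in> core_ids"
        then obtain u' i v' where "ids ! k = (core u' i, pt u' v', 0)" unfolding core_ids_def by blast
        then show ?thesis using k(2) core_neq_pt(1)[OF n, of u' i] by simp
      next
        assume "ids ! k \<in> port_ids"
        then obtain u' v' b where b: "ids ! k = (pt u' v', pt v' u', b)" "v' < u'" "u' < n"
          unfolding port_ids_def pairs_def by blast
        then have "u' = u" "v' = v" using k(2) n pt_eq_iff[of v' v u' u] by auto
        then show ?thesis using b k(1) by (metis imageI)
      qed
    next
      assume "\<exists>b. (pt u v, pt v u, b) \<in> (!) ids ` M"
      then show "\<exists>k\<in>M. source k = pt u v" by (metis fst_conv imageE)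
    qed
    have "(u, v) \<in> cand bs w \<longleftrightarrow> (u, v) \<in> chosen ((!) ids ` M)" for u v
      unfolding cand_def chosen_def parity
      by (cases "(u, v) \<in> pairs") (simp_all only: iff mem_Collect_eq case_prod_conv simp_thms if_cancel split: if_split, auto)
    then show ?thesis by auto
  qed
  moreover have "sum id_type ((!) ids ` M) = target"
    using Mf(3) by (simp add: sum.reindex[OF inj_on_ids[OF Mf(1)]])
  ultimately show ?thesis using id_matching_imp_solution[OF sol Mf(2)] w by auto
qed

text \<open>\<open>nbits\<close> was chosen so that \<open>n * length ids \<le> 2 ^ nbits\<close>,
  which is what the bound \<open>1 / n\<close> asks for.\<close>

lemma prob_candidate:
  assumes sol: "solution F" and n: "0 < n"
  shows "measure coin_tape {\<omega>. isolating family (random_weight (stake (length ids * nbits) \<omega>))} \<ge> 1 - 1 / real n"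
  unfolding random_weight_def
  by (rule measure_stake_isolating[OF finite_family family_nonempty[OF sol] _ _ n])
     (auto simp: family_def nbits_def bit_length_lower)

section \<open>Polynomial bounds for all loops\<close>

lemma length_ids_le: "length ids \<le> n * n * n + 2 * (n * n)"
proof -
  have "length ids = card (core_ids \<union> port_ids)" using distinct_card[OF distinct_ids] set_ids by simp
  also have "\<dots> \<le> card core_ids + card port_ids" by (rule card_Un_le)
  finally have le: "length ids \<le> card core_ids + card port_ids" .
  have "card core_ids \<le> card ((\<lambda>(u, i, v). (core u i, pt u v, 0 :: nat)) ` ({..<n} \<times> {..<n} \<times> {..<n}))"
    by (rule card_mono) (force simp: core_ids_def)+
  also have "\<dots> \<le> card ({..<n} \<times> {..<n} \<times> {..<n})" by (rule card_image_le) simp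
  finally have 1: "card core_ids \<le> n * n * n" by simp
  have "card port_ids \<le> card ((\<lambda>(u, v, b :: nat). (pt u v, pt v u, b)) ` ({..<n} \<times> {..<n} \<times> {..<2}))"
    by (rule card_mono) (force simp: port_ids_def pairs_def)+
  also have "\<dots> \<le> card ({..<n} \<times> {..<n} \<times> {..<2 :: nat})" by (rule card_image_le) simp
  finally have "card port_ids \<le> 2 * (n * n)" by simp
  with le 1 show ?thesis by linarith
qed

text \<open>Products add exponents, and a sum raises the exponent by one because
  \<open>2 \<le> y\<close>. The largest exponent reached is 26; 40 leaves room.\<close>

lemma loop_bound_power:
  assumes y: "n + c + place c + 2 \<le> y"
  shows "loop_bound (y ^ 40)"
proof -
  have y2: "2 \<le> y" "n \<le> y" "c \<le> y" "place c \<le> y" "n + 2 \<le> y" using y by auto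
  have pw: "a \<le> y ^ k" if "a \<le> y ^ j" "j \<le> k" for a j k
    using order_trans[OF that(1) power_increasing[OF that(2), of y]] y2 by simp
  have mult: "a * b \<le> y ^ l" if "a \<le> y ^ j" "b \<le> y ^ k" "j + k = l" for a b j k l
    using mult_le_mono[OF that(1,2)] that(3) by (simp flip: power_add)
  have add: "a + b \<le> y ^ l" if "a \<le> y ^ k" "b \<le> y ^ k" "Suc k = l" for a b k l
  proof -
    have "a + b \<le> 2 * y ^ k" using that by simp
    also have "\<dots> \<le> y * y ^ k" using y2 by (intro mult_le_mono1) simp
    finally show ?thesis using that(3) by auto
  qed
  have one: "1 \<le> y ^ k" for k using y2 by simp
  have n1: "n \<le> y ^ 1" "2 \<le> y ^ 1" "n + 2 \<le> y ^ 1" "c \<le> y ^ 1" using y2 by simp_all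
  have nn: "n * n \<le> y ^ 2" by (rule mult[OF n1(1) n1(1)]) simp
  have nn2: "2 * (n * n) \<le> y ^ 3" by (rule mult[OF n1(2) nn]) simp
  have "(\<Sum>u<n. n - d u) \<le> (\<Sum>u<n. n)" by (rule sum_mono) simp
  then have "order \<le> 2 * (n * n)" by (simp add: order_def)
  then have o3: "order \<le> y ^ 3" using nn2 by (rule order_trans)
  have o4: "order + 1 \<le> y ^ 4" by (rule add[OF o3 one]) simp
  have "length ids \<le> (n + 2) * (n * n)" using length_ids_le by (simp add: algebra_simps)
  also have "\<dots> \<le> y ^ 3" by (rule mult[OF n1(3) nn]) simp
  finally have l3: "length ids \<le> y ^ 3" .
  have l4: "n * length ids \<le> y ^ 4" by (rule mult[OF n1(1) l3]) simp
  have b4: "nbits \<le> y ^ 4"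
    unfolding nbits_def by (rule order_trans[OF bit_length_le l4])
  have l5: "2 * (n * length ids) \<le> y ^ 5" by (rule mult[OF n1(2) l4]) simp
  have "2 ^ nbits \<le> 2 * (n * length ids) + 1" unfolding nbits_def by (rule bit_length_upper)
  also have "\<dots> \<le> y ^ 6" by (rule add[OF l5 one]) simp
  finally have "length ids * 2 ^ nbits \<le> y ^ 9" by (rule mult[OF l3]) simp
  then have m10: "modulus \<le> y ^ 10" unfolding modulus_def by (rule add[OF _ one]) simp
  have place: "place i \<le> y ^ 1" if "i \<le> c" for i
  proof -
    have "place i \<le> place c" by (rule lift_Suc_mono_le[of place, OF _ that]) (simp add: place_Suc)
    then show ?thesis using y2 by simp
  qed
  have sw: "step_weight i \<le> y ^ 10" if "i < c" for i
    unfolding step_weight_def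
  proof (rule add[of _ 9])
    have "(order + 1) * (order + 1) \<le> y ^ 8" by (rule mult[OF o4 o4]) simp
    then show "(order + 1) * (order + 1) * place i \<le> y ^ 9"
      by (rule mult[OF _ place]) (use that in simp_all)
  qed (use pw[OF o4, of 9] in simp_all)
  have stride: "stride l \<le> y ^ 10" for l
  proof (cases "l \<in> jl ` {..<c}")
    case True
    then show ?thesis using stride_jl sw by auto
  qed (simp add: stride_other)
  have it: "id_type k \<le> y ^ 11" for k
    unfolding id_type_def by (rule add[of _ 10]) (use pw[OF n1(2), of 10] stride in auto)
  have ds: "demand_cap i * step_weight i \<le> y ^ 13" if "i < c" for i
    by (rule mult[OF order_trans[OF _ o3] sw[OF that]]) (simp_all add: demand_cap_def)
  have "(\<Sum>i<c. demand_cap i * step_weight i) \<le> (\<Sum>i<c. y ^ 13)" by (rule sum_mono) (use ds in simp)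
  also have "\<dots> = c * y ^ 13" by simp
  also have "\<dots> \<le> y ^ 14" by (rule mult[OF n1(4) order_refl]) simp
  finally have "target \<le> y ^ 15"
    using add[OF pw[OF o3, of 14], of _ 15] by (simp add: target_def)
  then have t16: "target + 1 \<le> y ^ 16" by (rule add[OF _ one]) simp
  have mt: "modulus * (target + 1) \<le> y ^ 26" by (rule mult[OF m10 t16]) simp
  show ?thesis unfolding loop_bound_def
    using pw[OF n1(1), of 40] pw[OF o4, of 40] pw[OF n1(4), of 40] pw[OF l3, of 40] pw[OF l4, of 40] pw[OF b4, of 40]
      pw[OF it, of 40] pw[OF t16, of 40] pw[OF nn2, of 40] pw[OF m10, of 40] pw[OF mt, of 40]
    by simp
qed

end

section \<open>Encoded instances\<close>

lemma length_concat_map_upt: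
  "(\<And>i. i < m \<Longrightarrow> length (f i) = l) \<Longrightarrow> length (concat (map f [0..<m])) = m * l"
  by (induction m) auto

lemma nth_concat_map_upt:
  assumes "\<And>i. i < m \<Longrightarrow> length (f i) = l" "i < m" "j < l"
  shows "concat (map f [0..<m]) ! (i * l + j) = f i ! j"
  using assms
proof (induction m)
  case (Suc m)
  have len: "length (concat (map f [0..<m])) = m * l"
    by (rule length_concat_map_upt) (use Suc.prems(1) in simp)
  show ?case
  proof (cases "i < m")
    case True
    then have "(i + 1) * l \<le> m * l" by (intro mult_le_mono1) simp
    then have "i * l + j < m * l" using Suc.prems(3) by simp
    then show ?thesis using Suc True len by (simp add: nth_append)
  next
    case False
    then have "i = m" using Suc.prems(2) by simp
    then show ?thesis using len by (simp add: nth_append)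
  qed
qed simp

fun problem_degree :: "problem \<Rightarrow> nat \<Rightarrow> nat" where
  "problem_degree (Dominating_Matching G) u = 1"
| "problem_degree (Dominating_F_Factor G d) u = d ! u"

text \<open>The indices listed by \<open>encode_demands\<close>. Dropping vacuous demands makes all
  remaining ones positive, and it leaves the product of the \<open>m_j + 1\<close>
  unchanged.\<close>

definition active :: "dom_graph \<Rightarrow> nat list" where
  "active G = filter (\<lambda>j. demand G j \<noteq> 0) [0..<nsets G]"

definition active_label :: "dom_graph \<Rightarrow> nat \<Rightarrow> nat" where
  "active_label G i = active G ! i + 2"

definition active_demand :: "dom_graph \<Rightarrow> nat \<Rightarrow> nat" where
  "active_demand G i = demand G (active G ! i)"

lemma distinct_active: "distinct (active G)"
  by (simp add: active_def)

lemma set_active: "set (active G) = {j. j < nsets G \<and> demand G j \<noteq> 0}"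
  by (auto simp: active_def)

lemma length_active_le: "length (active G) \<le> nsets G"
  unfolding active_def by (rule order_trans[OF length_filter_le]) simp

lemma prod_active:
  "(\<Prod>i<length (active G). active_demand G i + 1) = demand_product G"
proof -
  have "(\<Prod>i<length (active G). active_demand G i + 1) = (\<Prod>j\<in>set (active G). demand G j + 1)"
    unfolding active_demand_def by (rule prod.reindex_bij_betw) (simp add: bij_betw_nth distinct_active)
  also have "\<dots> = (\<Prod>j<nsets G. demand G j + 1)"
    by (rule prod.mono_neutral_left) (auto simp: set_active)
  finally show ?thesis by (simp add: demand_product_def)
qed

text \<open>The time bound of \<open>wp\<close> at loop bound \<open>y ^ 40\<close>, with
  \<open>r\<close> in place of \<open>y\<close>.\<close>

abbreviation time_poly :: "real poly \<Rightarrow> real poly" where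
  "time_poly r \<equiv> smult (real (cost factor_program)) ((1 + r ^ 40) ^ depth factor_program)"

locale wf_instance =
  fixes P :: problem
  assumes wf: "wf_problem P"
begin

abbreviation G :: dom_graph where
  "G \<equiv> graph P"

lemma wf_graph: "wf_dom_graph G"
  using wf by (cases P) auto

lemma active_nth: "i < length (active G) \<Longrightarrow> active G ! i < nsets G \<and> demand G (active G ! i) \<noteq> 0"
  using nth_mem[of i "active G"] by (simp add: set_active)

sublocale factor_instance "nverts G" "edge_label G" "problem_degree P" "length (active G)"
  "active_label G" "active_demand G"
proof
  show "inj_on (active_label G) {..<length (active G)}"
    using distinct_active[of G] by (auto simp: inj_on_def nth_eq_iff_index_eq active_label_def)
  show "1 \<le> active_demand G i" if "i < length (active G)" for i
    using active_nth[OF that] by (simp add: active_demand_def)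
qed

lemma prescribed_subset: "j < nsets G \<Longrightarrow> prescribed G j \<subseteq> edges G"
  using wf_graph by (simp add: wf_dom_graph_def)

lemma edge_label_eq_0_iff: "edge_label G u v = 0 \<longleftrightarrow> {u, v} \<notin> edges G"
  by (simp add: edge_label_def)

lemma edge_label_iff:
  assumes j: "j < nsets G"
  shows "edge_label G u v = j + 2 \<longleftrightarrow> {u, v} \<in> prescribed G j"
proof -
  have uniq: "i = j'" if "i < nsets G" "{u, v} \<in> prescribed G i" "j' < nsets G" "{u, v} \<in> prescribed G j'" for i j'
    using wf_graph that unfolding wf_dom_graph_def by blast
  have the: "(THE j. j < nsets G \<and> {u, v} \<in> prescribed G j) = i" if "i < nsets G" "{u, v} \<in> prescribed G i" for i
    using that uniq by (intro the_equality) auto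
  show ?thesis
  proof
    assume l: "edge_label G u v = j + 2"
    then obtain i where "i < nsets G" "{u, v} \<in> prescribed G i"
      by (auto simp: edge_label_def split: if_splits)
    moreover from this have "edge_label G u v = i + 2"
      using the[of i] prescribed_subset[of i] by (auto simp: edge_label_def)
    ultimately show "{u, v} \<in> prescribed G j" using l by simp
  next
    assume "{u, v} \<in> prescribed G j"
    then show "edge_label G u v = j + 2"
      using j the[of j] prescribed_subset[of j] by (auto simp: edge_label_def)
  qed
qed

abbreviation pair_edge :: "nat \<times> nat \<Rightarrow> nat set" where
  "pair_edge \<equiv> (\<lambda>(u, v). {u, v})"

lemma inj_pair_edge: "S \<subseteq> pairs \<Longrightarrow> inj_on pair_edge S"
proof (rule inj_onI)
  fix p p' assume S: "S \<subseteq> pairs" "p \<in> S" "p' \<in> S" and eq: "pair_edge p = pair_edge p'"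
  obtain u v u' v' where p: "p = (u, v)" "p' = (u', v')" by force
  have "v < u" "v' < u'" using S unfolding p pairs_def by blast+
  then show "p = p'" using eq unfolding p by (simp add: doubleton_eq_iff) linarith
qed

lemma pair_edge_edges: "S \<subseteq> pairs \<Longrightarrow> pair_edge ` S \<subseteq> edges G"
proof
  fix e assume "S \<subseteq> pairs" "e \<in> pair_edge ` S"
  then obtain u v where "e = {u, v}" "edge_label G u v \<noteq> 0" by (auto simp: pairs_def)
  then show "e \<in> edges G" using edge_label_eq_0_iff[of u v] by simp
qed

lemma edges_from_pairs:
  assumes "F \<subseteq> edges G"
  shows "\<exists>S\<subseteq>pairs. F = pair_edge ` S"
proof (intro exI conjI)
  let ?S = "{(u, v). v < u \<and> {u, v} \<in> F}"
  have e: "\<exists>u v. e = {u, v} \<and> v < u \<and> u < nverts G" if e: "e \<in> F" for e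
  proof -
    have "e \<in> {{u, v} | u v. u < nverts G \<and> v < nverts G \<and> u \<noteq> v}"
      using e assms wf_graph unfolding wf_dom_graph_def by blast
    then obtain u v where uv: "e = {u, v}" "u < nverts G" "v < nverts G" "u \<noteq> v" by blast
    then show ?thesis by (metis insert_commute linorder_neqE_nat)
  qed
  show "?S \<subseteq> pairs"
  proof
    fix p assume "p \<in> ?S"
    then obtain u v where p: "p = (u, v)" "v < u" "{u, v} \<in> F" by auto
    then obtain u' v' where "{u, v} = {u', v'}" "v' < u'" "u' < nverts G" using e by metis
    then have "u < nverts G" using p by (auto simp: doubleton_eq_iff)
    then show "p \<in> pairs" using p assms by (auto simp: pairs_def edge_label_eq_0_iff)
  qed
  show "F = pair_edge ` ?S"
  proof (intro equalityI subsetI)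
    fix x assume "x \<in> F"
    then obtain u v where "x = {u, v}" "v < u" using e by metis
    then show "x \<in> pair_edge ` ?S" using \<open>x \<in> F\<close> by (intro image_eqI[of _ _ "(u, v)"]) auto
  qed auto
qed

lemma vdegree_pair_edge: "S \<subseteq> pairs \<Longrightarrow> vdegree (pair_edge ` S) u = card (incident S u)"
proof -
  assume S: "S \<subseteq> pairs"
  have "{e \<in> pair_edge ` S. u \<in> e} = pair_edge ` incident S u" by (auto simp: incident_def)
  moreover have "inj_on pair_edge (incident S u)"
    by (rule inj_on_subset[OF inj_pair_edge[OF S]]) (auto simp: incident_def)
  ultimately show ?thesis by (simp add: vdegree_def card_image)
qed

lemma card_pair_edge_prescribed:
  assumes S: "S \<subseteq> pairs" and j: "j < nsets G"
  shows "card (pair_edge ` S \<inter> prescribed G j) = card (class_of S (j + 2))"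
proof -
  have "pair_edge ` S \<inter> prescribed G j = pair_edge ` class_of S (j + 2)"
    unfolding class_of_def edge_label_iff[OF j] by auto
  moreover have "inj_on pair_edge (class_of S (j + 2))"
    by (rule inj_on_subset[OF inj_pair_edge[OF S]]) (auto simp: class_of_def)
  ultimately show ?thesis by (simp add: card_image)
qed

lemma dominating_pair_edge:
  assumes S: "S \<subseteq> pairs"
  shows "dominating G (pair_edge ` S) \<longleftrightarrow>
    (\<forall>i<length (active G). active_demand G i \<le> card (class_of S (active_label G i)))"
  unfolding active_demand_def active_label_def
proof
  assume "dominating G (pair_edge ` S)"
  then show "\<forall>i<length (active G). demand G (active G ! i) \<le> card (class_of S (active G ! i + 2))"
    using card_pair_edge_prescribed[OF S] active_nth by (auto simp: dominating_def)
next
  assume a: "\<forall>i<length (active G). demand G (active G ! i) \<le> card (class_of S (active G ! i + 2))"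
  have "demand G j \<le> card (pair_edge ` S \<inter> prescribed G j)" if j: "j < nsets G" for j
  proof (cases "demand G j = 0")
    case False
    then obtain i where "i < length (active G)" "active G ! i = j"
      using j set_active[of G] by (metis (mono_tags, lifting) in_set_conv_nth mem_Collect_eq)
    then show ?thesis using a card_pair_edge_prescribed[OF S j] by auto
  qed simp
  then show "dominating G (pair_edge ` S)" by (simp add: dominating_def)
qed

lemma perfect_matching_iff_degrees:
  assumes F: "F \<subseteq> edges G"
  shows "perfect_matching G F \<longleftrightarrow> (\<forall>u<nverts G. vdegree F u = 1)"
proof
  assume pm: "perfect_matching G F"
  show "\<forall>u<nverts G. vdegree F u = 1"
  proof (intro allI impI)
    fix u assume "u < nverts G"
    then have "u \<in> \<Union>F" using pm by (simp add: perfect_matching_def)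
    then obtain e where e: "e \<in> F" "u \<in> e" by blast
    then have "{e \<in> F. u \<in> e} = {e}" using pm unfolding perfect_matching_def by blast
    then show "vdegree F u = 1" by (simp add: vdegree_def)
  qed
next
  assume d: "\<forall>u<nverts G. vdegree F u = 1"
  have sub: "e \<subseteq> {..<nverts G}" if "e \<in> F" for e
    using that F wf_graph unfolding wf_dom_graph_def by fastforce
  have one: "\<exists>e. {e \<in> F. u \<in> e} = {e}" if "u < nverts G" for u
    using d that card_1_singletonE[of "{e \<in> F. u \<in> e}"] by (metis vdegree_def)
  have "e \<inter> e' = {}" if "e \<in> F" "e' \<in> F" "e \<noteq> e'" for e e'
  proof (rule ccontr)
    assume "e \<inter> e' \<noteq> {}"
    then obtain u where u: "u \<in> e" "u \<in> e'" by blast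
    then have "u < nverts G" using sub[OF that(1)] by auto
    then show False using one[of u] that u by blast
  qed
  moreover have "\<Union>F = {..<nverts G}"
  proof (intro equalityI subsetI)
    fix u assume "u \<in> {..<nverts G}"
    then show "u \<in> \<Union>F" using one[of u] by blast
  qed (use sub in blast)
  ultimately show "perfect_matching G F" using F unfolding perfect_matching_def by blast
qed

lemma solves_iff_degrees:
  assumes F: "F \<subseteq> edges G"
  shows "solves F P \<longleftrightarrow> (\<forall>u<nverts G. vdegree F u = problem_degree P u) \<and> dominating G F"
proof (cases P)
  case (Dominating_Matching H)
  then show ?thesis using perfect_matching_iff_degrees[OF F] by simp
next
  case (Dominating_F_Factor H d)
  then show ?thesis using F by (simp add: f_factor_def)
qed

lemma solves_iff:
  assumes S: "S \<subseteq> pairs"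
  shows "solves (pair_edge ` S) P \<longleftrightarrow> solution S"
  unfolding solves_iff_degrees[OF pair_edge_edges[OF S]] vdegree_pair_edge[OF S] dominating_pair_edge[OF S] solution_def
  using S by blast

lemma solves_imp_solution: "solves F P \<Longrightarrow> \<exists>S. solution S"
proof -
  assume F: "solves F P"
  then have "F \<subseteq> edges G" by (cases P) (auto simp: perfect_matching_def f_factor_def)
  then obtain S where "S \<subseteq> pairs" "F = pair_edge ` S" using edges_from_pairs by blast
  then show ?thesis using F solves_iff by blast
qed

lemma length_encode_matrix: "length (encode_matrix G) = nverts G * nverts G"
  unfolding encode_matrix_def by (rule length_concat_map_upt) simp

lemma nth_encode_matrix:
  assumes "u < nverts G" "v < nverts G"
  shows "encode_matrix G ! (u * nverts G + v) = edge_label G u v"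
  unfolding encode_matrix_def using assms by (subst nth_concat_map_upt) simp_all

lemma encode_demands_eq:
  "encode_demands G = length (active G) # concat (map (\<lambda>i. [active G ! i, demand G (active G ! i)]) [0..<length (active G)])"
proof -
  have "map (\<lambda>j. [j, demand G j]) (active G) = map (\<lambda>i. [active G ! i, demand G (active G ! i)]) [0..<length (active G)]"
    by (rule nth_equalityI) simp_all
  then show ?thesis unfolding encode_demands_def active_def[symmetric] Let_def by (rule arg_cong)
qed

lemma length_encode_demands: "length (encode_demands G) = 1 + length (active G) * 2"
  unfolding encode_demands_eq
  using length_concat_map_upt[of "length (active G)" "\<lambda>i. [active G ! i, demand G (active G ! i)]" 2] by simp

lemma nth_encode_demands:
  assumes "i < length (active G)"
  shows "encode_demands G ! (1 + (i + i)) = active G ! i" "encode_demands G ! (2 + (i + i)) = demand G (active G ! i)"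
proof -
  let ?f = "\<lambda>i. [active G ! i, demand G (active G ! i)]"
  have "concat (map ?f [0..<length (active G)]) ! (i * 2 + 0) = active G ! i"
    by (subst nth_concat_map_upt) (use assms in simp_all)
  moreover have "concat (map ?f [0..<length (active G)]) ! (i * 2 + 1) = demand G (active G ! i)"
    by (subst nth_concat_map_upt) (use assms in simp_all)
  moreover have "1 + (i + i) = Suc (i * 2 + 0)" "2 + (i + i) = Suc (i * 2 + 1)" by simp_all
  ultimately show "encode_demands G ! (1 + (i + i)) = active G ! i"
    "encode_demands G ! (2 + (i + i)) = demand G (active G ! i)"
    unfolding encode_demands_eq by (simp_all only: nth_Cons_Suc)
qed

lemma reads_input_encode: "reads_input (init_mem (encode P))"
proof -
  \<comment> \<open>Both encodings get a common shape: a matching instance has tag 0 and an empty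
    degree list.\<close>
  define D where "D = (case P of Dominating_Matching _ \<Rightarrow> [] | Dominating_F_Factor _ d \<Rightarrow> d)"
  define \<tau> :: nat where "\<tau> = (case P of Dominating_Matching _ \<Rightarrow> 0 | Dominating_F_Factor _ _ \<Rightarrow> 1)"
  let ?n = "nverts G" and ?c = "length (active G)"
  have enc: "encode P = [\<tau>, ?n] @ encode_matrix G @ D @ encode_demands G"
    by (cases P) (simp_all add: D_def \<tau>_def)
  have lenD: "length D = (if \<tau> = 0 then 0 else ?n)" using wf by (cases P) (auto simp: D_def \<tau>_def)
  have degD: "problem_degree P u = (if \<tau> = 0 then 1 else D ! u)" for u by (cases P) (auto simp: D_def \<tau>_def)
  let ?s = "init_mem (encode P)"
  have len: "length (encode P) = 2 + ?n * ?n + length D + (1 + ?c * 2)"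
    by (simp add: enc length_encode_matrix length_encode_demands)
  have s0: "?s 0 0 = \<tau>" "?s 0 1 = ?n" by (simp_all add: init_mem_def enc)
  have mat: "?s 0 (2 + (u * ?n + v)) = edge_label G u v" if "u < ?n" "v < ?n" for u v
  proof -
    have "(u + 1) * ?n \<le> ?n * ?n" using that by (intro mult_le_mono1) simp
    then have "u * ?n + v < ?n * ?n" using that by simp
    then show ?thesis using nth_encode_matrix[OF that]
      by (simp add: init_mem_def enc nth_append length_encode_matrix)
  qed
  have deg: "?s 0 (2 + ?n * ?n + u) = D ! u" if "u < length D" for u
    using that by (simp add: init_mem_def enc nth_append length_encode_matrix)
  have dem: "?s 0 (2 + ?n * ?n + length D + k) = encode_demands G ! k" if "k < 1 + ?c * 2" for k
    using that by (simp add: init_mem_def enc nth_append length_encode_matrix length_encode_demands)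
  have dpos: "dpos ?s = 2 + ?n * ?n + length D" using s0 lenD by (simp add: dpos_def)
  show ?thesis
    unfolding reads_input_def dpos
  proof (intro conjI allI impI)
    show "?s 0 (2 + ?n * ?n + length D) = ?c" using dem[of 0] by (simp add: encode_demands_eq)
    fix i assume i: "i < ?c"
    show "?s 0 (2 + ?n * ?n + length D + 1 + (i + i)) + 2 = active_label G i"
      unfolding active_label_def using dem[of "1 + (i + i)"] nth_encode_demands(1)[OF i] i by (simp add: add.assoc)
    show "?s 0 (2 + ?n * ?n + length D + 2 + (i + i)) = active_demand G i"
      unfolding active_demand_def using dem[of "2 + (i + i)"] nth_encode_demands(2)[OF i] i by (simp add: add.assoc)
  next
    fix u assume "u < ?n"
    then show "problem_degree P u = (if ?s 0 0 = 0 then 1 else ?s 0 (2 + ?n * ?n + u))"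
      using degD[of u] deg[of u] s0 lenD by simp
  qed (use s0 mat in simp_all)
qed

abbreviation tape_prefix :: "bool stream \<Rightarrow> bool list" where
  "tape_prefix \<omega> \<equiv> stake (length ids * nbits) \<omega>"

lemma exec_program:
  assumes "nverts G + length (active G) + place (length (active G)) + 2 \<le> y"
  shows "\<exists>t s' \<omega>'. exec factor_program (init_mem (encode P)) \<omega> t s' \<omega>' \<and>
    t \<le> cost factor_program * Suc (y ^ 40) ^ depth factor_program \<and>
    outcome (tape_prefix \<omega>) s'"
proof -
  have "init_mem (encode P) 1 0 = 0" "init_mem (encode P) 15 = (\<lambda>_. 0)"
    by (simp_all add: init_mem_def)
  from wp_program[OF reads_input_encode this loop_bound_power[OF assms]]
  show ?thesis unfolding wp_def .
qed

lemma cand_pairs: "cand bs w \<subseteq> pairs"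
  by (auto simp: cand_def)

text \<open>Determinism identifies the given run with the one described by
  \<open>exec_program\<close>.\<close>

lemma returns_solves: "returns factor_program P \<omega> F \<Longrightarrow> solves F P"
proof -
  assume "returns factor_program P \<omega> F"
  then obtain t s \<omega>' where e: "exec factor_program (init_mem (encode P)) \<omega> t s \<omega>'" "out_edges s = Some F"
    unfolding returns_def by blast
  obtain t' s' \<omega>'' where e': "exec factor_program (init_mem (encode P)) \<omega> t' s' \<omega>''"
    "outcome (tape_prefix \<omega>) s'"
    using exec_program[OF order_refl, of \<omega>] by blast
  have "s = s'" using exec_deterministic[OF e(1) e'(1)] by simp
  then show ?thesis using e(2) e'(2) solves_iff[OF cand_pairs] by (auto simp: outcome_def)
qed

text \<open>Turns success into a condition on a finite tape prefix, hence into a measurable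
  event.\<close>

lemma returns_iff:
  "(\<exists>F. returns factor_program P \<omega> F \<and> solves F P) \<longleftrightarrow> (\<exists>w<modulus. solution (cand (tape_prefix \<omega>) w))"
proof -
  obtain t s \<omega>' where e: "exec factor_program (init_mem (encode P)) \<omega> t s \<omega>'"
    "outcome (tape_prefix \<omega>) s"
    using exec_program[OF order_refl, of \<omega>] by blast
  have r: "returns factor_program P \<omega> F \<longleftrightarrow> out_edges s = Some F" for F
    unfolding returns_def using e(1) exec_deterministic[OF e(1)] by blast
  show ?thesis
  proof (cases "out_edges s")
    case None
    then show ?thesis using e(2) r by (simp add: outcome_def)
  next
    case (Some F)
    then have "returns factor_program P \<omega> F" using r by simp
    moreover from this have "solves F P" by (rule returns_solves)
    ultimately show ?thesis using e(2) Some by (auto simp: outcome_def)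
  qed
qed

lemma prob_returns:
  assumes "solves F P" "0 < nverts G"
  shows "measure coin_tape {\<omega>. \<exists>F. returns factor_program P \<omega> F \<and> solves F P} \<ge> 1 - 1 / real (nverts G)"
proof -
  obtain S where S: "solution S" using solves_imp_solution[OF assms(1)] by blast
  have "1 - 1 / real (nverts G) \<le> measure coin_tape {\<omega>. isolating family (random_weight (tape_prefix \<omega>))}"
    by (rule prob_candidate[OF S assms(2)])
  also have "\<dots> \<le> measure coin_tape {\<omega>. \<exists>w<modulus. solution (cand (tape_prefix \<omega>) w)}"
  proof (rule finite_measure.finite_measure_mono[OF prob_space.finite_measure[OF prob_space_coin_tape]])
    show "{\<omega>. isolating family (random_weight (tape_prefix \<omega>))} \<subseteq> {\<omega>. \<exists>w<modulus. solution (cand (tape_prefix \<omega>) w)}"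
      using isolating_imp_candidate[OF S] by blast
    show "{\<omega>. \<exists>w<modulus. solution (cand (tape_prefix \<omega>) w)} \<in> sets coin_tape"
      using stake_sets[of "length ids * nbits" "{bs. \<exists>w<modulus. solution (cand bs w)}"] by simp
  qed
  finally show ?thesis unfolding returns_iff .
qed

lemma halts_within_program:
  fixes r :: "real poly"
  assumes "real (nverts G + length (active G) + place (length (active G)) + 2) \<le> poly r (real (nverts G))"
  shows "halts_within factor_program P
    (poly (time_poly r) (real (nverts G)))"
proof -
  define y where "y = nverts G + length (active G) + place (length (active G)) + 2"
  have "real (Suc (y ^ 40)) \<le> poly (1 + r ^ 40) (real (nverts G))"
    using power_mono[OF assms, of 40] by (simp add: y_def)
  then have "real (Suc (y ^ 40)) ^ depth factor_program \<le>
      poly (1 + r ^ 40) (real (nverts G)) ^ depth factor_program"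
    by (rule power_mono) simp
  then have b: "real (cost factor_program * Suc (y ^ 40) ^ depth factor_program) \<le>
      poly (time_poly r) (real (nverts G))"
    by (simp add: mult_left_mono del: of_nat_Suc)
  show ?thesis unfolding halts_within_def
  proof
    fix \<omega>
    obtain t s' \<omega>' where t: "exec factor_program (init_mem (encode P)) \<omega> t s' \<omega>'"
      "t \<le> cost factor_program * Suc (y ^ 40) ^ depth factor_program"
      using exec_program[of y \<omega>] unfolding y_def by blast
    have "real t \<le> poly (time_poly r) (real (nverts G))"
      using t(2) b by (meson of_nat_le_iff order_trans)
    then show "\<exists>t s \<omega>'. exec factor_program (init_mem (encode P)) \<omega> t s \<omega>' \<and>
      real t \<le> poly (time_poly r) (real (nverts G))"
      using t(1) by blast
  qed
qed

text \<open>Each active demand contributes a factor of at least 2, and \<open>c \<le> 2 ^ c\<close>;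
  capping can only shrink the factors.\<close>

lemma size_le_demand_product:
  "length (active G) \<le> demand_product G" "place (length (active G)) \<le> demand_product G"
proof -
  have "length (active G) \<le> 2 ^ length (active G)" by (rule less_imp_le[OF less_exp])
  also have "\<dots> = (\<Prod>i<length (active G). 2)" by simp
  also have "\<dots> \<le> demand_product G"
    unfolding prod_active[symmetric]
  proof (rule prod_mono)
    fix i assume "i \<in> {..<length (active G)}"
    then show "0 \<le> (2 :: nat) \<and> 2 \<le> active_demand G i + 1" using dm_pos[of i] by simp
  qed
  finally show "length (active G) \<le> demand_product G" .
  show "place (length (active G)) \<le> demand_product G"
    unfolding prod_active[symmetric] place_def by (rule prod_mono) (simp add: demand_cap_def)
qed

text \<open>The bound does not involve the demands. So with boundedly many sets the time is
  polynomial even if huge demands make the product of the \<open>m_j + 1\<close>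
  superpolynomial.\<close>

lemma place_le_power: "place i \<le> (2 * (nverts G * nverts G) + 1) ^ i"
proof -
  have "(\<Sum>u<nverts G. nverts G - problem_degree P u) \<le> (\<Sum>u<nverts G. nverts G)" by (rule sum_mono) simp
  then have "order \<le> 2 * (nverts G * nverts G)" by (simp add: order_def)
  then have "place i \<le> (\<Prod>i'<i. 2 * (nverts G * nverts G) + 1)"
    unfolding place_def by (intro prod_mono) (simp add: demand_cap_def min.coboundedI2)
  then show ?thesis by simp
qed

end

text \<open>A demand not exceeding the size of its set is at most the number of edges, hence at most
  the square of the number of vertices.\<close>

lemma demand_product_bounded:
  assumes wf: "wf_dom_graph G" and K: "nsets G \<le> K"
    and d: "\<And>j. j < nsets G \<Longrightarrow> demand G j \<le> card (prescribed G j)"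
  shows "demand_product G \<le> (nverts G * nverts G + 1) ^ K"
proof -
  have sub: "edges G \<subseteq> (\<lambda>(u, v). {u, v}) ` ({..<nverts G} \<times> {..<nverts G})"
  proof
    fix e assume "e \<in> edges G"
    then obtain u v where "e = {u, v}" "u < nverts G" "v < nverts G" using wf unfolding wf_dom_graph_def by blast
    then show "e \<in> (\<lambda>(u, v). {u, v}) ` ({..<nverts G} \<times> {..<nverts G})" by (intro image_eqI[of _ _ "(u, v)"]) auto
  qed
  then have fin: "finite (edges G)" by (rule finite_subset) simp
  have "card (edges G) \<le> card ((\<lambda>(u, v). {u, v}) ` ({..<nverts G} \<times> {..<nverts G}))"
    by (rule card_mono[OF _ sub]) simp
  also have "\<dots> \<le> card ({..<nverts G} \<times> {..<nverts G})" by (rule card_image_le) simp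
  finally have e: "card (edges G) \<le> nverts G * nverts G" by simp
  have "demand G j \<le> nverts G * nverts G" if "j < nsets G" for j
  proof -
    have "prescribed G j \<subseteq> edges G" using wf that by (simp add: wf_dom_graph_def)
    then have "card (prescribed G j) \<le> card (edges G)" by (rule card_mono[OF fin])
    then show ?thesis using d[OF that] e by simp
  qed
  then have "demand_product G \<le> (\<Prod>j<nsets G. nverts G * nverts G + 1)"
    unfolding demand_product_def by (intro prod_mono) simp
  also have "\<dots> = (nverts G * nverts G + 1) ^ nsets G" by simp
  also have "\<dots> \<le> (nverts G * nverts G + 1) ^ K" by (rule power_increasing[OF K]) simp
  finally show ?thesis .
qed

text \<open>The second running time clause covers boundedly many sets with arbitrary demands. The
  last conjunct bounds the product itself, for demands that do not exceed the sizes of their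
  sets.\<close>

theorem theorem2:
  "(\<exists>A :: com.
      (\<forall>(p :: real poly) (C :: real). \<exists>q :: real poly. \<forall>P.
         wf_problem P \<and> real (demand_product (graph P)) \<le> C * poly p (real (nverts (graph P))) \<longrightarrow>
         halts_within A P (poly q (real (nverts (graph P))))) \<and>
      (\<forall>K :: nat. \<exists>q :: real poly. \<forall>P.
         wf_problem P \<and> nsets (graph P) \<le> K \<longrightarrow>
         halts_within A P (poly q (real (nverts (graph P))))) \<and>
      (\<forall>P \<omega> F. wf_problem P \<and> returns A P \<omega> F \<longrightarrow> solves F P) \<and>
      (\<exists>\<epsilon> :: nat \<Rightarrow> real. \<epsilon> \<longlonglongrightarrow> 0 \<and>
         (\<forall>P. wf_problem P \<and> (\<exists>F. solves F P) \<longrightarrow>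
            measure coin_tape {\<omega>. \<exists>F. returns A P \<omega> F \<and> solves F P}
              \<ge> 1 - \<epsilon> (nverts (graph P))))) \<and>
   (\<forall>K :: nat. \<exists>p :: real poly. \<forall>G.
      wf_dom_graph G \<and> nsets G \<le> K \<and> (\<forall>j<nsets G. demand G j \<le> card (prescribed G j)) \<longrightarrow>
      real (demand_product G) \<le> poly p (real (nverts G)))"
proof (intro conjI exI[of _ factor_program] allI)
  fix p :: "real poly" and C :: real
  \<comment> \<open>The demand product, bounded by \<open>C * p\<close>, enters twice: it bounds
    both the number of active sets and \<open>place\<close>.\<close>
  let ?r = "[:2, 1:] + smult (2 * C) p"
  show "\<exists>q :: real poly. \<forall>P.
     wf_problem P \<and> real (demand_product (graph P)) \<le> C * poly p (real (nverts (graph P))) \<longrightarrow>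
     halts_within factor_program P (poly q (real (nverts (graph P))))"
  proof (intro exI allI impI)
    fix P assume a: "wf_problem P \<and> real (demand_product (graph P)) \<le> C * poly p (real (nverts (graph P)))"
    interpret wf_instance P using a by unfold_locales blast
    show "halts_within factor_program P
      (poly (time_poly ?r) (real (nverts (graph P))))"
      by (rule halts_within_program) (use a size_le_demand_product in simp)
  qed
next
  fix K :: nat
  \<comment> \<open>\<open>K\<close> bounds the number of active sets, and the power is the bound
    from \<open>place_le_power\<close>.\<close>
  let ?r = "[:real K + 2, 1:] + [:1, 0, 2:] ^ K :: real poly"
  show "\<exists>q :: real poly. \<forall>P. wf_problem P \<and> nsets (graph P) \<le> K \<longrightarrow>
     halts_within factor_program P (poly q (real (nverts (graph P))))"
  proof (intro exI allI impI)
    fix P assume a: "wf_problem P \<and> nsets (graph P) \<le> K"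
    interpret wf_instance P using a by unfold_locales blast
    have c: "length (active (graph P)) \<le> K" using length_active_le[of "graph P"] a by simp
    have "place (length (active (graph P))) \<le> (2 * (nverts (graph P) * nverts (graph P)) + 1) ^ length (active (graph P))"
      by (rule place_le_power)
    also have "\<dots> \<le> (2 * (nverts (graph P) * nverts (graph P)) + 1) ^ K" by (rule power_increasing[OF c]) simp
    finally have "real (place (length (active (graph P)))) \<le> real ((2 * (nverts (graph P) * nverts (graph P)) + 1) ^ K)"
      by (rule of_nat_mono)
    then have pl: "real (place (length (active (graph P)))) \<le> (1 + real (nverts (graph P)) * (real (nverts (graph P)) * 2)) ^ K"
      by (simp add: algebra_simps)
    show "halts_within factor_program P
      (poly (time_poly ?r) (real (nverts (graph P))))"
      by (rule halts_within_program) (use c pl in simp)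
  qed
next
  fix P \<omega> F
  show "wf_problem P \<and> returns factor_program P \<omega> F \<longrightarrow> solves F P"
    using wf_instance.returns_solves wf_instance.intro by blast
next
  show "\<exists>\<epsilon> :: nat \<Rightarrow> real. \<epsilon> \<longlonglongrightarrow> 0 \<and> (\<forall>P. wf_problem P \<and> (\<exists>F. solves F P) \<longrightarrow>
      measure coin_tape {\<omega>. \<exists>F. returns factor_program P \<omega> F \<and> solves F P} \<ge> 1 - \<epsilon> (nverts (graph P)))"
  \<comment> \<open>The value \<open>2 / (n + 1)\<close> dominates the failure bound
    \<open>1 / n\<close> for positive \<open>n\<close>; at \<open>n = 0\<close> it is 2, which makes
    the claim trivial.\<close>
  proof (intro exI[of _ "\<lambda>n. 2 * inverse (real (Suc n))"] conjI allI impI)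
    show "(\<lambda>n. 2 * inverse (real (Suc n))) \<longlonglongrightarrow> 0"
      by (rule tendsto_mult_right_zero[OF LIMSEQ_inverse_real_of_nat])
    fix P assume a: "wf_problem P \<and> (\<exists>F. solves F P)"
    then obtain F where F: "solves F P" by blast
    show "1 - 2 * inverse (real (Suc (nverts (graph P)))) \<le>
      measure coin_tape {\<omega>. \<exists>F. returns factor_program P \<omega> F \<and> solves F P}"
    proof (cases "nverts (graph P) = 0")
      case True
      have "1 - 2 * inverse (real (Suc (nverts (graph P)))) \<le> 0" using True by simp
      then show ?thesis using measure_nonneg order_trans by blast
    next
      case False
      then have "1 / real (nverts (graph P)) \<le> 2 * inverse (real (Suc (nverts (graph P))))" by (simp add: field_simps)
      then show ?thesis using wf_instance.prob_returns[of P F] F a False by (force simp: wf_instance_def)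
    qed
  qed
next
  fix K :: nat
  show "\<exists>p :: real poly. \<forall>G. wf_dom_graph G \<and> nsets G \<le> K \<and> (\<forall>j<nsets G. demand G j \<le> card (prescribed G j)) \<longrightarrow>
      real (demand_product G) \<le> poly p (real (nverts G))"
  proof (intro exI[of _ "[:1, 0, 1:] ^ K"] allI impI)
    fix G assume "wf_dom_graph G \<and> nsets G \<le> K \<and> (\<forall>j<nsets G. demand G j \<le> card (prescribed G j))"
    then have "demand_product G \<le> (nverts G * nverts G + 1) ^ K" by (intro demand_product_bounded) auto
    then have "real (demand_product G) \<le> real ((nverts G * nverts G + 1) ^ K)" by (rule of_nat_mono)
    then show "real (demand_product G) \<le> poly ([:1, 0, 1:] ^ K) (real (nverts G))" by (simp add: add.commute)
  qed
qed

end
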